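(* For each $n>0$, the $t$-graded DG algebra $R_n$ is quasi-isomorphic to its cohomology $H(R_n)$ (regarded as a $t$-graded DG algebra with zero differential).
   Context: Fix $n>0$; everything is over $\mathbb{F}_2$. For $0\le k\le n$ let $\mathcal{B}_{n,k}$ be the set of sequences $\mathbf{x}=(x_1<\dots<x_k)$ in $\{1,\dots,n\}$ ($\mathcal{B}_{n,0}=\{\emptyset\}$), and $\mathcal{B}_n=\bigsqcup_k\mathcal{B}_{n,k}$. **Quiver.** Vertices: $\mathcal{B}_n$. Loops: $\mathbf{x}\xrightarrow{i}\mathbf{x}$ for $\mathbf{x}\in\mathcal{B}_{n,k}$, $1\le i\le k$. Arrows (elementary decorated rook diagrams): $\mathbf{x}\xrightarrow{i,s_1,\mathbf{v}}\mathbf{y}$ for $\mathbf{x},\mathbf{y}\in\mathcal{B}_{n,k}$, $s_1\ge0$, $1\le i\le i+s_1\le k$, with $y_i<x_i$, $y_{j+1}=x_j$ for $i\le j\le i+s_1-1$, and $y_j=x_j$ for $j\notin\{i,\dots,i+s_1\}$. Thus $\mathbf{y}$ is obtained from $\mathbf{x}$ by replacing the entry $q=x_{i+s_1}$ by a smaller number $p=y_i$ not in $\mathbf{x}$, and there is exactly one arrow for each such pair $(\mathbf{x},\mathbf{y})$. Here $\mathbf{v}=(x_i-y_i-1,\dots,x_{i+s_1}-y_{i+s_1}-1)$, and $s_0=s_0(\mathbf{v})$ is the sum of its entries. So $s_1$ (number of crossings) is the number of $m$ with $p<m<q$ that are in $\mathbf{x}$, and $s_0$ (number of markings) the number of such $m$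 not in $\mathbf{x}$. **The $t$-graded DG algebra $R_n$.** $R_n$ is the $\mathbb{F}_2$-algebra with orthogonal idempotents $e(\mathbf{x})$ summing to $1$, generators $\rho(\mathbf{x}\xrightarrow{i}\mathbf{x})=e(\mathbf{x})\rho(\mathbf{x}\xrightarrow{i}\mathbf{x})e(\mathbf{x})$ for loops and $r(\mathbf{x}\xrightarrow{i,s_1,\mathbf{v}}\mathbf{y})=e(\mathbf{x})\,r(\mathbf{x}\xrightarrow{i,s_1,\mathbf{v}}\mathbf{y})\,e(\mathbf{y})$ for arrows, and relations: - $\rho(\mathbf{x}\xrightarrow{i}\mathbf{x})^2=0$; - $\rho(\mathbf{x}\xrightarrow{i'}\mathbf{x})\rho(\mathbf{x}\xrightarrow{i}\mathbf{x})=\rho(\mathbf{x}\xrightarrow{i}\mathbf{x})\rho(\mathbf{x}\xrightarrow{i'}\mathbf{x})$ if $i\ne i'$; - $\rho(\mathbf{x}\xrightarrow{i'}\mathbf{x})\,r(\mathbf{x}\xrightarrow{i,s_1,\mathbf{v}}\mathbf{y})=r(\mathbf{x}\xrightarrow{i,s_1,\mathbf{v}}\mathbf{y})\,\rho(\mathbf{y}\xrightarrow{i'}\mathbf{y})$ if $i'\notin\{i,\dots,i+s_1\}$; - $r(\mathbf{x}\xrightarrow{i,s_1,\mathbf{v}}\mathbf{y})\,r(\mathbf{y}\xrightarrow{i',s_1',\mathbf{v}'}\mathbf{z})=r(\mathbf{x}\xrightarrow{i',s_1',\mathbf{v}'}\mathbf{w})\,r(\mathbf{w}\xrightarrow{i,s_1,\mathbf{v}}\mathbf{z})$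 if $x_{i+s_1}<z_{i'}$; - $\rho(\mathbf{x}\xrightarrow{i'}\mathbf{x})\,r(\mathbf{x}\xrightarrow{i,s_1,\mathbf{v}}\mathbf{y})=r(\mathbf{x}\xrightarrow{i,s_1,\mathbf{v}}\mathbf{y})\,\rho(\mathbf{y}\xrightarrow{i'+1}\mathbf{y})$ if $s_1>0$, $i'\in\{i,\dots,i+s_1-1\}$. Grading $(\deg_h,\deg_t)$ ($\deg_h$ cohomological, $\deg_t$ the $t$-grading): $(0,0)$ on $e(\mathbf{x})$, $(-1,-1)$ on loops, $(1-s_1,1+s_0)$ on $r(\mathbf{x}\xrightarrow{i,s_1,\mathbf{v}}\mathbf{y})$. The differential (of degree $(1,0)$) satisfies the Leibniz rule, vanishes on idempotents and loops, and on $r(\mathbf{x}\xrightarrow{i,s_1,\mathbf{v}}\mathbf{y})$ is the sum over resolutions of all markings and crossings. Writing $r(\mathbf{x}\to\mathbf{y})$ for the generator of the unique arrow from $\mathbf{x}$ to $\mathbf{y}$, and $p=y_i$, $q=x_{i+s_1}$: $$d\,r(\mathbf{x}\to\mathbf{y})=\sum_{p<m<q,\ m\notin\mathbf{x}}r(\mathbf{x}\to\mathbf{w}^m)\,r(\mathbf{w}^m\to\mathbf{y})+\sum_{s=0}^{s_1-1}\Big(\rho(\mathbf{x}\xrightarrow{i+s}\mathbf{x})\,r(\mathbf{x}\to\mathbf{z}^s)\,r(\mathbf{z}^s\to\mathbf{y})+r(\mathbf{x}\to\mathbf{z}^s)\,r(\mathbf{z}^s\to\mathbf{y})\,\rho(\mathbf{y}\xrightarrow{i+s+1}\mathbf{y})\Big),$$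 where $\mathbf{w}^m=(\mathbf{x}\setminus\{q\})\cup\{m\}$ and $\mathbf{z}^s=(\mathbf{x}\setminus\{x_{i+s}\})\cup\{p\}$. *)

theory Defs
  imports "HOL-Algebra.QuotRing" "HOL-Library.Poly_Mapping" "HOL-Library.Z2"
begin

section \<open>Bigraded differential graded algebras over the field with two elements\<close>

text \<open>
  An algebra over the two-element field is a unital, associative ring in which \<open>x + x = 0\<close>; linear
  maps are then the additive maps, and linear subspaces the additive subgroups. In
  \<open>homog A h t\<close>, \<open>h\<close> is the cohomological degree and \<open>t\<close> is the \<open>t\<close>-degree.
\<close>

record 'a tdga = "'a ring" +
  homog :: "int \<Rightarrow> int \<Rightarrow> 'a set"
  diff :: "'a \<Rightarrow> 'a"

locale tdg_algebra = ring A for A :: "'a tdga" (structure) +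
  assumes char_two: "x \<in> carrier A \<Longrightarrow> x \<oplus> x = \<zero>"
    and homog_subgroup: "additive_subgroup (homog A h t) A"
    and one_homog: "\<one> \<in> homog A 0 0"
    and mult_homog: "x \<in> homog A h t \<Longrightarrow> y \<in> homog A h' t' \<Longrightarrow> x \<otimes> y \<in> homog A (h + h') (t + t')"
    and direct_sum: "x \<in> carrier A \<Longrightarrow>
      \<exists>!c. (\<forall>h t. c (h, t) \<in> homog A h t) \<and> finite {p. c p \<noteq> \<zero>} \<and> x = (\<Oplus>p\<in>{p. c p \<noteq> \<zero>}. c p)"
    and diff_add: "x \<in> carrier A \<Longrightarrow> y \<in> carrier A \<Longrightarrow> diff A (x \<oplus> y) = diff A x \<oplus> diff A y"
    and diff_homog: "x \<in> homog A h t \<Longrightarrow> diff A x \<in> homog A (h + 1) t"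
    and diff_closed: "x \<in> carrier A \<Longrightarrow> diff A x \<in> carrier A"
    and diff_diff: "x \<in> carrier A \<Longrightarrow> diff A (diff A x) = \<zero>"
    and leibniz: "x \<in> carrier A \<Longrightarrow> y \<in> carrier A \<Longrightarrow>
      diff A (x \<otimes> y) = (diff A x \<otimes> y) \<oplus> (x \<otimes> diff A y)"

definition tdga_hom :: "'a tdga \<Rightarrow> 'b tdga \<Rightarrow> ('a \<Rightarrow> 'b) set" where
  "tdga_hom A B = {f \<in> ring_hom A B.
     (\<forall>h t. f ` homog A h t \<subseteq> homog B h t) \<and>
     (\<forall>x\<in>carrier A. f (diff A x) = diff B (f x))}"

definition cocycles :: "'a tdga \<Rightarrow> 'a set" where
  "cocycles A = {x \<in> carrier A. diff A x = \<zero>\<^bsub>A\<^esub>}"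

definition coboundaries :: "'a tdga \<Rightarrow> 'a set" where
  "coboundaries A = diff A ` carrier A"

definition cohomology_ring :: "'a tdga \<Rightarrow> 'a set ring" where
  "cohomology_ring A = (A\<lparr>carrier := cocycles A\<rparr>) Quot (coboundaries A)"

definition cohomology :: "'a tdga \<Rightarrow> 'a set tdga" where
  "cohomology A = ring.extend (cohomology_ring A)
     (tdga.fields
        (\<lambda>h t. (\<lambda>z. coboundaries A +>\<^bsub>A\<^esub> z) ` (cocycles A \<inter> homog A h t))
        (\<lambda>_. \<zero>\<^bsub>cohomology_ring A\<^esub>))"

definition cohomology_map :: "'b tdga \<Rightarrow> ('a \<Rightarrow> 'b) \<Rightarrow> 'a set \<Rightarrow> 'b set" where
  "cohomology_map B f X = (\<Union>z\<in>X. coboundaries B +>\<^bsub>B\<^esub> f z)"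

definition quasi_iso :: "'a tdga \<Rightarrow> 'b tdga \<Rightarrow> ('a \<Rightarrow> 'b) \<Rightarrow> bool" where
  "quasi_iso A B f \<longleftrightarrow> tdg_algebra A \<and> tdg_algebra B \<and> f \<in> tdga_hom A B \<and>
     bij_betw (cohomology_map B f) (carrier (cohomology A)) (carrier (cohomology B))"

definition quasi_iso_link :: "'a tdga \<Rightarrow> 'b tdga \<Rightarrow> bool" where
  "quasi_iso_link A B \<longleftrightarrow> (\<exists>f. quasi_iso A B f) \<or> (\<exists>g. quasi_iso B A g)"

text \<open>
  Quasi-isomorphic means connected by a finite zigzag of quasi-isomorphisms. The algebras strictly
  inside the zigzag have to live in one fixed type. No zigzag is lost by choosing
  \<open>('a + 'b) list\<close>: over a field any zigzag can be replaced by a span whose apex is a cofibrant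
  replacement of one of its ends, and such a replacement can be taken of cardinality at most the
  maximum of the cardinality of that end and \<open>\<aleph>\<^sub>0\<close>.
\<close>

definition quasi_isomorphic :: "'a tdga \<Rightarrow> 'b tdga \<Rightarrow> bool" where
  "quasi_isomorphic A B \<longleftrightarrow> quasi_iso_link A B \<or>
     (\<exists>C D :: ('a + 'b) list tdga.
        quasi_iso_link A C \<and> quasi_iso_link\<^sup>*\<^sup>* C D \<and> quasi_iso_link D B)"


section \<open>The quiver\<close>

text \<open>Entries of sequences are indexed from 1.\<close>

definition vertices :: "nat \<Rightarrow> nat list set" where
  "vertices n = {x. sorted_wrt (<) x \<and> set x \<subseteq> {1..n}}"

definition entry :: "nat list \<Rightarrow> nat \<Rightarrow> nat" where
  "entry x i = x ! (i - 1)"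

definition replace :: "nat \<Rightarrow> nat \<Rightarrow> nat list \<Rightarrow> nat list" where
  "replace q m x = sorted_list_of_set (insert m (set x - {q}))"

definition is_loop :: "nat \<Rightarrow> nat list \<Rightarrow> nat \<Rightarrow> bool" where
  "is_loop n x i \<longleftrightarrow> x \<in> vertices n \<and> 1 \<le> i \<and> i \<le> length x"

text \<open>The subtractions in \<open>v\<close> do not truncate, as \<open>y\<^sub>j < x\<^sub>j\<close> for \<open>i \<le> j \<le> i + s\<close>.\<close>

definition is_arrow ::
  "nat \<Rightarrow> nat list \<Rightarrow> nat \<Rightarrow> nat \<Rightarrow> nat list \<Rightarrow> nat list \<Rightarrow> bool" where
  "is_arrow n x i s v y \<longleftrightarrow>
     x \<in> vertices n \<and> y \<in> vertices n \<and> length x = length y \<and>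
     1 \<le> i \<and> i + s \<le> length x \<and>
     entry y i < entry x i \<and>
     (\<forall>j. i \<le> j \<and> j < i + s \<longrightarrow> entry y (j + 1) = entry x j) \<and>
     (\<forall>j. 1 \<le> j \<and> j \<le> length x \<and> j \<notin> {i..i + s} \<longrightarrow> entry y j = entry x j) \<and>
     v = map (\<lambda>j. entry x j - entry y j - 1) [i..<i + s + 1]"

datatype gen =
    Vertex "nat list"
  | Loop "nat list" nat
  | Arrow "nat list" nat nat "nat list" "nat list"

definition gens :: "nat \<Rightarrow> gen set" where
  "gens n = {Vertex x | x. x \<in> vertices n} \<union> {Loop x i | x i. is_loop n x i} \<union>
     {Arrow x i s v y | x i s v y. is_arrow n x i s v y}"


section \<open>The free algebra on the generators\<close>

text \<open>
  Words form an additively written monoid under concatenation, so that the convolution product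
  on finitely supported functions makes \<open>word \<Rightarrow>\<^sub>0 bit\<close> the free algebra on all letters.
\<close>

datatype word = Word (letters: "gen list")

instantiation word :: monoid_add
begin

definition zero_word :: word where "0 = Word []"

definition plus_word :: "word \<Rightarrow> word \<Rightarrow> word" where
  "u + w = Word (letters u @ letters w)"

instance
  by standard (simp_all add: zero_word_def plus_word_def)

end

type_synonym free = "word \<Rightarrow>\<^sub>0 bit"

definition free_alg :: "nat \<Rightarrow> free ring" where
  "free_alg n = \<lparr>carrier = {f. \<forall>w\<in>Poly_Mapping.keys f. set (letters w) \<subseteq> gens n},
     mult = (*), one = 1, zero = 0, add = (+)\<rparr>"

definition mono_word :: "gen list \<Rightarrow> free" where
  "mono_word gs = Poly_Mapping.single (Word gs) 1"

definition e_gen :: "nat list \<Rightarrow> free" where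
  "e_gen x = mono_word [Vertex x]"

definition rho :: "nat list \<Rightarrow> nat \<Rightarrow> free" where
  "rho x i = mono_word [Loop x i]"

definition r_gen :: "nat list \<Rightarrow> nat \<Rightarrow> nat \<Rightarrow> nat list \<Rightarrow> nat list \<Rightarrow> free" where
  "r_gen x i s v y = mono_word [Arrow x i s v y]"

text \<open>The generator of the unique arrow from \<open>x\<close> to \<open>y\<close>.\<close>

definition r_to :: "nat \<Rightarrow> nat list \<Rightarrow> nat list \<Rightarrow> free" where
  "r_to n x y = (THE a. \<exists>i s v. is_arrow n x i s v y \<and> a = r_gen x i s v y)"


section \<open>The algebra\<close>

text \<open>
  In \<open>arrow_arrow\<close> the sequence \<open>w\<close> exists and is unique whenever the first two arrows compose and the
  inequality holds; the two premises mentioning \<open>w\<close> only give it its name.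
\<close>

inductive_set relators :: "nat \<Rightarrow> free set" for n :: nat where
  idem: "x \<in> vertices n \<Longrightarrow> e_gen x * e_gen x - e_gen x \<in> relators n"
| orth: "x \<in> vertices n \<Longrightarrow> y \<in> vertices n \<Longrightarrow> x \<noteq> y \<Longrightarrow> e_gen x * e_gen y \<in> relators n"
| unit: "(\<Sum>x\<in>vertices n. e_gen x) - 1 \<in> relators n"
| loop_ends: "is_loop n x i \<Longrightarrow> rho x i - e_gen x * rho x i * e_gen x \<in> relators n"
| arrow_ends: "is_arrow n x i s v y \<Longrightarrow> r_gen x i s v y - e_gen x * r_gen x i s v y * e_gen y \<in> relators n"
| loop_square: "is_loop n x i \<Longrightarrow> rho x i * rho x i \<in> relators n"
| loop_loop: "is_loop n x i \<Longrightarrow> is_loop n x i' \<Longrightarrow> i \<noteq> i' \<Longrightarrow>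
    rho x i' * rho x i - rho x i * rho x i' \<in> relators n"
| loop_arrow: "is_arrow n x i s v y \<Longrightarrow> is_loop n x i' \<Longrightarrow> i' \<notin> {i..i + s} \<Longrightarrow>
    rho x i' * r_gen x i s v y - r_gen x i s v y * rho y i' \<in> relators n"
| arrow_arrow: "is_arrow n x i s v y \<Longrightarrow> is_arrow n y i' s' v' z \<Longrightarrow>
    is_arrow n x i' s' v' w \<Longrightarrow> is_arrow n w i s v z \<Longrightarrow> entry x (i + s) < entry z i' \<Longrightarrow>
    r_gen x i s v y * r_gen y i' s' v' z - r_gen x i' s' v' w * r_gen w i s v z \<in> relators n"
| loop_crossing: "is_arrow n x i s v y \<Longrightarrow> s > 0 \<Longrightarrow> i \<le> i' \<Longrightarrow> i' < i + s \<Longrightarrow>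
    rho x i' * r_gen x i s v y - r_gen x i s v y * rho y (i' + 1) \<in> relators n"

fun deg_h :: "gen \<Rightarrow> int" where
  "deg_h (Vertex x) = 0"
| "deg_h (Loop x i) = - 1"
| "deg_h (Arrow x i s v y) = 1 - int s"

fun deg_t :: "gen \<Rightarrow> int" where
  "deg_t (Vertex x) = 0"
| "deg_t (Loop x i) = - 1"
| "deg_t (Arrow x i s v y) = 1 + int (sum_list v)"

definition free_homog :: "nat \<Rightarrow> int \<Rightarrow> int \<Rightarrow> free set" where
  "free_homog n h t = {f \<in> carrier (free_alg n). \<forall>w\<in>Poly_Mapping.keys f.
     sum_list (map deg_h (letters w)) = h \<and> sum_list (map deg_t (letters w)) = t}"

fun diff_gen :: "nat \<Rightarrow> gen \<Rightarrow> free" where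
  "diff_gen n (Vertex x) = 0"
| "diff_gen n (Loop x i) = 0"
| "diff_gen n (Arrow x i s v y) =
    (let p = entry y i; q = entry x (i + s) in
      (\<Sum>m\<in>{p<..<q} - set x. r_to n x (replace q m x) * r_to n (replace q m x) y) +
      (\<Sum>j<s. let z = replace (entry x (i + j)) p x in
         rho x (i + j) * r_to n x z * r_to n z y +
         r_to n x z * r_to n z y * rho y (i + j + 1)))"

text \<open>
  The derivation of the free algebra extending \<open>diff_gen\<close>; every coefficient on the support of an
  element is 1.
\<close>

definition diff_word :: "nat \<Rightarrow> gen list \<Rightarrow> free" where
  "diff_word n gs =
     (\<Sum>j<length gs. mono_word (take j gs) * diff_gen n (gs ! j) * mono_word (drop (Suc j) gs))"

definition diff_free :: "nat \<Rightarrow> free \<Rightarrow> free" where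
  "diff_free n f = (\<Sum>w\<in>Poly_Mapping.keys f. diff_word n (letters w))"

definition rel_ideal :: "nat \<Rightarrow> free set" where
  "rel_ideal n = Idl\<^bsub>free_alg n\<^esub> (relators n)"

definition R_alg :: "nat \<Rightarrow> free set tdga" where
  "R_alg n = ring.extend (free_alg n Quot rel_ideal n)
     (tdga.fields
        (\<lambda>h t. (\<lambda>f. rel_ideal n +>\<^bsub>free_alg n\<^esub> f) ` free_homog n h t)
        (\<lambda>X. \<Union>f\<in>X. rel_ideal n +>\<^bsub>free_alg n\<^esub> diff_free n f))"

end

theory Submission
  imports Defs
begin

text \<open>
  Call \<open>deg\<^sub>h - deg\<^sub>t\<close> the weight. An arrow moving an entry from \<open>q\<close> to \<open>p\<close> has weight
  \<open>- (q - p - 1)\<close> and a loop has weight \<open>0\<close>, so all weights are at most \<open>0\<close>, and the differential raises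
  the weight by one. Hence, as soon as the cohomology vanishes in negative weights, sending an element to
  the class of its component of weight \<open>0\<close> is a homomorphism of differential graded algebras from the
  algebra to its cohomology, and it is a quasi-isomorphism (\<open>formality_criterion\<close>).

  To show this vanishing, record for each number \<open>m\<close> in \<open>{1..n}\<close>, called a site, what a path in the
  quiver does there: an entry equal to \<open>m\<close> carries a loop (\<open>Dot\<close>), an entry leaves \<open>m\<close> or arrives at \<open>m\<close>
  (\<open>Leave\<close>, \<open>Arrive\<close>), or an entry jumps over \<open>m\<close>, which is then itself an entry (\<open>Cross\<close>) or not
  (\<open>Mark\<close>). The relations only allow letters at different sites to be interchanged, and at one site
  \<open>Dot\<close> to be interchanged with \<open>Cross\<close> and \<open>Dot Dot\<close> to be replaced by zero. It follows that the algebra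
  has a basis of families of site words that fit together: the number of jumps over the edge between
  \<open>m\<close> and \<open>m + 1\<close> is the same seen from both ends (\<open>rel_ideal_iff\<close>, \<open>rep_sec\<close>). Here one inclusion is the
  construction of an action of the free algebra on such families that satisfies the relations; the other
  is a diamond argument, since two letters that can both be the first of a word for a given
  family commute (\<open>reach_unique\<close>).

  In this basis the differential is a sum of commuting differentials, one per site, given by
  \<open>Mark \<mapsto> Arrive Leave\<close> and \<open>Cross \<mapsto> Dot Leave Arrive + Leave Arrive Dot\<close>. So the algebra is a direct sum,
  over the numbers of jumps over the edges, of tensor products of complexes of words at one site. A single
  such complex may have cohomology in negative weight, but the numbers of jumps start and end with
  zero. If some edge is jumped over at least twice, then at the left end of the leftmost such edge sits
  the complex of words with one jump to the left and two to the right, which is acyclic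
  (\<open>qloc_21\<close>). Otherwise a negative weight comes from a word consisting, up to a \<open>Dot\<close>, of a single \<open>Cross\<close> or
  \<open>Mark\<close>, and the differential is injective on those (\<open>qloc_11\<close>). In both cases an explicit homotopy at that
  site gives the exactness (\<open>exact_below_diagonal\<close>).
\<close>

section \<open>Rings and cosets\<close>

lemma ring_extend_simps [simp]:
  "carrier (ring.extend R (tdga.fields H D)) = carrier R"
  "mult (ring.extend R (tdga.fields H D)) = mult R"
  "one (ring.extend R (tdga.fields H D)) = one R"
  "zero (ring.extend R (tdga.fields H D)) = zero R"
  "add (ring.extend R (tdga.fields H D)) = add R"
  "homog (ring.extend R (tdga.fields H D)) = H"
  "diff (ring.extend R (tdga.fields H D)) = D"
  by (simp_all add: ring.extend_def tdga.fields_def)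

lemma ring_cong:
  assumes "ring R" "carrier S = carrier R" "mult S = mult R" "one S = one R"
    "add S = add R" "zero S = zero R"
  shows "ring S"
proof -
  interpret R: ring R by fact
  show ?thesis
    by (rule ringI, rule abelian_groupI, rule_tac [7] Group.monoidI, unfold assms)
      (auto simp: R.a_ac R.m_assoc R.l_distr R.r_distr intro: R.add.l_inv_ex)
qed

lemma (in abelian_group_hom) hom_finsum:
  assumes "finite S" "f \<in> S \<rightarrow> carrier G"
  shows "h (finsum G f S) = finsum H (\<lambda>s. h (f s)) S"
  using assms by (induction S) (auto simp: Pi_def)

lemma (in abelian_group) coset_eq_iff_char_two:
  assumes I: "additive_subgroup I G" and two: "\<And>x. x \<in> carrier G \<Longrightarrow> x \<oplus> x = \<zero>"
    and xy: "x \<in> carrier G" "y \<in> carrier G"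
  shows "I +> x = I +> y \<longleftrightarrow> x \<oplus> y \<in> I"
proof -
  interpret I: additive_subgroup I G by fact
  have canc: "(a \<oplus> b) \<oplus> b = a" if "a \<in> carrier G" "b \<in> carrier G" for a b
    using that by (simp add: a_assoc two)
  have mem: "x \<in> I +> y \<longleftrightarrow> x \<oplus> y \<in> I"
  proof
    assume "x \<in> I +> y"
    then obtain i where "i \<in> I" "x = i \<oplus> y" by (auto simp: a_r_coset_def')
    then show "x \<oplus> y \<in> I" using canc xy by simp
  next
    assume "x \<oplus> y \<in> I"
    moreover have "x = (x \<oplus> y) \<oplus> y" using canc xy by simp
    ultimately show "x \<in> I +> y" by (force simp: a_r_coset_def')
  qed
  have "x = \<zero> \<oplus> x" using xy by simp
  then have "x \<in> I +> x" using I.zero_closed by (force simp: a_r_coset_def')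
  then show ?thesis
    using mem a_repr_independence[OF _ xy(2) I.a_subgroup] by metis
qed

section \<open>Graded abelian groups\<close>

text \<open>\<open>c\<close> lists the homogeneous components of \<open>x\<close>, all but finitely many of them zero.\<close>

definition decomposes :: "('a, 'b) ring_scheme \<Rightarrow> ('i \<Rightarrow> 'a set) \<Rightarrow> ('i \<Rightarrow> 'a) \<Rightarrow> 'a \<Rightarrow> bool" where
  "decomposes G H c x \<longleftrightarrow> (\<forall>p. c p \<in> H p) \<and> finite {p. c p \<noteq> \<zero>\<^bsub>G\<^esub>} \<and>
     x = (\<Oplus>\<^bsub>G\<^esub>p\<in>{p. c p \<noteq> \<zero>\<^bsub>G\<^esub>}. c p)"

text \<open>An internal direct sum, presented by its projections.\<close>

locale graded_group = abelian_group G for G (structure) +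
  fixes H :: "'i \<Rightarrow> 'a set" and pr :: "'i \<Rightarrow> 'a \<Rightarrow> 'a"
  assumes H_subgroup: "additive_subgroup (H p) G"
    and pr_homog: "x \<in> carrier G \<Longrightarrow> pr p x \<in> H p"
    and pr_add: "x \<in> carrier G \<Longrightarrow> y \<in> carrier G \<Longrightarrow> pr p (x \<oplus> y) = pr p x \<oplus> pr p y"
    and pr_same: "x \<in> H p \<Longrightarrow> pr p x = x"
    and pr_other: "x \<in> H p \<Longrightarrow> q \<noteq> p \<Longrightarrow> pr q x = \<zero>"
    and pr_finite: "x \<in> carrier G \<Longrightarrow> finite {p. pr p x \<noteq> \<zero>}"
    and pr_sum: "x \<in> carrier G \<Longrightarrow> x = (\<Oplus>p\<in>{p. pr p x \<noteq> \<zero>}. pr p x)"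
begin

lemma H_closed: "x \<in> H p \<Longrightarrow> x \<in> carrier G"
  using H_subgroup additive_subgroup.a_subset by blast

lemma H_zero: "\<zero> \<in> H p"
  by (rule additive_subgroup.zero_closed[OF H_subgroup])

lemma pr_closed: "x \<in> carrier G \<Longrightarrow> pr p x \<in> carrier G"
  using pr_homog H_closed by blast

lemma pr_zero: "pr p \<zero> = \<zero>"
  using pr_same H_zero by blast

lemma pr_hom: "pr p \<in> hom (add_monoid G) (add_monoid G)"
  by (simp add: hom_def pr_closed pr_add)

lemma pr_abelian_group_hom: "abelian_group_hom G G (pr p)"
  by (intro abelian_group_homI abelian_group_axioms group_hom.intro group_hom_axioms.intro
      a_group pr_hom)

lemma homog_induct [consumes 1, case_names zero homog add]:
  assumes "x \<in> carrier G" "P \<zero>" "\<And>p x. x \<in> H p \<Longrightarrow> P x"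
    "\<And>x y. x \<in> carrier G \<Longrightarrow> y \<in> carrier G \<Longrightarrow> P x \<Longrightarrow> P y \<Longrightarrow> P (x \<oplus> y)"
  shows "P x"
proof -
  have "finite S \<Longrightarrow> P (\<Oplus>p\<in>S. pr p x)" for S
  proof (induction S rule: finite_induct)
    case (insert a S)
    then show ?case
      using assms pr_homog[OF assms(1), of a] by (auto simp: pr_closed)
  qed (use assms in auto)
  then show ?thesis
    using pr_sum[OF assms(1)] pr_finite[OF assms(1)] by metis
qed

lemma decomposes_unique:
  assumes c: "decomposes G H c x"
  shows "c = (\<lambda>p. pr p x)"
proof
  fix q
  let ?S = "{p. c p \<noteq> \<zero>}"
  have cH: "c p \<in> H p" for p
    using c by (auto simp: decomposes_def)
  have fin: "finite ?S" and x: "x = (\<Oplus>p\<in>?S. c p)"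
    using c by (simp_all add: decomposes_def)
  have cc: "c p \<in> carrier G" for p
    using cH H_closed by blast
  have prc: "pr q (c p) = (if q = p then c p else \<zero>)" for p
    using pr_same[OF cH] pr_other[OF cH, of q p] by auto
  interpret q: abelian_group_hom G G "pr q" by (rule pr_abelian_group_hom)
  have "pr q x = (\<Oplus>p\<in>?S. if q = p then c p else \<zero>)"
    unfolding x using fin cc by (subst q.hom_finsum) (auto simp: prc)
  also have "\<dots> = c q"
  proof (cases "c q = \<zero>")
    case True
    then have "(\<Oplus>p\<in>?S. if q = p then c p else \<zero>) = (\<Oplus>p\<in>?S. \<zero>)"
      by (intro finsum_cong') auto
    with True show ?thesis by simp
  next
    case False
    then show ?thesis
      using fin cc finsum_singleton[of q ?S c] by auto
  qed
  finally show "c q = pr q x" by simp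
qed

lemma decomposes_pr: "x \<in> carrier G \<Longrightarrow> decomposes G H (\<lambda>p. pr p x) x"
  using pr_sum by (simp add: decomposes_def pr_homog pr_finite)

lemma decomposes_ex1: "x \<in> carrier G \<Longrightarrow> \<exists>!c. decomposes G H c x"
  using decomposes_unique decomposes_pr by metis

end

lemma (in abelian_group) finsum_superset:
  assumes "finite S" "T \<subseteq> S" "\<And>p. p \<in> S - T \<Longrightarrow> c p = \<zero>" "\<And>p. c p \<in> carrier G"
  shows "(\<Oplus>p\<in>S. c p) = (\<Oplus>p\<in>T. c p)"
  using assms by (intro add.finprod_mono_neutral_cong_right) auto

lemma (in abelian_group) graded_groupI:
  assumes H: "\<And>p. additive_subgroup (H p) G"
    and ex1: "\<And>x. x \<in> carrier G \<Longrightarrow> \<exists>!c. decomposes G H c x"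
  shows "graded_group G H (\<lambda>p x. (THE c. decomposes G H c x) p)"
proof -
  define pr where "pr = (\<lambda>p x. (THE c. decomposes G H c x) p)"
  have dec: "decomposes G H (\<lambda>p. pr p x) x" if "x \<in> carrier G" for x
    using theI'[OF ex1[OF that]] by (simp add: pr_def)
  have uniq: "pr p x = c p" if "decomposes G H c x" "x \<in> carrier G" for c x p
    using the1_equality[OF ex1] that by (simp add: pr_def)
  have cl: "x \<in> H p \<Longrightarrow> x \<in> carrier G" for x p
    using H additive_subgroup.a_subset by blast
  have zero: "\<zero> \<in> H p" for p
    by (rule additive_subgroup.zero_closed[OF H])
  have add: "x \<in> H p \<Longrightarrow> y \<in> H p \<Longrightarrow> x \<oplus> y \<in> H p" for x y p
    by (rule additive_subgroup.a_closed[OF H])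
  have single: "decomposes G H (\<lambda>q. if q = p then x else \<zero>) x" if "x \<in> H p" for p x
  proof -
    have sub: "{q. (if q = p then x else \<zero>) \<noteq> \<zero>} \<subseteq> {p}" by auto
    have "(\<Oplus>q\<in>{p}. if q = p then x else \<zero>)
        = (\<Oplus>q\<in>{q. (if q = p then x else \<zero>) \<noteq> \<zero>}. if q = p then x else \<zero>)"
      using cl[OF that] by (intro finsum_superset[OF _ sub]) auto
    moreover have "(\<Oplus>q\<in>{p}. if q = p then x else \<zero>) = x" using cl[OF that] by simp
    ultimately show ?thesis
      unfolding decomposes_def using that zero finite_subset[OF sub] by simp
  qed
  have "graded_group G H pr"
  proof (intro graded_group.intro graded_group_axioms.intro abelian_group_axioms)
    fix x y p assume xy: "x \<in> carrier G" "y \<in> carrier G"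
    have dx: "pr q x \<in> H q" "finite {q. pr q x \<noteq> \<zero>}" "x = (\<Oplus>p\<in>{p. pr p x \<noteq> \<zero>}. pr p x)" for q
      using dec[OF xy(1)] by (auto simp: decomposes_def)
    have dy: "pr q y \<in> H q" "finite {q. pr q y \<noteq> \<zero>}" "y = (\<Oplus>p\<in>{p. pr p y \<noteq> \<zero>}. pr p y)" for q
      using dec[OF xy(2)] by (auto simp: decomposes_def)
    let ?S = "{q. pr q x \<noteq> \<zero>} \<union> {q. pr q y \<noteq> \<zero>}"
    have fin: "finite ?S" using dx dy by simp
    have sub: "{q. pr q x \<oplus> pr q y \<noteq> \<zero>} \<subseteq> ?S" by auto
    have "x = (\<Oplus>p\<in>?S. pr p x)"
      using fin cl[OF dx(1)] by (subst dx(3), intro finsum_superset[symmetric]) auto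
    moreover have "y = (\<Oplus>p\<in>?S. pr p y)"
      using fin cl[OF dy(1)] by (subst dy(3), intro finsum_superset[symmetric]) auto
    ultimately have "x \<oplus> y = (\<Oplus>p\<in>?S. pr p x) \<oplus> (\<Oplus>p\<in>?S. pr p y)" by simp
    also have "\<dots> = (\<Oplus>p\<in>?S. pr p x \<oplus> pr p y)"
      using cl[OF dx(1)] cl[OF dy(1)] by (intro finsum_addf[symmetric]) auto
    also have "\<dots> = (\<Oplus>p\<in>{q. pr q x \<oplus> pr q y \<noteq> \<zero>}. pr p x \<oplus> pr p y)"
      using fin sub cl[OF dx(1)] cl[OF dy(1)] by (intro finsum_superset) auto
    finally have "decomposes G H (\<lambda>q. pr q x \<oplus> pr q y) (x \<oplus> y)"
      using add dx(1) dy(1) finite_subset[OF sub fin] by (simp add: decomposes_def)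
    then show "pr p (x \<oplus> y) = pr p x \<oplus> pr p y"
      using xy uniq by simp
  next
    fix x p assume "x \<in> H p"
    then show "pr p x = x" using uniq[OF single] cl by simp
  next
    fix x p q assume "x \<in> H p" "q \<noteq> p"
    then show "pr q x = \<zero>" using uniq[OF single] cl by simp
  qed (use H dec in \<open>auto simp: decomposes_def\<close>)
  then show ?thesis by (simp add: pr_def)
qed

section \<open>Quotients of graded algebras\<close>

text \<open>The quotient of a graded ring \<open>F\<close> by a homogeneous ideal \<open>I\<close>, with the differential \<open>D\<close> induced by
  a derivation \<open>d\<close> of \<open>F\<close> whose square and whose failure to be homogeneous lie in \<open>I\<close>. It produces both
  the algebra itself, from the free algebra, and the cohomology, from the cocycles with \<open>d = 0\<close>.\<close>

lemma quotient_tdg_algebra: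
  fixes F :: "('a, 'b) ring_scheme" (structure)
    and H :: "int \<Rightarrow> int \<Rightarrow> 'a set" and D :: "'a set \<Rightarrow> 'a set"
  assumes I: "ideal I F"
    and gr: "graded_group F (\<lambda>(h, t). H h t) pr"
    and pr_I: "\<And>p x. x \<in> I \<Longrightarrow> pr p x \<in> I"
    and char_two: "\<And>x. x \<in> carrier F \<Longrightarrow> x \<oplus> x = \<zero>"
    and one: "\<one> \<in> H 0 0"
    and mult: "\<And>x y h t h' t'. x \<in> H h t \<Longrightarrow> y \<in> H h' t' \<Longrightarrow> x \<otimes> y \<in> H (h + h') (t + t')"
    and d_closed: "\<And>x. x \<in> carrier F \<Longrightarrow> d x \<in> carrier F"
    and d_add: "\<And>x y. x \<in> carrier F \<Longrightarrow> y \<in> carrier F \<Longrightarrow> d (x \<oplus> y) = d x \<oplus> d y"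
    and d_homog: "\<And>x h t. x \<in> H h t \<Longrightarrow> I +> d x \<in> (+>) I ` H (h + 1) t"
    and d_d: "\<And>x. x \<in> carrier F \<Longrightarrow> d (d x) \<in> I"
    and leibniz: "\<And>x y. x \<in> carrier F \<Longrightarrow> y \<in> carrier F \<Longrightarrow>
        d (x \<otimes> y) = (d x \<otimes> y) \<oplus> (x \<otimes> d y)"
    and D: "\<And>x. x \<in> carrier F \<Longrightarrow> D (I +> x) = I +> d x"
  shows "tdg_algebra (ring.extend (F Quot I) (tdga.fields (\<lambda>h t. (+>) I ` H h t) D))"
    (is "tdg_algebra ?Q")
proof -
  interpret I: ideal I F by fact
  interpret F: graded_group F "\<lambda>(h, t). H h t" pr by fact
  let ?H = "\<lambda>(h, t). H h t"
  have Hc: "x \<in> H h t \<Longrightarrow> x \<in> carrier F" for x h t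
    using F.H_closed[of x "(h, t)"] by simp
  have "ring ?Q" by (rule ring_cong[OF I.quotient_is_ring]) simp_all
  then interpret Q: ring ?Q .
  have car: "carrier ?Q = (+>) I ` carrier F"
    unfolding ring_extend_simps by (auto simp: FactRing_simps)
  have addQ: "(I +> x) \<oplus>\<^bsub>?Q\<^esub> (I +> y) = I +> (x \<oplus> y)"
    if "x \<in> carrier F" "y \<in> carrier F" for x y
    using that by (simp add: FactRing_simps I.a_rcos_sum)
  have multQ: "(I +> x) \<otimes>\<^bsub>?Q\<^esub> (I +> y) = I +> (x \<otimes> y)"
    if "x \<in> carrier F" "y \<in> carrier F" for x y
    using that by (simp add: FactRing_simps I.rcoset_mult_add)
  have zeroQ: "\<zero>\<^bsub>?Q\<^esub> = I" "I +> \<zero> = I"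
    by (simp_all add: FactRing_simps I.a_subset)
  have eq_iff: "I +> x = I +> y \<longleftrightarrow> x \<oplus> y \<in> I" if "x \<in> carrier F" "y \<in> carrier F" for x y
    using I.coset_eq_iff_char_two[OF I.additive_subgroup_axioms char_two that] .
  have zero_iff: "I +> x = I \<longleftrightarrow> x \<in> I" if "x \<in> carrier F" for x
    using eq_iff[OF that I.zero_closed] that by (simp add: zeroQ)
  have hom: "abelian_group_hom F ?Q ((+>) I)"
    by (intro abelian_group_homI group_hom.intro group_hom_axioms.intro I.a_group Q.a_group
        I.abelian_group_axioms Q.abelian_group_axioms)
      (simp add: hom_def car addQ del: ring_extend_simps)
  interpret hom: abelian_group_hom F ?Q "(+>) I" by (rule hom)
  have subgr: "additive_subgroup ((+>) I ` H h t) ?Q" for h t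
  proof -
    have "subgroup ((+>) I ` H h t) (add_monoid ?Q)"
      using group_hom.subgroup_img_is_subgroup[OF hom.a_group_hom] F.H_subgroup[of "(h,t)"]
      by (simp add: additive_subgroup_def)
    then show ?thesis by (simp add: additive_subgroup_def)
  qed
  define prQ where "prQ = (\<lambda>p X. I +> pr p (SOME x. x \<in> carrier F \<and> X = I +> x))"
  have prQ: "prQ p (I +> x) = I +> pr p x" if x: "x \<in> carrier F" for p x
  proof -
    define y where "y = (SOME y. y \<in> carrier F \<and> I +> x = I +> y)"
    have y: "y \<in> carrier F" "I +> x = I +> y"
      using someI[of "\<lambda>y. y \<in> carrier F \<and> I +> x = I +> y" x] x by (auto simp: y_def)
    then have "y \<oplus> x \<in> I" using eq_iff x by metis
    then have "pr p (y \<oplus> x) \<in> I" by (rule pr_I)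
    then have "I +> pr p y = I +> pr p x"
      using x y by (subst eq_iff) (auto simp: F.pr_add F.pr_closed)
    then show ?thesis by (simp add: prQ_def y_def)
  qed
  have gQ: "graded_group ?Q (\<lambda>(h, t). (+>) I ` H h t) prQ"
  proof (intro graded_group.intro graded_group_axioms.intro Q.abelian_group_axioms)
    fix p :: "int \<times> int"
    show "additive_subgroup (case p of (h, t) \<Rightarrow> (+>) I ` H h t) ?Q"
      using subgr by (cases p) auto
  next
    fix X p assume "X \<in> carrier ?Q"
    then obtain x where x: "x \<in> carrier F" "X = I +> x" using car by blast
    then show "prQ p X \<in> (case p of (h, t) \<Rightarrow> (+>) I ` H h t)"
      using F.pr_homog[OF x(1), of p] by (cases p) (auto simp: prQ)
  next
    fix X Y p assume "X \<in> carrier ?Q" "Y \<in> carrier ?Q"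
    then obtain x y where xy: "x \<in> carrier F" "X = I +> x" "y \<in> carrier F" "Y = I +> y"
      unfolding car by auto
    then show "prQ p (X \<oplus>\<^bsub>?Q\<^esub> Y) = prQ p X \<oplus>\<^bsub>?Q\<^esub> prQ p Y"
      by (simp only: addQ prQ F.pr_add F.pr_closed I.a_closed)
  next
    fix X and p :: "int \<times> int" assume "X \<in> (case p of (h, t) \<Rightarrow> (+>) I ` H h t)"
    then obtain x where x: "x \<in> ?H p" "X = I +> x" by (cases p) auto
    then show "prQ p X = X"
      by (simp only: F.H_closed[OF x(1)] prQ F.pr_same[OF x(1)])
  next
    fix X and p q :: "int \<times> int" assume "X \<in> (case p of (h, t) \<Rightarrow> (+>) I ` H h t)" "q \<noteq> p"
    then obtain x where x: "x \<in> ?H p" "X = I +> x" by (cases p) auto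
    then show "prQ q X = \<zero>\<^bsub>?Q\<^esub>"
      by (simp only: F.H_closed[OF x(1)] prQ F.pr_other[OF x(1) \<open>q \<noteq> p\<close>] zeroQ)
  next
    fix X assume "X \<in> carrier ?Q"
    then obtain x where x: "x \<in> carrier F" "X = I +> x" using car by blast
    have sub: "{p. prQ p X \<noteq> \<zero>\<^bsub>?Q\<^esub>} \<subseteq> {p. pr p x \<noteq> \<zero>}"
      using x by (auto simp: prQ zeroQ simp del: ring_extend_simps)
    with F.pr_finite[OF x(1)] show "finite {p. prQ p X \<noteq> \<zero>\<^bsub>?Q\<^esub>}"
      by (rule rev_finite_subset)
    have "X = (\<Oplus>\<^bsub>?Q\<^esub>p\<in>{p. pr p x \<noteq> \<zero>}. I +> pr p x)"
      using x F.pr_sum[OF x(1)] hom.hom_finsum[of "{p. pr p x \<noteq> \<zero>}" "\<lambda>p. pr p x"] F.pr_finite[OF x(1)]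
      by (auto simp: F.pr_closed simp del: ring_extend_simps)
    also have "\<dots> = (\<Oplus>\<^bsub>?Q\<^esub>p\<in>{p. pr p x \<noteq> \<zero>}. prQ p X)"
      using x by (simp add: prQ)
    also have "\<dots> = (\<Oplus>\<^bsub>?Q\<^esub>p\<in>{p. prQ p X \<noteq> \<zero>\<^bsub>?Q\<^esub>}. prQ p X)"
      using sub F.pr_finite[OF x(1)] x
      by (intro Q.finsum_superset) (auto simp: prQ F.pr_closed simp del: ring_extend_simps)
    finally show "X = (\<Oplus>\<^bsub>?Q\<^esub>p\<in>{p. prQ p X \<noteq> \<zero>\<^bsub>?Q\<^esub>}. prQ p X)" .
  qed
  show ?thesis
  proof (intro tdg_algebra.intro tdg_algebra_axioms.intro Q.ring_axioms)
    fix X assume "X \<in> carrier ?Q"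
    then obtain x where x: "x \<in> carrier F" "X = I +> x" using car by blast
    show "X \<oplus>\<^bsub>?Q\<^esub> X = \<zero>\<^bsub>?Q\<^esub>"
      using x by (simp only: addQ char_two zeroQ)
    show "diff ?Q X \<in> carrier ?Q"
      using x d_closed by (simp add: D car[simplified])
    show "diff ?Q (diff ?Q X) = \<zero>\<^bsub>?Q\<^esub>"
      using x zeroQ by (simp add: D d_closed d_d zero_iff)
    have "\<exists>!c. decomposes ?Q (\<lambda>(h, t). homog ?Q h t) c X"
      using graded_group.decomposes_ex1[OF gQ \<open>X \<in> carrier ?Q\<close>] by simp
    then show "\<exists>!c. (\<forall>h t. c (h, t) \<in> homog ?Q h t) \<and> finite {p. c p \<noteq> \<zero>\<^bsub>?Q\<^esub>} \<and>
        X = (\<Oplus>\<^bsub>?Q\<^esub>p\<in>{p. c p \<noteq> \<zero>\<^bsub>?Q\<^esub>}. c p)"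
      by (simp only: decomposes_def split_paired_All prod.case)
    fix Y assume "Y \<in> carrier ?Q"
    then obtain y where y: "y \<in> carrier F" "Y = I +> y" using car by blast
    show "diff ?Q (X \<oplus>\<^bsub>?Q\<^esub> Y) = diff ?Q X \<oplus>\<^bsub>?Q\<^esub> diff ?Q Y"
      using x y by (simp only: addQ D d_add d_closed I.a_closed ring_extend_simps(7))
    show "diff ?Q (X \<otimes>\<^bsub>?Q\<^esub> Y) = diff ?Q X \<otimes>\<^bsub>?Q\<^esub> Y \<oplus>\<^bsub>?Q\<^esub> X \<otimes>\<^bsub>?Q\<^esub> diff ?Q Y"
      using x y by (simp only: addQ multQ D leibniz d_closed I.a_closed I.m_closed ring_extend_simps(7))
  next
    fix h t show "additive_subgroup (homog ?Q h t) ?Q" using subgr by simp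
  next
    show "\<one>\<^bsub>?Q\<^esub> \<in> homog ?Q 0 0" using one by (simp add: FactRing_simps)
  next
    fix X Y h t h' t' assume "X \<in> homog ?Q h t" "Y \<in> homog ?Q h' t'"
    then obtain x y where "x \<in> H h t" "X = I +> x" "y \<in> H h' t'" "Y = I +> y" by auto
    then show "X \<otimes>\<^bsub>?Q\<^esub> Y \<in> homog ?Q (h + h') (t + t')"
      by (simp only: multQ Hc ring_extend_simps(6)) (blast intro: mult)
  next
    fix X h t assume "X \<in> homog ?Q h t"
    then obtain x where "x \<in> H h t" "X = I +> x" by auto
    then show "diff ?Q X \<in> homog ?Q (h + 1) t"
      by (simp only: D Hc d_homog ring_extend_simps(6,7))
  qed
qed


section \<open>Cohomology and formality\<close>

context tdg_algebra
begin

text \<open>The homogeneous component in a bidegree.\<close>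

definition pr :: "int \<times> int \<Rightarrow> 'a \<Rightarrow> 'a" where
  "pr p x = (THE c. decomposes A (\<lambda>(h, t). homog A h t) c x) p"

sublocale graded: graded_group A "\<lambda>(h, t). homog A h t" pr
proof -
  have "graded_group A (\<lambda>(h, t). homog A h t)
      (\<lambda>p x. (THE c. decomposes A (\<lambda>(h, t). homog A h t) c x) p)"
  proof (rule graded_groupI)
    fix p show "additive_subgroup (case p of (h, t) \<Rightarrow> homog A h t) A"
      using homog_subgroup by (cases p) auto
  next
    fix x assume "x \<in> carrier A"
    from direct_sum[OF this] show "\<exists>!c. decomposes A (\<lambda>(h, t). homog A h t) c x"
      by (simp only: decomposes_def split_paired_All prod.case)
  qed
  then show "graded_group A (\<lambda>(h, t). homog A h t) pr"
    by (simp add: pr_def[abs_def])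
qed

lemma homog_closed: "x \<in> homog A h t \<Longrightarrow> x \<in> carrier A"
  using graded.H_closed[of x "(h, t)"] by simp

lemma diff_zero: "diff A \<zero> = \<zero>"
  using diff_add[of \<zero> \<zero>] char_two[OF diff_closed[of \<zero>]] by simp

lemma pr_diff:
  assumes "x \<in> carrier A"
  shows "pr (h + 1, t) (diff A x) = diff A (pr (h, t) x)"
  using assms
proof (induction rule: graded.homog_induct)
  case (homog p x)
  obtain h' t' where p: "p = (h', t')" by (cases p)
  with homog have x: "x \<in> homog A h' t'" by simp
  show ?case
  proof (cases "(h, t) = (h', t')")
    case True
    then show ?thesis
      using graded.pr_same[of "diff A x" "(h + 1, t)"] graded.pr_same[of x "(h, t)"] x
      by (simp add: diff_homog)
  next
    case False
    then show ?thesis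
      using graded.pr_other[of "diff A x" "(h' + 1, t')" "(h + 1, t)"]
        graded.pr_other[of x "(h', t')" "(h, t)"] x
      by (simp add: diff_homog diff_zero)
  qed
qed (simp_all add: diff_zero graded.pr_zero diff_add graded.pr_add graded.pr_closed diff_closed)

text \<open>The ring of cocycles; only its carrier differs from \<open>A\<close>.\<close>

abbreviation Z :: "'a tdga" where "Z \<equiv> A\<lparr>carrier := cocycles A\<rparr>"

lemma cocycle_iff: "x \<in> cocycles A \<longleftrightarrow> x \<in> carrier A \<and> diff A x = \<zero>"
  by (simp add: cocycles_def)

lemma cocycles_ring: "ring Z"
proof (rule ringI)
  show "abelian_group Z"
    by (rule abelian_groupI)
      (auto simp: cocycle_iff diff_add diff_zero a_ac char_two intro!: bexI[of _ "_ :: 'a"])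
  have one: "diff A \<one> = \<zero>"
    using leibniz[of \<one> \<one>] char_two[of "diff A \<one>"] diff_closed[of \<one>] by simp
  show "Group.monoid Z"
    by (rule Group.monoidI) (auto simp: cocycle_iff leibniz m_assoc one)
qed (auto simp: cocycle_iff l_distr r_distr)

lemma coboundaries_ideal: "ideal (coboundaries A) Z"
proof -
  interpret Z: ring Z by (rule cocycles_ring)
  show ?thesis
  proof (rule idealI[OF cocycles_ring])
    show "subgroup (coboundaries A) (add_monoid Z)"
    proof (rule Z.add.subgroupI)
      show "coboundaries A \<noteq> {}" using diff_zero by (auto simp: coboundaries_def)
      show "coboundaries A \<subseteq> carrier Z"
        by (auto simp: coboundaries_def cocycle_iff diff_closed diff_diff)
      fix x assume x: "x \<in> coboundaries A"
      have "x \<in> cocycles A" using x by (auto simp: coboundaries_def cocycle_iff diff_closed diff_diff)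
      then have "x \<oplus>\<^bsub>Z\<^esub> x = \<zero>\<^bsub>Z\<^esub>" by (simp add: cocycle_iff char_two)
      then have "\<ominus>\<^bsub>Z\<^esub> x = x" using Z.minus_equality[of x x] \<open>x \<in> cocycles A\<close> by simp
      then show "\<ominus>\<^bsub>Z\<^esub> x \<in> coboundaries A" using x by simp
      fix y assume "y \<in> coboundaries A"
      then show "x \<oplus>\<^bsub>Z\<^esub> y \<in> coboundaries A"
        using x by (auto simp: coboundaries_def simp flip: diff_add)
    qed
  next
    fix a x assume "a \<in> coboundaries A" "x \<in> carrier Z"
    then obtain y where y: "y \<in> carrier A" "a = diff A y" and x: "x \<in> carrier A" "diff A x = \<zero>"
      by (auto simp: coboundaries_def cocycle_iff)
    have "x \<otimes> a = diff A (x \<otimes> y)" "a \<otimes> x = diff A (y \<otimes> x)"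
      using x y by (simp_all add: leibniz diff_closed)
    then show "x \<otimes>\<^bsub>Z\<^esub> a \<in> coboundaries A" "a \<otimes>\<^bsub>Z\<^esub> x \<in> coboundaries A"
      using x y by (auto simp: coboundaries_def)
  qed
qed

lemma coset_Z: "coboundaries A +>\<^bsub>Z\<^esub> x = coboundaries A +> x"
  by (simp add: a_r_coset_def r_coset_def)

lemma pr_cocycle: "x \<in> cocycles A \<Longrightarrow> pr p x \<in> cocycles A"
  using pr_diff[of x "fst p" "snd p"] graded.pr_closed[of x p]
  by (simp add: cocycle_iff graded.pr_zero)

lemma tdg_algebra_cohomology: "tdg_algebra (cohomology A)"
proof -
  let ?H = "\<lambda>h t. cocycles A \<inter> homog A h t"
  interpret Z: ring Z by (rule cocycles_ring)
  have gr: "graded_group Z (\<lambda>(h, t). ?H h t) pr"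
  proof (intro graded_group.intro graded_group_axioms.intro Z.abelian_group_axioms)
    fix p :: "int \<times> int"
    obtain h t where p: "p = (h, t)" by (cases p)
    interpret h: additive_subgroup "homog A h t" A by (rule homog_subgroup)
    have "subgroup (?H h t) (add_monoid Z)"
    proof (rule Z.add.subgroupI)
      fix x y assume xy: "x \<in> ?H h t" "y \<in> ?H h t"
      then show "x \<oplus>\<^bsub>Z\<^esub> y \<in> ?H h t"
        by (auto simp: cocycle_iff diff_add)
      have "x \<oplus>\<^bsub>Z\<^esub> x = \<zero>\<^bsub>Z\<^esub>" using xy by (simp add: cocycle_iff char_two)
      then have "\<ominus>\<^bsub>Z\<^esub> x = x" using Z.minus_equality[of x x] xy by simp
      then show "\<ominus>\<^bsub>Z\<^esub> x \<in> ?H h t" using xy by simp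
    next
      have "\<zero> \<in> ?H h t" using h.zero_closed by (simp add: cocycle_iff diff_zero)
      then show "?H h t \<noteq> {}" by blast
    qed auto
    then show "additive_subgroup (case p of (h, t) \<Rightarrow> ?H h t) Z"
      by (simp add: additive_subgroup_def p)
  next
    fix x p assume "x \<in> carrier Z"
    then show "pr p x \<in> (case p of (h, t) \<Rightarrow> ?H h t)"
      using pr_cocycle[of x p] graded.pr_homog[of x p]
      by (cases p) (auto simp: cocycle_iff)
  next
    fix x y p assume "x \<in> carrier Z" "y \<in> carrier Z"
    then show "pr p (x \<oplus>\<^bsub>Z\<^esub> y) = pr p x \<oplus>\<^bsub>Z\<^esub> pr p y"
      by (simp add: cocycle_iff graded.pr_add)
  next
    fix x and p :: "int \<times> int" assume "x \<in> (case p of (h, t) \<Rightarrow> ?H h t)"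
    then show "pr p x = x" using graded.pr_same[of x p] by (cases p) auto
  next
    fix x and p q :: "int \<times> int" assume "x \<in> (case p of (h, t) \<Rightarrow> ?H h t)" "q \<noteq> p"
    then show "pr q x = \<zero>\<^bsub>Z\<^esub>" using graded.pr_other[of x p q] by (cases p) auto
  next
    fix x assume x: "x \<in> carrier Z"
    then have xA: "x \<in> carrier A" by (simp add: cocycle_iff)
    show fin: "finite {p. pr p x \<noteq> \<zero>\<^bsub>Z\<^esub>}" using graded.pr_finite[OF xA] by simp
    have "(\<Oplus>\<^bsub>Z\<^esub>p\<in>S. pr p x) = (\<Oplus>p\<in>S. pr p x)" if "finite S" for S
      using that x xA
      by (induction S) (auto simp: graded.pr_closed pr_cocycle)
    then show "x = (\<Oplus>\<^bsub>Z\<^esub>p\<in>{p. pr p x \<noteq> \<zero>\<^bsub>Z\<^esub>}. pr p x)"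
      using graded.pr_sum[OF xA] fin by simp
  qed
  have "tdg_algebra (ring.extend (Z Quot coboundaries A)
      (tdga.fields (\<lambda>h t. (+>\<^bsub>Z\<^esub>) (coboundaries A) ` ?H h t) (\<lambda>_. coboundaries A)))"
  proof (rule quotient_tdg_algebra[OF coboundaries_ideal gr, where d = "\<lambda>_. \<zero>"])
    interpret B: ideal "coboundaries A" Z by (rule coboundaries_ideal)
    fix x assume "x \<in> coboundaries A"
    then obtain y where y: "y \<in> carrier A" "x = diff A y" by (auto simp: coboundaries_def)
    fix p :: "int \<times> int"
    show "pr p x \<in> coboundaries A"
      using pr_diff[OF y(1), of "fst p - 1" "snd p"] graded.pr_closed[OF y(1)] y
      by (auto simp: coboundaries_def)
  next
    interpret B: ideal "coboundaries A" Z by (rule coboundaries_ideal)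
    fix x
    show "\<zero> \<in> coboundaries A" using B.zero_closed by simp
    show "coboundaries A = coboundaries A +>\<^bsub>Z\<^esub> \<zero>"
      using B.a_rcos_const[OF B.zero_closed] by simp
    show "\<one>\<^bsub>Z\<^esub> \<in> ?H 0 0" using Z.one_closed one_homog by simp
    fix h t
    have "\<zero> \<in> ?H (h + 1) t"
      using additive_subgroup.zero_closed[OF homog_subgroup] by (simp add: cocycle_iff diff_zero)
    then show "coboundaries A +>\<^bsub>Z\<^esub> \<zero> \<in> (+>\<^bsub>Z\<^esub>) (coboundaries A) ` ?H (h + 1) t"
      by (rule imageI)
  qed (use mult_homog in \<open>auto simp: cocycle_iff char_two diff_zero leibniz\<close>)
  then show ?thesis
    by (simp add: cohomology_def coset_Z cohomology_ring_def FactRing_def)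
qed


lemma coset_eq_iff:
  assumes "x \<in> cocycles A" "y \<in> cocycles A"
  shows "coboundaries A +> x = coboundaries A +> y \<longleftrightarrow> x \<oplus> y \<in> coboundaries A"
proof -
  interpret Z: ring Z by (rule cocycles_ring)
  interpret B: ideal "coboundaries A" Z by (rule coboundaries_ideal)
  show ?thesis
    using Z.coset_eq_iff_char_two[OF B.additive_subgroup_axioms, of x y] assms
    by (simp add: coset_Z cocycle_iff char_two)
qed

lemma coboundaries_closed: "x \<in> coboundaries A \<Longrightarrow> x \<in> cocycles A"
  by (auto simp: coboundaries_def cocycle_iff diff_closed diff_diff)

lemma coboundaries_add: "x \<in> coboundaries A \<Longrightarrow> y \<in> coboundaries A \<Longrightarrow> x \<oplus> y \<in> coboundaries A"
  by (auto simp: coboundaries_def simp flip: diff_add)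

lemma coboundaries_zero: "\<zero> \<in> coboundaries A"
  using diff_zero by (force simp: coboundaries_def)

lemma coset_of_coboundary: "x \<in> coboundaries A \<Longrightarrow> coboundaries A +> x = coboundaries A"
proof -
  interpret B: ideal "coboundaries A" Z by (rule coboundaries_ideal)
  show "x \<in> coboundaries A \<Longrightarrow> coboundaries A +> x = coboundaries A"
    using B.a_rcos_const by (simp add: coset_Z)
qed

lemma cohomology_simps:
  shows carrier_cohomology: "carrier (cohomology A) = (+>) (coboundaries A) ` cocycles A"
    and zero_cohomology: "\<zero>\<^bsub>cohomology A\<^esub> = coboundaries A"
    and one_cohomology: "\<one>\<^bsub>cohomology A\<^esub> = coboundaries A +> \<one>"
    and homog_cohomology: "homog (cohomology A) h t =
          (+>) (coboundaries A) ` (cocycles A \<inter> homog A h t)"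
    and diff_cohomology: "diff (cohomology A) X = coboundaries A"
    and add_cohomology: "x \<in> cocycles A \<Longrightarrow> y \<in> cocycles A \<Longrightarrow>
          (coboundaries A +> x) \<oplus>\<^bsub>cohomology A\<^esub> (coboundaries A +> y) = coboundaries A +> (x \<oplus> y)"
    and mult_cohomology: "x \<in> cocycles A \<Longrightarrow> y \<in> cocycles A \<Longrightarrow>
          (coboundaries A +> x) \<otimes>\<^bsub>cohomology A\<^esub> (coboundaries A +> y) = coboundaries A +> (x \<otimes> y)"
proof -
  interpret B: ideal "coboundaries A" Z by (rule coboundaries_ideal)
  show "carrier (cohomology A) = (+>) (coboundaries A) ` cocycles A"
    by (auto simp: cohomology_def cohomology_ring_def FactRing_def A_RCOSETS_def' coset_Z)
  show "\<zero>\<^bsub>cohomology A\<^esub> = coboundaries A" "diff (cohomology A) X = coboundaries A"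
    "\<one>\<^bsub>cohomology A\<^esub> = coboundaries A +> \<one>"
    "homog (cohomology A) h t = (+>) (coboundaries A) ` (cocycles A \<inter> homog A h t)"
    by (auto simp: cohomology_def cohomology_ring_def FactRing_def A_RCOSETS_def' coset_Z)
  show "(coboundaries A +> x) \<oplus>\<^bsub>cohomology A\<^esub> (coboundaries A +> y) = coboundaries A +> (x \<oplus> y)"
    if "x \<in> cocycles A" "y \<in> cocycles A"
    using B.a_rcos_sum[of x y] that
    by (simp add: cohomology_def cohomology_ring_def FactRing_def A_RCOSETS_def' coset_Z)
  show "(coboundaries A +> x) \<otimes>\<^bsub>cohomology A\<^esub> (coboundaries A +> y) = coboundaries A +> (x \<otimes> y)"
    if "x \<in> cocycles A" "y \<in> cocycles A"
    using B.rcoset_mult_add[of x y] that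
    by (simp add: cohomology_def cohomology_ring_def FactRing_def A_RCOSETS_def' coset_Z)
qed

text \<open>The sum of the components whose two degrees agree.\<close>

definition diagonal :: "'a \<Rightarrow> 'a" where
  "diagonal x = (\<Oplus>p\<in>{p. pr p x \<noteq> \<zero>}. if fst p = snd p then pr p x else \<zero>)"

lemma diagonal_superset:
  assumes "x \<in> carrier A" "finite S" "{p. pr p x \<noteq> \<zero>} \<subseteq> S"
  shows "diagonal x = (\<Oplus>p\<in>S. if fst p = snd p then pr p x else \<zero>)"
  unfolding diagonal_def using assms
  by (intro finsum_superset[symmetric]) (auto simp: graded.pr_closed)

lemma diagonal_closed: "x \<in> carrier A \<Longrightarrow> diagonal x \<in> carrier A"
  unfolding diagonal_def by (intro finsum_closed) (auto simp: graded.pr_closed)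

lemma diagonal_add:
  assumes x: "x \<in> carrier A" and y: "y \<in> carrier A"
  shows "diagonal (x \<oplus> y) = diagonal x \<oplus> diagonal y"
proof -
  let ?S = "{p. pr p x \<noteq> \<zero>} \<union> {p. pr p y \<noteq> \<zero>}"
  have fin: "finite ?S" using assms by (simp add: graded.pr_finite)
  have "diagonal (x \<oplus> y) = (\<Oplus>p\<in>?S. if fst p = snd p then pr p (x \<oplus> y) else \<zero>)"
    using assms fin by (intro diagonal_superset) (auto simp: graded.pr_add)
  also have "\<dots> = (\<Oplus>p\<in>?S. (if fst p = snd p then pr p x else \<zero>) \<oplus>
      (if fst p = snd p then pr p y else \<zero>))"
    using assms by (intro finsum_cong') (auto simp: graded.pr_add graded.pr_closed)
  also have "\<dots> = diagonal x \<oplus> diagonal y"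
    using assms fin
    by (subst finsum_addf)
      (auto simp: graded.pr_closed diagonal_superset[OF x fin] diagonal_superset[OF y fin])
  finally show ?thesis .
qed

lemma diagonal_homog:
  assumes x: "x \<in> homog A h t"
  shows "diagonal x = (if h = t then x else \<zero>)"
proof -
  have xA: "x \<in> carrier A" using x by (rule homog_closed)
  have "pr q x = \<zero>" if "q \<noteq> (h, t)" for q
    using graded.pr_other[of x "(h, t)" q] x that by simp
  then have "diagonal x = (\<Oplus>p\<in>{(h, t)}. if fst p = snd p then pr p x else \<zero>)"
    using xA by (intro diagonal_superset) auto
  also have "\<dots> = (if h = t then x else \<zero>)"
    using graded.pr_same[of x "(h, t)"] x xA graded.pr_closed[OF xA, of "(h, t)"] by auto
  finally show ?thesis .
qed

text \<open>Multiplicativity of the diagonal part is where the absence of elements above the diagonal is used: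
  off-diagonal components of two factors cannot multiply to a diagonal one.\<close>

theorem formality_criterion:
  assumes above: "\<And>h t x. t < h \<Longrightarrow> x \<in> homog A h t \<Longrightarrow> x = \<zero>"
    and exact: "\<And>h t x. h < t \<Longrightarrow> x \<in> homog A h t \<Longrightarrow> diff A x = \<zero> \<Longrightarrow> x \<in> coboundaries A"
  shows "quasi_iso A (cohomology A) (\<lambda>x. coboundaries A +> diagonal x)"
proof -
  interpret Z: ring Z by (rule cocycles_ring)
  interpret B: ideal "coboundaries A" Z by (rule coboundaries_ideal)
  interpret H: tdg_algebra "cohomology A" by (rule tdg_algebra_cohomology)
  let ?f = "\<lambda>x. coboundaries A +> diagonal x"
  have off: "x \<in> coboundaries A" if "x \<in> homog A h t" "diff A x = \<zero>" "h \<noteq> t" for x h t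
    using that above exact coboundaries_zero by (metis linorder_neqE)
  have diag_cocycle: "diagonal x \<in> cocycles A" if "x \<in> carrier A" for x
    using that
  proof (induction rule: graded.homog_induct)
    case (homog p x)
    then have x: "x \<in> homog A (fst p) (snd p)" by (cases p) auto
    show ?case
    proof (cases "fst p = snd p")
      case True
      then have "diff A x = \<zero>" using above[of "snd p" "fst p + 1"] diff_homog[OF x] by simp
      with x True show ?thesis by (simp add: diagonal_homog cocycle_iff homog_closed)
    next
      case False
      with x show ?thesis by (simp add: diagonal_homog cocycle_iff diff_zero)
    qed
  next
    case zero
    show ?case using diagonal_homog[of \<zero> 0 0] graded.H_zero[of "(0,0)"]
      by (simp add: cocycle_iff diff_zero)
  next
    case (add x y)
    then show ?case by (simp add: diagonal_add cocycle_iff diff_add)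
  qed
  have diag0: "diagonal \<zero> = \<zero>"
    using diagonal_homog[of \<zero> 0 0] graded.H_zero[of "(0,0)"] by simp
  have diag_diff: "diagonal (diff A x) \<in> coboundaries A" if "x \<in> carrier A" for x
    using that
  proof (induction rule: graded.homog_induct)
    case (homog p x)
    then have x: "x \<in> homog A (fst p) (snd p)" by (cases p) auto
    show ?case
      using diagonal_homog[OF diff_homog[OF x]] coboundaries_zero homog_closed[OF x]
      by (auto simp: coboundaries_def)
  next
    case (add x y)
    then show ?case by (simp add: diff_add diagonal_add diff_closed coboundaries_add)
  qed (simp add: diff_zero diag0 coboundaries_zero)
  have diag_mult: "diagonal (x \<otimes> y) = diagonal x \<otimes> diagonal y"
    if "x \<in> carrier A" "y \<in> carrier A" for x y
    using that(1)
  proof (induction rule: graded.homog_induct)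
    case (homog p x)
    then have x: "x \<in> homog A (fst p) (snd p)" by (cases p) auto
    show ?case
      using that(2)
    proof (induction rule: graded.homog_induct)
      case (homog q y)
      then have y: "y \<in> homog A (fst q) (snd q)" by (cases q) auto
      note xy = mult_homog[OF x y]
      consider "fst p > snd p" | "fst q > snd q" | "fst p = snd p" "fst q = snd q"
        | "fst p \<le> snd p" "fst q \<le> snd q" "fst p \<noteq> snd p \<or> fst q \<noteq> snd q"
        by linarith
      then show ?case
      proof cases
        case 1
        then have "x = \<zero>" using above x by blast
        then show ?thesis using homog_closed[OF y] by (simp add: diag0 diagonal_closed)
      next
        case 2
        then have "y = \<zero>" using above y by blast
        then show ?thesis using homog_closed[OF x] by (simp add: diag0 diagonal_closed)
      next
        case 3
        then show ?thesis by (simp add: diagonal_homog[OF x] diagonal_homog[OF y] diagonal_homog[OF xy])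
      next
        case 4
        then have "fst p + fst q \<noteq> snd p + snd q" by linarith
        then show ?thesis
          using 4 homog_closed[OF x] homog_closed[OF y]
          by (auto simp: diagonal_homog[OF x] diagonal_homog[OF y] diagonal_homog[OF xy])
      qed
    next
      case (add y z)
      then show ?case
        using homog_closed[OF x] by (simp add: r_distr diagonal_add diagonal_closed)
    qed (use homog_closed[OF x] in \<open>simp add: diag0 diagonal_closed\<close>)
  next
    case (add x z)
    then show ?case
      using that(2) by (simp add: l_distr diagonal_add diagonal_closed)
  qed (use that(2) in \<open>simp add: diag0 diagonal_closed\<close>)
  have diag_class: "coboundaries A +> diagonal z = coboundaries A +> z" if z: "z \<in> cocycles A" for z
  proof -
    have zA: "z \<in> carrier A" using z by (simp add: cocycle_iff)
    let ?S = "{p. pr p z \<noteq> \<zero>}"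
    let ?c = "\<lambda>p. (if fst p = snd p then pr p z else \<zero>) \<oplus> pr p z"
    have c: "?c p \<in> coboundaries A" for p
    proof (cases "fst p = snd p")
      case True
      then show ?thesis using zA by (simp add: graded.pr_closed char_two coboundaries_zero)
    next
      case False
      then have "pr p z \<in> coboundaries A"
        using off[of "pr p z" "fst p" "snd p"] pr_cocycle[OF z, of p] graded.pr_homog[OF zA, of p]
        by (cases p) (auto simp: cocycle_iff)
      then show ?thesis using False zA by (simp add: graded.pr_closed)
    qed
    have "diagonal z \<oplus> z = (\<Oplus>p\<in>?S. ?c p)"
      using zA graded.pr_sum[OF zA]
      by (subst finsum_addf) (auto simp: graded.pr_closed diagonal_def)
    moreover have "finite S \<Longrightarrow> (\<Oplus>p\<in>S. ?c p) \<in> coboundaries A" for S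
    proof (induction S rule: finite_induct)
      case (insert q S)
      have "(\<Oplus>p\<in>insert q S. ?c p) = ?c q \<oplus> (\<Oplus>p\<in>S. ?c p)"
        using insert.hyps zA by (intro finsum_insert) (auto simp: graded.pr_closed)
      then show ?case using c[of q] insert.IH by (simp only: coboundaries_add)
    qed (simp add: coboundaries_zero)
    ultimately have "diagonal z \<oplus> z \<in> coboundaries A"
      using graded.pr_finite[OF zA] by simp
    then show ?thesis using z diag_cocycle[OF zA] by (simp add: coset_eq_iff)
  qed
  have hom: "?f \<in> tdga_hom A (cohomology A)"
    unfolding tdga_hom_def
  proof (intro CollectI conjI allI ballI ring_hom_memI)
    fix x assume x: "x \<in> carrier A"
    then show "?f x \<in> carrier (cohomology A)" by (simp add: carrier_cohomology diag_cocycle)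
    show "?f (diff A x) = diff (cohomology A) (?f x)"
      using diag_diff[OF x] by (simp add: diff_cohomology coset_of_coboundary)
    fix y assume y: "y \<in> carrier A"
    show "?f (x \<otimes> y) = ?f x \<otimes>\<^bsub>cohomology A\<^esub> ?f y"
      using x y by (simp add: mult_cohomology diag_mult diag_cocycle)
    show "?f (x \<oplus> y) = ?f x \<oplus>\<^bsub>cohomology A\<^esub> ?f y"
      using x y by (simp add: add_cohomology diagonal_add diag_cocycle)
  next
    show "?f \<one> = \<one>\<^bsub>cohomology A\<^esub>"
      using diagonal_homog[OF one_homog] by (simp add: one_cohomology)
  next
    fix h t
    show "?f ` homog A h t \<subseteq> homog (cohomology A) h t"
    proof
      fix X assume "X \<in> ?f ` homog A h t"
      then obtain x where x: "x \<in> homog A h t" "X = ?f x" by auto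
      have "diagonal x \<in> homog A h t"
        using x graded.H_zero[of "(h, t)"] by (auto simp: diagonal_homog split: if_splits)
      then show "X \<in> homog (cohomology A) h t"
        using diag_cocycle[OF homog_closed[OF x(1)]] x(2) by (auto simp: homog_cohomology)
    qed
  qed
  have cobH: "coboundaries (cohomology A) = {coboundaries A}"
    using H.zero_closed by (auto simp: coboundaries_def diff_cohomology)
  have cocH: "cocycles (cohomology A) = carrier (cohomology A)"
    by (auto simp: cocycles_def diff_cohomology zero_cohomology)
  have cosetH: "coboundaries (cohomology A) +>\<^bsub>cohomology A\<^esub> X = {X}"
    if "X \<in> carrier (cohomology A)" for X
    using that H.l_zero[OF that] by (simp add: cobH a_r_coset_def' zero_cohomology)
  have carHH: "carrier (cohomology (cohomology A)) = (\<lambda>X. {X}) ` carrier (cohomology A)"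
    using cosetH by (simp add: H.carrier_cohomology cocH image_def)
  have map: "cohomology_map (cohomology A) ?f X = {X}" if X: "X \<in> carrier (cohomology A)" for X
  proof -
    obtain z where z: "z \<in> cocycles A" "X = coboundaries A +> z"
      using X by (auto simp: carrier_cohomology)
    have zX: "z \<in> X"
      using B.a_rcos_self[of z] z by (simp add: coset_Z)
    have "?f x = X" if x: "x \<in> X" for x
    proof -
      obtain b where b: "b \<in> coboundaries A" "x = b \<oplus> z"
        using x z by (auto simp: a_r_coset_def')
      have xZ: "x \<in> cocycles A"
        using b z(1) coboundaries_closed[of b] by (auto simp: cocycle_iff diff_add)
      have "b \<in> carrier A" "z \<in> carrier A"
        using b z(1) coboundaries_closed[of b] by (auto simp: cocycle_iff)
      then have "x \<oplus> z = b" using b by (simp add: a_assoc char_two)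
      then have "coboundaries A +> x = coboundaries A +> z"
        using xZ z b by (simp add: coset_eq_iff)
      then show ?thesis using diag_class[OF xZ] z by simp
    qed
    then show ?thesis
      using zX cosetH[OF X] by (auto simp: cohomology_map_def)
  qed
  have "bij_betw (cohomology_map (cohomology A) ?f) (carrier (cohomology A))
      (carrier (cohomology (cohomology A)))"
    unfolding carHH bij_betw_def inj_on_def using map by (auto simp: image_def)
  then show ?thesis
    unfolding quasi_iso_def using tdg_algebra_axioms tdg_algebra_cohomology hom by simp
qed

end

section \<open>Linear extension over the field with two elements\<close>

abbreviation bas :: "'a \<Rightarrow> 'a \<Rightarrow>\<^sub>0 bit" where
  "bas k \<equiv> Poly_Mapping.single k 1"

text \<open>The linear extension of a map on the basis; all coefficients on the support are 1.\<close>

definition lin :: "('a \<Rightarrow> 'b \<Rightarrow>\<^sub>0 bit) \<Rightarrow> ('a \<Rightarrow>\<^sub>0 bit) \<Rightarrow> 'b \<Rightarrow>\<^sub>0 bit" where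
  "lin g f = (\<Sum>k\<in>Poly_Mapping.keys f. g k)"

lemma pm_char_two [simp]: "f + f = (0 :: 'a \<Rightarrow>\<^sub>0 bit)"
  by (rule poly_mapping_eqI) (simp add: lookup_add)

lemma pm_char_two' [simp]: "f + (f + g) = (g :: 'a \<Rightarrow>\<^sub>0 bit)"
  by (simp flip: add.assoc)

lemma pm_minus [simp]: "f - g = f + (g :: 'a \<Rightarrow>\<^sub>0 bit)"
  by (simp add: diff_eq_eq add.assoc)

lemma pm_eq_iff_sum_zero: "f = g \<longleftrightarrow> f + g = (0 :: 'a \<Rightarrow>\<^sub>0 bit)"
  using eq_iff_diff_eq_0[of f g] by simp

lemma lin_superset:
  assumes "finite S" "Poly_Mapping.keys f \<subseteq> S"
  shows "lin g f = (\<Sum>k\<in>S. if Poly_Mapping.lookup f k = 0 then 0 else g k)"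
  unfolding lin_def using assms
  by (intro sum.mono_neutral_cong_left) (auto simp: in_keys_iff)

lemma lin_add [simp]: "lin g (f + f') = lin g f + lin g f'"
proof -
  let ?S = "Poly_Mapping.keys f \<union> Poly_Mapping.keys f'"
  have "lin g (f + f') = (\<Sum>k\<in>?S. if Poly_Mapping.lookup (f + f') k = 0 then 0 else g k)"
    by (rule lin_superset) (use Poly_Mapping.keys_add[of f f'] in auto)
  also have "\<dots> = (\<Sum>k\<in>?S. (if Poly_Mapping.lookup f k = 0 then 0 else g k) +
      (if Poly_Mapping.lookup f' k = 0 then 0 else g k))"
  proof (intro sum.cong refl)
    fix k
    show "(if Poly_Mapping.lookup (f + f') k = 0 then 0 else g k) =
      (if Poly_Mapping.lookup f k = 0 then 0 else g k) +
      (if Poly_Mapping.lookup f' k = 0 then 0 else g k)"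
      by (cases "Poly_Mapping.lookup f k"; cases "Poly_Mapping.lookup f' k")
        (simp_all add: lookup_add)
  qed
  also have "\<dots> = lin g f + lin g f'"
    by (simp add: sum.distrib lin_superset[of ?S])
  finally show ?thesis .
qed

lemma lin_zero [simp]: "lin g 0 = 0"
  by (simp add: lin_def)

lemma lin_bas [simp]: "lin g (bas k) = g k"
  by (simp add: lin_def)

lemma lin_sum [simp]: "lin g (sum f S) = (\<Sum>s\<in>S. lin g (f s))"
  by (induction S rule: infinite_finite_induct) simp_all

lemma bas_induct [case_names zero add]:
  assumes "P 0" "\<And>k f. k \<notin> Poly_Mapping.keys f \<Longrightarrow> P f \<Longrightarrow> P (bas k + f)"
  shows "P (f :: 'a \<Rightarrow>\<^sub>0 bit)"
proof (induction "card (Poly_Mapping.keys f)" arbitrary: f)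
  case 0
  then show ?case using assms(1) by simp
next
  case (Suc n)
  then obtain k where k: "k \<in> Poly_Mapping.keys f" by fastforce
  let ?g = "bas k + f"
  have g: "Poly_Mapping.keys ?g = Poly_Mapping.keys f - {k}"
    using k by (auto simp: in_keys_iff lookup_add lookup_single when_def split: if_splits)
  then have "P ?g" using Suc k by simp
  then have "P (bas k + ?g)" using assms(2)[of k ?g] g by blast
  then show ?case by simp
qed

lemma sum_bas_keys: "(\<Sum>k\<in>Poly_Mapping.keys f. bas k) = (f :: 'a \<Rightarrow>\<^sub>0 bit)"
proof -
  have "lin bas f = f" by (induction f rule: bas_induct) simp_all
  then show ?thesis by (simp add: lin_def)
qed

lemma lin_bas_id [simp]: "lin bas f = f"
  by (simp add: lin_def sum_bas_keys)

lemma lin_cong: "(\<And>k. k \<in> Poly_Mapping.keys f \<Longrightarrow> g k = h k) \<Longrightarrow> lin g f = lin h f"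
  by (simp add: lin_def)

lemma additive_eq_lin:
  assumes "\<And>f g. F (f + g) = F f + F g"
  shows "F f = lin (\<lambda>k. F (bas k)) f"
proof (induction f rule: bas_induct)
  case zero
  show ?case using assms[of 0 0] by simp
qed (simp add: assms)

lemma lin_lin: "lin g (lin h f) = lin (\<lambda>k. lin g (h k)) f"
  by (induction f rule: bas_induct) simp_all

lemma lin_add_fun: "lin (\<lambda>k. g k + h k) f = lin g f + lin h f"
  by (simp add: lin_def sum.distrib)

lemma lin_zero_fun [simp]: "lin (\<lambda>k. 0) f = 0"
  by (simp add: lin_def)

lemma lin_sum_fun: "lin (\<lambda>k. \<Sum>s\<in>S. g s k) f = (\<Sum>s\<in>S. lin (g s) f)"
  unfolding lin_def by (rule sum.swap)

lemma lin_swap: "lin (\<lambda>k. lin (\<lambda>l. g k l) f') f = lin (\<lambda>l. lin (\<lambda>k. g k l) f) f'"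
  unfolding lin_def by (rule sum.swap)

lemma keys_sum_subset: "Poly_Mapping.keys (\<Sum>s\<in>S. f s) \<subseteq> (\<Union>s\<in>S. Poly_Mapping.keys (f s))"
  using keys_sum[of f S] by (cases "finite S") auto

lemma keys_lin: "u \<in> Poly_Mapping.keys (lin g f) \<Longrightarrow>
    \<exists>k\<in>Poly_Mapping.keys f. u \<in> Poly_Mapping.keys (g k)"
  unfolding lin_def using keys_sum_subset[of g "Poly_Mapping.keys f"] by auto

lemma keys_plus: "u \<in> Poly_Mapping.keys (f + g) \<Longrightarrow> u \<in> Poly_Mapping.keys f \<or> u \<in> Poly_Mapping.keys g"
  using Poly_Mapping.keys_add[of f g] by blast

section \<open>Words at one site\<close>

text \<open>A list of letters is the history of one site along a path. In the normal form chosen here a \<open>Dot\<close>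
  precedes the \<open>Cross\<close>es with which it commutes; \<open>dot\<close> and \<open>cross\<close> multiply a normal form by \<open>Dot\<close> and \<open>Cross\<close>
  from the left, and \<open>pre u\<close> by a word \<open>u\<close> to which no relation applies.\<close>

datatype letter = Dot | Arrive | Leave | Cross | Mark

fun dot :: "letter list \<Rightarrow> letter list \<Rightarrow>\<^sub>0 bit" where
  "dot (Dot # w) = 0"
| "dot w = bas (Dot # w)"

fun cross :: "letter list \<Rightarrow> letter list" where
  "cross (Dot # w) = Dot # Cross # w"
| "cross w = Cross # w"

abbreviation pre :: "letter list \<Rightarrow> letter list \<Rightarrow> letter list \<Rightarrow>\<^sub>0 bit" where
  "pre u \<equiv> (\<lambda>w. bas (u @ w))"

text \<open>The differential at one site: the derivation given by \<open>Mark \<mapsto> Arrive Leave\<close> and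
  \<open>Cross \<mapsto> Dot Leave Arrive + Leave Arrive Dot\<close>.\<close>

fun dloc :: "letter list \<Rightarrow> letter list \<Rightarrow>\<^sub>0 bit" where
  "dloc [] = 0"
| "dloc (Dot # w) = lin dot (dloc w)"
| "dloc (Arrive # w) = lin (pre [Arrive]) (dloc w)"
| "dloc (Leave # w) = lin (pre [Leave]) (dloc w)"
| "dloc (Mark # w) = bas (Arrive # Leave # w) + lin (pre [Mark]) (dloc w)"
| "dloc (Cross # w) = bas (Dot # Leave # Arrive # w) + lin (pre [Leave, Arrive]) (dot w) +
     lin (\<lambda>u. bas (cross u)) (dloc w)"

fun starts_dot :: "letter list \<Rightarrow> bool" where
  "starts_dot (Dot # w) = True"
| "starts_dot w = False"

text \<open>\<open>lvalid s w\<close>: the word \<open>w\<close> is a history in normal form of a site that is initially occupied if \<open>s\<close>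
  and empty otherwise.\<close>

fun lvalid :: "bool \<Rightarrow> letter list \<Rightarrow> bool" where
  "lvalid s [] = True"
| "lvalid s (Dot # w) = (s \<and> lvalid True w \<and> \<not> starts_dot w)"
| "lvalid s (Cross # w) = (s \<and> lvalid True w \<and> \<not> starts_dot w)"
| "lvalid s (Leave # w) = (s \<and> lvalid False w)"
| "lvalid s (Arrive # w) = (\<not> s \<and> lvalid True w)"
| "lvalid s (Mark # w) = (\<not> s \<and> lvalid False w)"

text \<open>The numbers of jumps over the edges to the right and to the left of the site.\<close>

fun right_count :: "letter list \<Rightarrow> nat" where
  "right_count [] = 0"
| "right_count (a # w) = (if a \<in> {Arrive, Cross, Mark} then 1 else 0) + right_count w"

fun left_count :: "letter list \<Rightarrow> nat" where
  "left_count [] = 0"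
| "left_count (a # w) = (if a \<in> {Leave, Cross, Mark} then 1 else 0) + left_count w"

text \<open>The degrees of a jump are distributed over the sites it meets: \<open>Leave\<close> carries the degree of an
  arrow without markings and crossings, \<open>Cross\<close> and \<open>Mark\<close> carry the corrections.\<close>

fun letter_h :: "letter \<Rightarrow> int" where
  "letter_h Leave = 1"
| "letter_h Arrive = 0"
| "letter_h Mark = 0"
| "letter_h Dot = -1"
| "letter_h Cross = -1"

fun letter_t :: "letter \<Rightarrow> int" where
  "letter_t Leave = 1"
| "letter_t Arrive = 0"
| "letter_t Mark = 1"
| "letter_t Dot = -1"
| "letter_t Cross = 0"

abbreviation word_h :: "letter list \<Rightarrow> int" where "word_h w \<equiv> sum_list (map letter_h w)"
abbreviation word_t :: "letter list \<Rightarrow> int" where "word_t w \<equiv> sum_list (map letter_t w)"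

lemma not_starts_dot: "\<not> starts_dot w \<Longrightarrow> dot w = bas (Dot # w) \<and> cross w = Cross # w"
  by (cases w rule: dot.cases) simp_all

lemma starts_dot_cases:
  obtains (dot) v where "w = Dot # v" "starts_dot w" | (other) "\<not> starts_dot w"
  by (cases w rule: dot.cases) auto

lemma dot_dot [simp]: "lin dot (dot w) = 0"
  by (cases w rule: dot.cases) simp_all

lemma dot_cross: "dot (cross w) = lin (\<lambda>u. bas (cross u)) (dot w)"
  by (cases w rule: dot.cases) simp_all

lemma dloc_dot: "lin dloc (dot w) = lin dot (dloc w)"
  by (cases w rule: starts_dot_cases) (simp_all add: lin_lin not_starts_dot)

lemma lvalid_cross [simp]: "lvalid True (cross w) = lvalid True w" "lvalid False (cross w) = False"
  by (cases w rule: dot.cases, auto)+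

lemma cross_counts [simp]:
  "right_count (cross w) = Suc (right_count w)" "left_count (cross w) = Suc (left_count w)"
  "word_h (cross w) = word_h w - 1" "word_t (cross w) = word_t w"
  by (cases w rule: dot.cases, auto)+

lemma keys_dot: "u \<in> Poly_Mapping.keys (dot w) \<Longrightarrow> u = Dot # w \<and> \<not> starts_dot w"
  by (cases w rule: dot.cases) (simp_all split: if_splits)

lemma dloc_cross:
  assumes "lvalid s w"
  shows "dloc (cross w) = bas (Dot # Leave # Arrive # w) + lin (pre [Leave, Arrive]) (dot w) +
     lin (\<lambda>u. bas (cross u)) (dloc w)"
proof (cases w rule: starts_dot_cases)
  case (dot v)
  then have "\<not> starts_dot v" using assms by simp
  moreover have "lin dot (lin (\<lambda>u. bas (cross u)) (dloc v)) = lin (\<lambda>u. bas (cross u)) (lin dot (dloc v))"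
    by (simp add: lin_lin dot_cross)
  ultimately show ?thesis
    using dot by (simp add: not_starts_dot)
next
  case other
  then show ?thesis by (simp add: not_starts_dot)
qed

lemma dloc_keys:
  assumes "u \<in> Poly_Mapping.keys (dloc w)"
  shows "(lvalid s w \<longrightarrow> lvalid s u) \<and> right_count u = right_count w \<and> left_count u = left_count w \<and>
    word_h u = word_h w + 1 \<and> word_t u = word_t w"
  using assms
proof (induction w arbitrary: u s rule: dloc.induct)
  case (2 w)
  then obtain k where k: "k \<in> Poly_Mapping.keys (dloc w)" "u \<in> Poly_Mapping.keys (dot k)"
    by (auto dest: keys_lin)
  from 2(1)[OF k(1), of True] keys_dot[OF k(2)] show ?case by auto
next
  case (3 w)
  then obtain k where k: "k \<in> Poly_Mapping.keys (dloc w)" "u = Arrive # k"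
    by (auto dest!: keys_lin split: if_splits)
  from 3(1)[OF k(1), of True] k(2) show ?case by auto
next
  case (4 w)
  then obtain k where k: "k \<in> Poly_Mapping.keys (dloc w)" "u = Leave # k"
    by (auto dest!: keys_lin split: if_splits)
  from 4(1)[OF k(1), of False] k(2) show ?case by auto
next
  case (5 w)
  then consider "u = Arrive # Leave # w" | k where "k \<in> Poly_Mapping.keys (dloc w)" "u = Mark # k"
    by (auto dest!: keys_plus keys_lin split: if_splits)
  then show ?case
  proof cases
    case (2 k)
    from 5(1)[OF 2(1), of False] 2(2) show ?thesis by auto
  qed auto
next
  case (6 w)
  then consider "u = Dot # Leave # Arrive # w" | "u = Leave # Arrive # Dot # w" "\<not> starts_dot w"
    | k where "k \<in> Poly_Mapping.keys (dloc w)" "u = cross k"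
    by (auto dest!: keys_plus keys_lin keys_dot split: if_splits)
  then show ?case
  proof cases
    case (3 k)
    have "lvalid s (Cross # w) \<longrightarrow> lvalid s (cross k)"
      using 6(1)[OF 3(1), of True] by (cases s) auto
    with 6(1)[OF 3(1)] 3(2) show ?thesis by auto
  qed auto
qed simp

lemmas dloc_keys_valid = dloc_keys[THEN conjunct1, rule_format]

text \<open>Validity matters here only through the normal form: \<open>dloc_cross\<close> fails on words that begin with two
  \<open>Dot\<close>s.\<close>

lemma dloc_dloc: "lvalid s w \<Longrightarrow> lin dloc (dloc w) = 0"
proof (induction w arbitrary: s rule: dloc.induct)
  case (2 w)
  have "lin dloc (lin dot (dloc w)) = lin dot (lin dloc (dloc w))"
    by (simp add: lin_lin dloc_dot)
  moreover have "lvalid True w" using 2 by simp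
  ultimately show ?case using 2(1) by simp
next
  case (6 w)
  have w: "lvalid True w" using 6 by simp
  have "lin dloc (lin (\<lambda>u. bas (cross u)) (dloc w)) =
      lin (\<lambda>u. bas (Dot # Leave # Arrive # u) + lin (pre [Leave, Arrive]) (dot u) +
     lin (\<lambda>u. bas (cross u)) (dloc u)) (dloc w)"
    unfolding lin_lin by (intro lin_cong) (simp add: dloc_cross[OF dloc_keys_valid[OF _ w]])
  also have "\<dots> = lin (pre [Dot, Leave, Arrive]) (dloc w) + lin (pre [Leave, Arrive]) (lin dot (dloc w))
      + lin (\<lambda>u. bas (cross u)) (lin dloc (dloc w))"
    by (simp add: lin_add_fun lin_lin)
  also have "lin dloc (dloc w) = 0" using 6(1) w by simp
  finally have 1: "lin dloc (lin (\<lambda>u. bas (cross u)) (dloc w)) =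
    lin (pre [Dot, Leave, Arrive]) (dloc w) + lin (pre [Leave, Arrive]) (lin dot (dloc w))" by simp
  have 2: "lin dloc (lin (pre [Leave, Arrive]) (dot w)) = lin (pre [Leave, Arrive]) (lin dot (dloc w))"
  proof -
    have "lin dloc (lin (pre [Leave, Arrive]) (dot w)) = lin (pre [Leave, Arrive]) (lin dloc (dot w))"
      by (simp add: lin_lin)
    then show ?thesis by (simp add: dloc_dot)
  qed
  have 3: "dloc (Dot # Leave # Arrive # w) = lin (pre [Dot, Leave, Arrive]) (dloc w)"
    by (simp add: lin_lin)
  have "lin dloc (dloc (Cross # w)) = dloc (Dot # Leave # Arrive # w) +
      lin dloc (lin (pre [Leave, Arrive]) (dot w)) + lin dloc (lin (\<lambda>u. bas (cross u)) (dloc w))"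
    by (simp only: dloc.simps(6) lin_add lin_bas)
  also have "\<dots> = 0" unfolding 1 2 3 by (rule pm_char_two)
  finally show ?case .
next
  case (3 w)
  have "lin dloc (lin (pre [Arrive]) (dloc w)) = lin (pre [Arrive]) (lin dloc (dloc w))"
    by (simp add: lin_lin)
  moreover have "lvalid True w" using 3 by simp
  ultimately show ?case using 3(1) by simp
next
  case (4 w)
  have "lin dloc (lin (pre [Leave]) (dloc w)) = lin (pre [Leave]) (lin dloc (dloc w))"
    by (simp add: lin_lin)
  moreover have "lvalid False w" using 4 by simp
  ultimately show ?case using 4(1) by simp
next
  case (5 w)
  have "lin dloc (lin (pre [Mark]) (dloc w)) =
      lin (pre [Arrive, Leave]) (dloc w) + lin (pre [Mark]) (lin dloc (dloc w))"
    by (simp add: lin_lin lin_add_fun)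
  moreover have "lin dloc (dloc w) = 0" using 5(1)[of False] 5(2) by simp
  moreover have "dloc (Arrive # Leave # w) = lin (pre [Arrive, Leave]) (dloc w)"
    by (simp add: lin_lin)
  moreover have "lin dloc (dloc (Mark # w)) = dloc (Arrive # Leave # w) + lin dloc (lin (pre [Mark]) (dloc w))"
    by (simp only: dloc.simps(5) lin_add lin_bas)
  ultimately show ?case by (simp only: lin_zero add_0_right pm_char_two)
qed simp

subsection \<open>The contracting homotopy\<close>

text \<open>This inverts the differential in the two cases needed: on all words with two jumps to the right and
  one to the left, and on the words of negative weight with one jump on either side. In
  the sixth line the second summand cancels the second term of \<open>dloc\<close> applied to the first.\<close>

definition hloc :: "letter list \<Rightarrow> letter list \<Rightarrow>\<^sub>0 bit" where
  "hloc w =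
    (if w = [Arrive, Leave] then bas [Mark]
     else if w = [Dot, Leave, Arrive] then bas [Cross]
     else if w = [Dot, Leave, Arrive, Dot] then bas [Dot, Cross]
     else if w = [Arrive, Leave, Arrive] then bas [Mark, Arrive]
     else if w = [Arrive, Leave, Arrive, Dot] then bas [Mark, Arrive, Dot]
     else if w = [Arrive, Dot, Leave, Arrive] then bas [Arrive, Cross] + bas [Mark, Arrive, Dot]
     else if w = [Arrive, Dot, Leave, Arrive, Dot] then bas [Arrive, Dot, Cross]
     else 0)"

lemma hloc_keys:
  assumes "u \<in> Poly_Mapping.keys (hloc w)"
  shows "(lvalid s w \<longrightarrow> lvalid s u) \<and> right_count u = right_count w \<and> left_count u = left_count w \<and>
    word_h u = word_h w + -1 \<and> word_t u = word_t w"
  using assms by (auto simp: hloc_def dest!: keys_plus split: if_splits)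

text \<open>The map homotopic to the identity through \<open>hloc\<close>.\<close>

definition qloc :: "letter list \<Rightarrow> letter list \<Rightarrow>\<^sub>0 bit" where
  "qloc w = bas w + (lin dloc (hloc w) + lin hloc (dloc w))"

lemma lvalid_count_le: "lvalid s w \<Longrightarrow>
   (if s then right_count w \<le> left_count w \<and> left_count w \<le> Suc (right_count w)
    else left_count w \<le> right_count w \<and> right_count w \<le> Suc (left_count w))"
  by (induction s w rule: lvalid.induct) (auto split: if_splits)

lemma lvalid_False_cases:
  assumes "lvalid False w"
  obtains "w = []" | u where "w = Arrive # u" "lvalid True u" | u where "w = Mark # u" "lvalid False u"
  using assms by (cases w; cases "hd w") auto

lemma lvalid_True_cases:
  assumes "lvalid True w"
  obtains "w = []" | "w = [Dot]"
    | u where "w = Leave # u" "lvalid False u" | u where "w = Dot # Leave # u" "lvalid False u"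
    | u where "w = Cross # u" "lvalid True u" "\<not> starts_dot u"
    | u where "w = Dot # Cross # u" "lvalid True u" "\<not> starts_dot u"
proof (cases w)
  case (Cons a v)
  then show ?thesis
    using assms that by (cases a; cases v; cases "hd v") auto
qed (use that in simp)

lemma lvalid_00:
  "lvalid True w \<Longrightarrow> right_count w = 0 \<Longrightarrow> left_count w = 0 \<Longrightarrow> w = [] \<or> w = [Dot]"
  "lvalid False w \<Longrightarrow> right_count w = 0 \<Longrightarrow> left_count w = 0 \<Longrightarrow> w = []"
   by (erule lvalid_True_cases, auto) (erule lvalid_False_cases, auto)

lemma lvalid_10:
  "lvalid False w \<Longrightarrow> right_count w = 1 \<Longrightarrow> left_count w = 0 \<Longrightarrow> w \<in> {[Arrive], [Arrive, Dot]}"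
  by (erule lvalid_False_cases) (auto dest: lvalid_00)

lemma lvalid_01:
  "lvalid True w \<Longrightarrow> right_count w = 0 \<Longrightarrow> left_count w = 1 \<Longrightarrow> w \<in> {[Leave], [Dot, Leave]}"
  by (erule lvalid_True_cases) (auto dest: lvalid_00)

lemma lvalid_11: 
  "lvalid True w \<Longrightarrow> right_count w = 1 \<Longrightarrow> left_count w = 1 \<Longrightarrow>
     w \<in> {[Leave, Arrive], [Leave, Arrive, Dot], [Dot, Leave, Arrive], [Dot, Leave, Arrive, Dot],
       [Cross], [Dot, Cross]}"
  "lvalid False w \<Longrightarrow> right_count w = 1 \<Longrightarrow> left_count w = 1 \<Longrightarrow>
     w \<in> {[Arrive, Leave], [Arrive, Dot, Leave], [Mark]}"
proof -
  show "lvalid True w \<Longrightarrow> right_count w = 1 \<Longrightarrow> left_count w = 1 \<Longrightarrow>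
     w \<in> {[Leave, Arrive], [Leave, Arrive, Dot], [Dot, Leave, Arrive], [Dot, Leave, Arrive, Dot],
       [Cross], [Dot, Cross]}"
    by (erule lvalid_True_cases) (auto dest!: lvalid_00 lvalid_10[simplified])
  show "lvalid False w \<Longrightarrow> right_count w = 1 \<Longrightarrow> left_count w = 1 \<Longrightarrow>
     w \<in> {[Arrive, Leave], [Arrive, Dot, Leave], [Mark]}"
    by (erule lvalid_False_cases) (auto dest!: lvalid_00 lvalid_01[simplified])
qed

lemma lvalid_21:
  assumes "lvalid s w" "right_count w = 2" "left_count w = 1"
  shows "w \<in> {[Mark, Arrive], [Mark, Arrive, Dot], [Arrive, Cross], [Arrive, Dot, Cross],
     [Arrive, Leave, Arrive], [Arrive, Leave, Arrive, Dot], [Arrive, Dot, Leave, Arrive],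
     [Arrive, Dot, Leave, Arrive, Dot]}"
proof -
  have "lvalid False w" using lvalid_count_le[of s w] assms by (cases s) auto
  then show ?thesis
  proof (cases rule: lvalid_False_cases)
    case (2 u)
    then have "u \<in> {[Leave, Arrive], [Leave, Arrive, Dot], [Dot, Leave, Arrive], [Dot, Leave, Arrive, Dot],
       [Cross], [Dot, Cross]}"
      using assms by (intro lvalid_11) auto
    then show ?thesis using 2 by auto
  next
    case (3 u)
    then have "u \<in> {[Arrive], [Arrive, Dot]}"
      using assms by (intro lvalid_10) auto
    then show ?thesis using 3 by auto
  qed (use assms in simp)
qed

lemma qloc_21:
  assumes "lvalid s w" "right_count w = 2" "left_count w = 1"
  shows "qloc w = 0"
  using lvalid_21[OF assms]
  by (elim insertE emptyE; hypsubst) (simp_all add: qloc_def hloc_def add.assoc)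

lemma qloc_11:
  assumes "lvalid s w" "right_count w = 1" "left_count w = 1" "Cross \<in> set w \<or> Mark \<in> set w"
  shows "qloc w = 0"
proof -
  have "w \<in> {[Cross], [Dot, Cross], [Mark]}"
    using assms(1) assms(4) lvalid_11(1)[OF _ assms(2,3)] lvalid_11(2)[OF _ assms(2,3)]
    by (cases s) auto
  then show ?thesis
    by (elim insertE emptyE; hypsubst) (simp_all add: qloc_def hloc_def add.assoc)
qed

section \<open>Configurations of site words\<close>

text \<open>The initial vertex of a path, and the history of each site.\<close>

type_synonym cfg = "nat list \<times> (nat \<Rightarrow> letter list)"

text \<open>The extension of a map on site words to configurations, acting at site \<open>m\<close> only.\<close>

definition site :: "nat \<Rightarrow> (letter list \<Rightarrow> letter list \<Rightarrow>\<^sub>0 bit) \<Rightarrow> cfg \<Rightarrow> cfg \<Rightarrow>\<^sub>0 bit" where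
  "site m F b = lin (\<lambda>u. bas (fst b, (snd b)(m := u))) (F (snd b m))"

definition cfg_diff :: "nat \<Rightarrow> cfg \<Rightarrow> cfg \<Rightarrow>\<^sub>0 bit" where
  "cfg_diff n b = (\<Sum>m\<in>{1..n}. site m dloc b)"

text \<open>Sites outside \<open>{1..n}\<close> have the empty history, so the last condition also says that nothing jumps
  over the two outer edges.\<close>

definition valid :: "nat \<Rightarrow> cfg \<Rightarrow> bool" where
  "valid n b \<longleftrightarrow> fst b \<in> vertices n \<and> (\<forall>m. m \<notin> {1..n} \<longrightarrow> snd b m = []) \<and>
     (\<forall>m. lvalid (m \<in> set (fst b)) (snd b m)) \<and>
     (\<forall>m. right_count (snd b m) = left_count (snd b (Suc m)))"

definition cfg_h :: "nat \<Rightarrow> cfg \<Rightarrow> int" where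
  "cfg_h n b = (\<Sum>m\<in>{1..n}. word_h (snd b m))"

definition cfg_t :: "nat \<Rightarrow> cfg \<Rightarrow> int" where
  "cfg_t n b = (\<Sum>m\<in>{1..n}. word_t (snd b m))"

lemma site_comp: "lin (site m F) (site m G b) = site m (\<lambda>w. lin F (G w)) b"
  by (simp add: site_def lin_lin)

lemma site_commute: "m \<noteq> m' \<Longrightarrow> lin (site m F) (site m' G b) = lin (site m' G) (site m F b)"
  by (simp add: site_def lin_lin fun_upd_twist[of m m'] lin_swap[of _ "F _" "G _"])

lemma site_bas [simp]: "site m bas b = bas b"
  by (simp add: site_def)

lemma site_add: "site m (\<lambda>w. F w + G w) b = site m F b + site m G b"
  by (simp add: site_def)

lemma site_zero: "F (snd b m) = 0 \<Longrightarrow> site m F b = 0"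
  by (simp add: site_def)

lemma keys_site: "b' \<in> Poly_Mapping.keys (site m F b) \<Longrightarrow>
    \<exists>u\<in>Poly_Mapping.keys (F (snd b m)). b' = (fst b, (snd b)(m := u))"
  unfolding site_def by (auto dest!: keys_lin split: if_splits)

lemma valid_site:
  assumes b: "valid n b" and m: "m \<in> {1..n}" and b': "b' \<in> Poly_Mapping.keys (site m F b)"
    and F: "\<And>u w s. u \<in> Poly_Mapping.keys (F w) \<Longrightarrow> (lvalid s w \<longrightarrow> lvalid s u) \<and>
      right_count u = right_count w \<and> left_count u = left_count w \<and>
      word_h u = word_h w + d \<and> word_t u = word_t w"
  shows "valid n b' \<and> cfg_h n b' = cfg_h n b + d \<and> cfg_t n b' = cfg_t n b"
proof -
  obtain u where u: "u \<in> Poly_Mapping.keys (F (snd b m))" "b' = (fst b, (snd b)(m := u))"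
    using keys_site[OF b'] by blast
  note Fu = F[OF u(1)]
  have "cfg_h n b' = word_h u + (\<Sum>k\<in>{1..n} - {m}. word_h (snd b k))"
    using m by (simp add: cfg_h_def u sum.remove[of _ m])
  moreover have "cfg_h n b = word_h (snd b m) + (\<Sum>k\<in>{1..n} - {m}. word_h (snd b k))"
    using m by (simp add: cfg_h_def sum.remove[of _ m])
  moreover have "cfg_t n b' = word_t u + (\<Sum>k\<in>{1..n} - {m}. word_t (snd b k))"
    using m by (simp add: cfg_t_def u sum.remove[of _ m])
  moreover have "cfg_t n b = word_t (snd b m) + (\<Sum>k\<in>{1..n} - {m}. word_t (snd b k))"
    using m by (simp add: cfg_t_def sum.remove[of _ m])
  moreover have "valid n b'"
    using b m Fu by (auto simp: valid_def u)
  ultimately show ?thesis using Fu by simp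
qed

lemma valid_cfg_diff:
  assumes "valid n b" "b' \<in> Poly_Mapping.keys (cfg_diff n b)"
  shows "valid n b' \<and> cfg_h n b' = cfg_h n b + 1 \<and> cfg_t n b' = cfg_t n b"
proof -
  obtain m where "m \<in> {1..n}" "b' \<in> Poly_Mapping.keys (site m dloc b)"
    using assms(2) keys_sum_subset[of "\<lambda>m. site m dloc b" "{1..n}"] by (auto simp: cfg_diff_def)
  from valid_site[OF assms(1) this dloc_keys] show ?thesis .
qed

lemma cfg_diff_square:
  assumes "valid n b"
  shows "lin (cfg_diff n) (cfg_diff n b) = 0"
proof -
  let ?T = "\<lambda>m m'. lin (site m dloc) (site m' dloc b)"
  have diag: "?T m m = 0" for m
  proof -
    have "lin dloc (dloc (snd b m)) = 0"
      using assms dloc_dloc[of "m \<in> set (fst b)"] by (simp add: valid_def)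
    then show ?thesis by (simp add: site_comp site_zero)
  qed
  have sym: "?T m m' = ?T m' m" for m m'
    using site_commute[of m m'] by (cases "m = m'") auto
  have "finite S \<Longrightarrow> (\<Sum>m'\<in>S. \<Sum>m\<in>S. ?T m m') = 0" for S
  proof (induction S rule: finite_induct)
    case (insert a S)
    have "(\<Sum>m'\<in>insert a S. \<Sum>m\<in>insert a S. ?T m m') =
        ?T a a + (\<Sum>m\<in>S. ?T m a) + ((\<Sum>m'\<in>S. ?T a m') + (\<Sum>m'\<in>S. \<Sum>m\<in>S. ?T m m'))"
      using insert by (simp add: sum.distrib)
    also have "(\<Sum>m'\<in>S. ?T a m') = (\<Sum>m\<in>S. ?T m a)" by (intro sum.cong sym refl)
    finally show ?case using insert diag by simp
  qed simp
  moreover have "lin (cfg_diff n) (cfg_diff n b) = (\<Sum>m'\<in>{1..n}. \<Sum>m\<in>{1..n}. ?T m m')"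
    unfolding cfg_diff_def lin_sum lin_sum_fun ..
  ultimately show ?thesis by simp
qed

lemma cfg_diff_square_lin:
  assumes "\<And>b. b \<in> Poly_Mapping.keys z \<Longrightarrow> valid n b"
  shows "lin (cfg_diff n) (lin (cfg_diff n) z) = 0"
proof -
  have "lin (cfg_diff n) (lin (cfg_diff n) z) = lin (\<lambda>b. 0) z"
    unfolding lin_lin using assms by (intro lin_cong cfg_diff_square)
  then show ?thesis by simp
qed

subsection \<open>Exactness below the diagonal\<close>

text \<open>\<open>homotope m\<close> is the identity plus the commutator of the differential with \<open>hloc\<close> at site \<open>m\<close>
  (\<open>homotope_eq\<close>), because the homotopy at \<open>m\<close> commutes with the differentials at all other sites.
  These maps commute, and a cocycle is cohomologous to its image under each of them.\<close>

definition homotope :: "nat \<Rightarrow> (cfg \<Rightarrow>\<^sub>0 bit) \<Rightarrow> cfg \<Rightarrow>\<^sub>0 bit" where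
  "homotope m = lin (site m qloc)"

lemma site_homotopy:
  assumes m: "m \<in> {1..n}"
  shows "lin (cfg_diff n) (site m hloc b) + lin (site m hloc) (cfg_diff n b) =
    site m (\<lambda>w. lin dloc (hloc w) + lin hloc (dloc w)) b"
proof -
  have split: "cfg_diff n b = site m dloc b + (\<Sum>k\<in>{1..n} - {m}. site k dloc b)" for b
    unfolding cfg_diff_def using m by (intro sum.remove) auto
  have "(\<Sum>k\<in>{1..n} - {m}. lin (site k dloc) (site m hloc b)) =
      (\<Sum>k\<in>{1..n} - {m}. lin (site m hloc) (site k dloc b))"
    by (intro sum.cong refl site_commute) auto
  moreover have "lin (cfg_diff n) (site m hloc b) = lin (site m dloc) (site m hloc b) +
      (\<Sum>k\<in>{1..n} - {m}. lin (site k dloc) (site m hloc b))"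
    unfolding split[abs_def] by (simp add: lin_add_fun lin_sum_fun)
  moreover have "lin (site m hloc) (cfg_diff n b) = lin (site m hloc) (site m dloc b) +
      (\<Sum>k\<in>{1..n} - {m}. lin (site m hloc) (site k dloc b))"
    unfolding split by simp
  moreover have "(a + s) + (c + s) = a + c" for a c s :: "cfg \<Rightarrow>\<^sub>0 bit"
    using pm_char_two'[of s c] by (simp add: add.assoc add.left_commute[of s c])
  ultimately show ?thesis
    by (simp add: site_comp site_add)
qed

lemma homotope_eq:
  assumes "m \<in> {1..n}"
  shows "homotope m z = z + (lin (cfg_diff n) (lin (site m hloc) z) + lin (site m hloc) (lin (cfg_diff n) z))"
proof (induction z rule: bas_induct)
  case (add k z)
  have "homotope m (bas k) = site m qloc k" by (simp add: homotope_def)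
  also have "\<dots> = bas k + (lin (cfg_diff n) (site m hloc k) + lin (site m hloc) (cfg_diff n k))"
    by (simp only: site_homotopy[OF assms] qloc_def[abs_def] site_add site_bas)
  finally have "homotope m (bas k + z) = (bas k + (lin (cfg_diff n) (site m hloc k) + lin (site m hloc) (cfg_diff n k)))
      + homotope m z"
    by (simp add: homotope_def)
  then show ?case unfolding add by (simp add: ac_simps)
qed (simp add: homotope_def)

lemma homotope_commute: "homotope m (homotope m' z) = homotope m' (homotope m z)"
proof (cases "m = m'")
  case False
  then show ?thesis by (simp add: homotope_def lin_lin site_commute[of m m'])
qed simp

lemma fold_homotope_commute: "homotope m (foldr homotope ms z) = foldr homotope ms (homotope m z)"
  by (induction ms) (simp_all add: homotope_commute)

lemma foldr_homotope_add: "foldr homotope ms (y + z) = foldr homotope ms y + foldr homotope ms z"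
  by (induction ms) (simp_all add: homotope_def)

lemma foldr_homotope_zero: "foldr homotope ms 0 = 0"
  by (induction ms) (simp_all add: homotope_def)

lemma foldr_homotope_kills:
  assumes "m \<in> set ms" "qloc (snd b m) = 0"
  shows "foldr homotope ms (bas b) = 0"
  using assms(1)
proof (induction ms)
  case (Cons a ms)
  show ?case
  proof (cases "m = a")
    case True
    have "homotope a (bas b) = 0"
      using True assms(2) by (simp add: homotope_def site_zero)
    then show ?thesis by (simp add: fold_homotope_commute foldr_homotope_zero)
  next
    case False
    with Cons show ?thesis by (simp add: homotope_def)
  qed
qed simp

lemma word_t_h: "word_h w \<le> word_t w" "word_h w < word_t w \<Longrightarrow> Cross \<in> set w \<or> Mark \<in> set w"
proof -
  have "word_h w \<le> word_t w \<and> (word_h w < word_t w \<longrightarrow> Cross \<in> set w \<or> Mark \<in> set w)"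
  proof (induction w)
    case (Cons a w)
    then show ?case by (cases a) auto
  qed simp
  then show "word_h w \<le> word_t w" "word_h w < word_t w \<Longrightarrow> Cross \<in> set w \<or> Mark \<in> set w" by auto
qed

lemma cross_mark_counts:
  "Cross \<in> set w \<or> Mark \<in> set w \<Longrightarrow> right_count w > 0 \<and> left_count w > 0"
  by (induction w) auto

lemma cfg_h_le_t: "cfg_h n b \<le> cfg_t n b"
  unfolding cfg_h_def cfg_t_def by (intro sum_mono word_t_h)

text \<open>If some edge is jumped over at least twice, the left end of the leftmost such edge is killed;
  otherwise every site with a \<open>Cross\<close> or \<open>Mark\<close> is.\<close>

lemma exists_killed_site:
  assumes b: "valid n b" and less: "cfg_h n b < cfg_t n b"
  shows "\<exists>m\<in>{1..n}. qloc (snd b m) = 0"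
proof (cases "\<exists>k. right_count (snd b k) \<ge> 2")
  case True
  define m where "m = (LEAST k. right_count (snd b k) \<ge> 2)"
  have m: "right_count (snd b m) \<ge> 2" and least: "k < m \<Longrightarrow> right_count (snd b k) < 2" for k
    using LeastI_ex[OF True] not_less_Least[of k "\<lambda>k. right_count (snd b k) \<ge> 2"]
    by (auto simp: m_def)
  have "m \<in> {1..n}"
  proof (rule ccontr)
    assume "m \<notin> {1..n}"
    then have "snd b m = []" using b by (simp add: valid_def)
    with m show False by simp
  qed
  then obtain k where k: "m = Suc k" by (cases m) auto
  have lv: "lvalid (m \<in> set (fst b)) (snd b m)" using b by (simp add: valid_def)
  have "left_count (snd b m) \<le> 1"
    using least[of k] b k by (metis valid_def less_2_cases_iff One_nat_def lessI le0 order_refl)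
  then have "right_count (snd b m) = 2" "left_count (snd b m) = 1"
    using m lvalid_count_le[OF lv] by (auto split: if_splits)
  then have "qloc (snd b m) = 0" by (rule qloc_21[OF lv])
  with \<open>m \<in> {1..n}\<close> show ?thesis by blast
next
  case False
  have "\<exists>m\<in>{1..n}. word_h (snd b m) < word_t (snd b m)"
  proof (rule ccontr)
    assume "\<not> ?thesis"
    then have "cfg_t n b \<le> cfg_h n b"
      unfolding cfg_h_def cfg_t_def by (intro sum_mono) force
    with less show False by simp
  qed
  then obtain m where m: "m \<in> {1..n}" "word_h (snd b m) < word_t (snd b m)" by blast
  then have cm: "Cross \<in> set (snd b m) \<or> Mark \<in> set (snd b m)" by (intro word_t_h)
  have lv: "lvalid (m \<in> set (fst b)) (snd b m)" using b by (simp add: valid_def)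
  obtain k where k: "m = Suc k" using m by (cases m) auto
  have "right_count (snd b m) < 2" "right_count (snd b k) < 2" using False by (auto simp: not_le)
  moreover have "left_count (snd b m) = right_count (snd b k)" using b k by (simp add: valid_def)
  ultimately have "right_count (snd b m) = 1" "left_count (snd b m) = 1"
    using cross_mark_counts[OF cm] by auto
  with m(1) qloc_11[OF lv _ _ cm] show ?thesis by blast
qed

lemma valid_hloc:
  assumes "valid n b" "m \<in> {1..n}" "b' \<in> Poly_Mapping.keys (site m hloc b)"
  shows "valid n b'"
  using valid_site[OF assms hloc_keys] by blast

lemma valid_keys_cfg_diff:
  assumes "\<And>b. b \<in> Poly_Mapping.keys z \<Longrightarrow> valid n b" "b' \<in> Poly_Mapping.keys (lin (cfg_diff n) z)"
  shows "valid n b'"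
  using keys_lin[OF assms(2)] assms(1) valid_cfg_diff by blast

lemma valid_keys_hloc:
  assumes "\<And>b. b \<in> Poly_Mapping.keys z \<Longrightarrow> valid n b" "m \<in> {1..n}"
    "b' \<in> Poly_Mapping.keys (lin (site m hloc) z)"
  shows "valid n b'"
  using keys_lin[OF assms(3)] assms(1) valid_hloc[OF _ assms(2)] by blast

text \<open>A cocycle is cohomologous to its image under the product of all \<open>homotope m\<close>, and this product kills
  every basis element below the diagonal.\<close>

theorem exact_below_diagonal:
  assumes z: "\<And>b. b \<in> Poly_Mapping.keys z \<Longrightarrow> valid n b \<and> cfg_h n b < cfg_t n b"
    and cocycle: "lin (cfg_diff n) z = 0"
  shows "\<exists>y. (\<forall>b\<in>Poly_Mapping.keys y. valid n b) \<and> lin (cfg_diff n) y = z"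
proof -
  let ?D = "lin (cfg_diff n)"
  let ?V = "\<lambda>z. \<forall>b\<in>Poly_Mapping.keys z. valid n b"
  have step: "set ms \<subseteq> {1..n} \<Longrightarrow> ?V (foldr homotope ms z) \<and> ?D (foldr homotope ms z) = 0 \<and>
      (\<exists>y. ?V y \<and> ?D y = z + foldr homotope ms z)" for ms
  proof (induction ms)
    case Nil
    show ?case using z cocycle by (auto intro!: exI[of _ 0])
  next
    case (Cons m ms)
    let ?w = "foldr homotope ms z"
    have m: "m \<in> {1..n}" using Cons.prems by simp
    have w: "?V ?w" "?D ?w = 0" using Cons by auto
    obtain y where y: "?V y" "?D y = z + ?w" using Cons by auto
    have eq: "homotope m ?w = ?w + ?D (lin (site m hloc) ?w)"
      using w by (simp add: homotope_eq[OF m])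
    have Vh: "?V (lin (site m hloc) ?w)"
      using w(1) valid_keys_hloc[OF _ m, of ?w] by blast
    have DD: "?D (?D (lin (site m hloc) ?w)) = 0"
      using Vh by (intro cfg_diff_square_lin) auto
    have "?V (homotope m ?w)"
      unfolding eq using w(1) Vh valid_keys_cfg_diff[of "lin (site m hloc) ?w" n]
      by (meson keys_plus)
    moreover have "?D (homotope m ?w) = 0"
      unfolding eq by (simp add: w DD)
    moreover have "?V (y + lin (site m hloc) ?w)"
      using y(1) Vh by (meson keys_plus)
    moreover have "?D (y + lin (site m hloc) ?w) = z + homotope m ?w"
      unfolding eq by (simp add: y(2) add.assoc)
    ultimately show ?case by (auto simp del: lin_add)
  qed
  have "foldr homotope [1..<Suc n] z = 0"
    using z
  proof (induction z rule: bas_induct)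
    case (add k z)
    have kin: "k \<in> Poly_Mapping.keys (bas k + z)" "\<And>b. b \<in> Poly_Mapping.keys z \<Longrightarrow> b \<in> Poly_Mapping.keys (bas k + z)"
      using add(1) by (auto simp: in_keys_iff lookup_add lookup_single when_def)
    have "valid n k" "cfg_h n k < cfg_t n k" using add(3)[OF kin(1)] by auto
    then obtain m where "m \<in> {1..n}" "qloc (snd k m) = 0" using exists_killed_site by blast
    then have "foldr homotope [1..<Suc n] (bas k) = 0" by (intro foldr_homotope_kills) auto
    moreover have "foldr homotope [1..<Suc n] z = 0" using add(2,3) kin(2) by blast
    ultimately show ?case by (simp only: foldr_homotope_add add_0_right)
  qed (rule foldr_homotope_zero)
  with step[of "[1..<Suc n]"] show ?thesis by (auto simp: atLeastLessThanSuc_atLeastAtMost simp del: upt_Suc)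
qed

section \<open>Arrows and loops of the quiver\<close>

lemma vertices_eqI: "x \<in> vertices n \<Longrightarrow> y \<in> vertices n \<Longrightarrow> set x = set y \<Longrightarrow> x = y"
  by (metis (no_types, lifting) mem_Collect_eq strict_sorted_equal vertices_def)

lemma vertices_iff: "x \<in> vertices n \<longleftrightarrow> sorted_wrt (<) x \<and> set x \<subseteq> {1..n}"
  by (simp add: vertices_def)

lemma finite_vertices: "finite (vertices n)"
proof (rule finite_subset)
  show "vertices n \<subseteq> sorted_list_of_set ` Pow {1..n}"
  proof
    fix x assume x: "x \<in> vertices n"
    then have "sorted_list_of_set (set x) = x"
      by (simp add: vertices_iff strict_sorted_iff sorted_list_of_set.idem_if_sorted_distinct)
    moreover have "set x \<in> Pow {1..n}" using x by (simp add: vertices_iff)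
    ultimately show "x \<in> sorted_list_of_set ` Pow {1..n}" by (metis imageI)
  qed
qed simp

text \<open>The data of an arrow starting at \<open>x\<close>: the entry \<open>q\<close> is replaced by the smaller number \<open>p\<close>. The arrow
  then ends at \<open>replace q p x\<close>.\<close>

definition step :: "nat \<Rightarrow> nat list \<Rightarrow> nat \<Rightarrow> nat \<Rightarrow> bool" where
  "step n x p q \<longleftrightarrow> x \<in> vertices n \<and> q \<in> set x \<and> p \<notin> set x \<and> 1 \<le> p \<and> p < q"

lemma set_replace: "set (replace q m x) = insert m (set x - {q})"
  unfolding replace_def by (rule set_sorted_list_of_set) simp

lemma sorted_replace: "sorted_wrt (<) (replace q m x)"
  unfolding replace_def by (rule strict_sorted_list_of_set)

lemma replace_vertices:
  assumes "x \<in> vertices n" "1 \<le> m" "m \<le> n"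
  shows "replace q m x \<in> vertices n"
  using assms by (auto simp: vertices_iff set_replace sorted_replace)

lemma step_replace: "step n x p q \<Longrightarrow> replace q p x \<in> vertices n"
  by (rule replace_vertices) (auto simp: step_def vertices_iff)

text \<open>The entries of \<open>v\<close> telescope, so that their sum is the number of markings.\<close>

lemma sum_gaps: "sorted_wrt (<) (p # c @ [q]) \<Longrightarrow>
   sum_list (map2 (\<lambda>a b. a - b - 1) (c @ [q]) (p # c)) + length c + 1 + p = (q :: nat)"
proof (induction c arbitrary: p)
  case (Cons a c)
  then have "sorted_wrt (<) (a # c @ [q])" by simp
  from Cons.IH[OF this] Cons.prems show ?case by simp
qed auto

text \<open>In terms of lists: \<open>c\<close> consists of the entries that are crossed, which are shifted by one
  position.\<close>

lemma arrow_shape: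
  assumes "is_arrow n x i s v y"
  obtains a c b p q where "x = a @ c @ q # b" "y = a @ p # c @ b" "i = length a + 1" "s = length c"
    "v = map2 (\<lambda>a b. a - b - 1) (c @ [q]) (p # c)" "sorted_wrt (<) (p # c @ [q])"
    "entry y i = p" "entry x (i + s) = q"
proof -
  have len: "length x = length y" and i: "1 \<le> i" "i + s \<le> length x"
    and lt: "entry y i < entry x i"
    and shift: "\<And>j. i \<le> j \<Longrightarrow> j < i + s \<Longrightarrow> entry y (j + 1) = entry x j"
    and same: "\<And>j. 1 \<le> j \<Longrightarrow> j \<le> length x \<Longrightarrow> j \<notin> {i..i + s} \<Longrightarrow> entry y j = entry x j"
    and v: "v = map (\<lambda>j. entry x j - entry y j - 1) [i..<i + s + 1]"
    and sx: "sorted_wrt (<) x"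
    using assms by (auto simp: is_arrow_def vertices_iff)
  define a where "a = take (i - 1) x"
  define c where "c = take s (drop (i - 1) x)"
  define q where "q = x ! (i + s - 1)"
  define b where "b = drop (i + s) x"
  define p where "p = y ! (i - 1)"
  have la: "length a = i - 1" and lc: "length c = s" using i by (auto simp: a_def c_def)
  have "x = take (i - 1 + s) x @ q # drop (Suc (i - 1 + s)) x"
    using i id_take_nth_drop[of "i - 1 + s" x] by (auto simp: q_def)
  moreover have "take (i - 1 + s) x = a @ c" by (simp only: take_add a_def c_def)
  moreover have "drop (Suc (i - 1 + s)) x = b" using i by (simp add: b_def)
  ultimately have x: "x = a @ c @ q # b" by (simp only: append_assoc)
  have y: "y = a @ p # c @ b"
  proof (rule nth_equalityI)
    show "length y = length (a @ p # c @ b)" using len arg_cong[OF x, of length] by simp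
    fix k assume k: "k < length y"
    consider "k < i - 1" | "k = i - 1" | "i - 1 < k" "k \<le> i - 1 + s" | "i - 1 + s < k" by linarith
    then show "y ! k = (a @ p # c @ b) ! k"
    proof cases
      case 1
      then have "k + 1 \<notin> {i..i + s}" by auto
      then have "y ! k = x ! k" using same[of "k + 1"] k len i by (simp add: entry_def)
      then show ?thesis using 1 la by (simp add: nth_append a_def)
    next
      case 2
      then show ?thesis using la by (simp add: nth_append p_def)
    next
      case 3
      have "y ! k = x ! (k - 1)" using shift[of k] 3 i by (simp add: entry_def)
      also have "\<dots> = c ! (k - 1 - (i - 1))"
        using 3 la lc by (subst x) (simp add: nth_append, linarith)
      also have "\<dots> = (a @ p # c @ b) ! k"
      proof -
        define j where "j = k - i"
        have "k = length a + Suc j" using 3 la i by (simp add: j_def)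
        then show ?thesis using 3 la lc by (simp add: nth_append)
      qed
      finally show ?thesis .
    next
      case 4
      then have "k + 1 \<notin> {i..i + s}" by auto
      then have "y ! k = x ! k" using same[of "k + 1"] k len i by (simp add: entry_def)
      also have "\<dots> = b ! (k - (i + s))"
        using 4 i k len by (simp add: b_def)
      also have "\<dots> = (a @ p # c @ b) ! k"
      proof -
        define j where "j = k - (i + s)"
        have "k = length a + Suc (length c + j)" using 4 la lc i by (simp add: j_def)
        moreover have "(a @ p # c @ b) ! (length a + Suc (length c + j)) = b ! j"
          by (simp add: nth_append)
        ultimately show ?thesis by (simp only: j_def)
      qed
      finally show ?thesis .
    qed
  qed
  have pq: "entry y i = p" "entry x (i + s) = q" by (simp_all add: entry_def p_def q_def)
  have ia: "i = length a + 1" using la i by simp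
  have "v = map2 (\<lambda>a b. a - b - 1) (c @ [q]) (p # c)"
  proof (rule nth_equalityI)
    show "length v = length (map2 (\<lambda>a b. a - b - 1) (c @ [q]) (p # c))" by (simp add: v lc)
    fix k assume "k < length v"
    then have k: "k \<le> s" by (simp add: v)
    have "entry x (i + k) = (c @ [q]) ! k"
      using k lc by (simp add: entry_def ia x nth_append)
    moreover have "entry y (i + k) = (p # c) ! k"
      using k lc by (cases k) (simp_all add: entry_def ia y nth_append)
    ultimately show "v ! k = map2 (\<lambda>a b. a - b - 1) (c @ [q]) (p # c) ! k"
      using k lc by (simp add: v del: upt_Suc)
  qed
  moreover have "sorted_wrt (<) (p # c @ [q])"
  proof -
    have sc: "sorted_wrt (<) (c @ [q])" using sx unfolding x by (simp add: sorted_wrt_append)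
    have "entry x i = hd (c @ [q])" by (cases c) (simp_all add: entry_def ia x nth_append)
    then have "p < hd (c @ [q])" using lt pq by simp
    then show ?thesis using sc by (cases c) auto
  qed
  ultimately show ?thesis using that x y ia lc pq by blast
qed

lemma arrow_of_shape:
  assumes x: "x = a @ c @ q # b" and y: "y = a @ p # c @ b"
    and xv: "x \<in> vertices n" and yv: "y \<in> vertices n" and p: "p < hd (c @ [q])"
  shows "is_arrow n x (length a + 1) (length c)
     (map (\<lambda>j. entry x j - entry y j - 1) [length a + 1..<length a + 1 + length c + 1]) y"
  unfolding is_arrow_def
proof (intro conjI allI impI xv yv)
  show "length x = length y" "1 \<le> length a + 1" "length a + 1 + length c \<le> length x"
    by (simp_all add: x y)
  show "entry y (length a + 1) < entry x (length a + 1)"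
    using p by (cases c) (simp_all add: entry_def x y nth_append)
next
  fix j assume "length a + 1 \<le> j \<and> j < length a + 1 + length c"
  then show "entry y (j + 1) = entry x j"
    by (auto simp: entry_def x y nth_append nth_Cons')
next
  fix j assume "1 \<le> j \<and> j \<le> length x \<and> j \<notin> {length a + 1..length a + 1 + length c}"
  then show "entry y j = entry x j"
    by (auto simp: entry_def x y nth_append nth_Cons')
qed simp

lemma step_shape:
  assumes "step n x p q"
  obtains a c b where "x = a @ c @ q # b" "replace q p x = a @ p # c @ b" "p < hd (c @ [q])"
proof -
  have x: "sorted_wrt (<) x" "q \<in> set x" "p \<notin> set x" "p < q"
    using assms by (auto simp: step_def vertices_iff)
  obtain d b where db: "x = d @ q # b" using x(2) by (meson split_list)
  define a where "a = takeWhile (\<lambda>z. z < p) d"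
  define c where "c = dropWhile (\<lambda>z. z < p) d"
  have d: "d = a @ c" by (simp add: a_def c_def)
  have ap: "z < p" if "z \<in> set a" for z
    using that by (auto simp: a_def dest: set_takeWhileD)
  have sd: "sorted_wrt (<) (a @ c @ q # b)" using x(1) by (simp add: db d)
  have hdc: "p < hd (c @ [q])"
  proof (cases "c = []")
    case False
    then have "\<not> hd c < p" unfolding c_def by (rule hd_dropWhile)
    moreover have "hd c \<noteq> p" using x(3) False by (auto simp: db d)
    ultimately show ?thesis using False by simp
  qed (use x in simp)
  have cp: "p < z" if "z \<in> set (c @ q # b)" for z
  proof (cases c)
    case (Cons r c')
    then have "r \<le> z" using that sd by (auto simp: sorted_wrt_append intro: order.strict_implies_order)
    with hdc Cons show ?thesis by simp
  qed (use that x sd in \<open>auto simp: sorted_wrt_append\<close>)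
  have "sorted_wrt (<) (a @ p # c @ b)"
    using sd ap cp by (auto simp: sorted_wrt_append)
  moreover have "set (a @ p # c @ b) = set (replace q p x)"
    using sd by (auto simp: set_replace db d sorted_wrt_append)
  moreover have "sorted_wrt (<) (replace q p x)" by (rule sorted_replace)
  ultimately have "replace q p x = a @ p # c @ b" using strict_sorted_equal by metis
  then show ?thesis using that hdc db d by simp
qed

text \<open>The unique arrow of the quiver that replaces \<open>q\<close> by \<open>p\<close>.\<close>

definition arr :: "nat \<Rightarrow> nat list \<Rightarrow> nat \<Rightarrow> nat \<Rightarrow> gen" where
  "arr n x p q = (SOME g. \<exists>i s v. g = Arrow x i s v (replace q p x) \<and>
     is_arrow n x i s v (replace q p x))"

lemma arrow_sets:
  assumes "is_arrow n x i s v y"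
  shows "step n x (entry y i) (entry x (i + s))" "y = replace (entry x (i + s)) (entry y i) x"
    "set y = insert (entry y i) (set x - {entry x (i + s)})"
proof -
  have xv: "x \<in> vertices n" and yv: "y \<in> vertices n" using assms by (auto simp: is_arrow_def)
  obtain a c b p q where sh: "x = a @ c @ q # b" "y = a @ p # c @ b"
    "sorted_wrt (<) (p # c @ [q])" "entry y i = p" "entry x (i + s) = q"
    using arrow_shape[OF assms] by metis
  have sx: "sorted_wrt (<) x" and sy: "sorted_wrt (<) y" using xv yv by (auto simp: vertices_iff)
  have "p \<notin> set x" using sx sy sh(3) unfolding sh(1,2) by (auto simp: sorted_wrt_append)
  moreover have "1 \<le> p" using yv by (simp add: vertices_iff sh)
  ultimately have st: "step n x p q" using xv sh(3) by (auto simp: step_def sh)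
  then show "step n x (entry y i) (entry x (i + s))" by (simp only: sh(4,5))
  have sety: "set y = insert p (set x - {q})"
    using sx sy sh(3) unfolding sh(1,2) by (auto simp: sorted_wrt_append)
  then show "set y = insert (entry y i) (set x - {entry x (i + s)})" by (simp only: sh(4,5))
  have "y = replace q p x"
    by (rule vertices_eqI[OF yv step_replace[OF st]]) (simp add: sety set_replace)
  then show "y = replace (entry x (i + s)) (entry y i) x" unfolding sh(4,5) .
qed

lemma nth_distinct_eq: "distinct x \<Longrightarrow> i < length x \<Longrightarrow> j < length x \<Longrightarrow> x ! i = x ! j \<Longrightarrow> i = j"
  by (simp add: nth_eq_iff_index_eq)

lemma vertices_distinct: "x \<in> vertices n \<Longrightarrow> distinct x"
  by (simp add: vertices_iff strict_sorted_iff)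

lemma arrow_unique:
  assumes 1: "is_arrow n x i s v y" and 2: "is_arrow n x i' s' v' y"
  shows "i = i' \<and> s = s' \<and> v = v'"
proof -
  let ?p = "entry y i" and ?q = "entry x (i + s)" and ?p' = "entry y i'" and ?q' = "entry x (i' + s')"
  have "step n x ?p ?q" "step n x ?p' ?q'" "set y = insert ?p (set x - {?q})"
    "set y = insert ?p' (set x - {?q'})"
    using arrow_sets[OF 1] arrow_sets[OF 2] by - assumption+
  note st = this
  have in_x: "?q \<in> set x" "?q' \<in> set x" and not_in_x: "?p \<notin> set x" "?p' \<notin> set x"
    using st(1,2) by (auto simp: step_def)
  have "?q \<notin> set y" using st(3) in_x not_in_x by auto
  then have q: "?q = ?q'" using st(4) in_x by auto
  have "?p \<in> set y" using st(3) by simp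
  then have pq: "?p = ?p'" "?q = ?q'" using st(4) not_in_x q by auto
  have b: "1 \<le> i" "i + s \<le> length x" "1 \<le> i'" "i' + s' \<le> length x" "length x = length y"
    "distinct x" "distinct y"
    using 1 2 vertices_distinct by (auto simp: is_arrow_def)
  have "i - 1 < length y" "i' - 1 < length y" "i + s - 1 < length x" "i' + s' - 1 < length x"
    using b(1-5) by linarith+
  then have "i - 1 = i' - 1" "i + s - 1 = i' + s' - 1"
    using nth_distinct_eq[OF b(6)] nth_distinct_eq[OF b(7)] pq unfolding entry_def by blast+
  then have idx: "i = i'" "s = s'" using b(1-4) by linarith+
  then show ?thesis using 1 2 by (simp add: is_arrow_def)
qed

lemma arr_eqI:
  assumes "is_arrow n x i s v y"
  shows "arr n x (entry y i) (entry x (i + s)) = Arrow x i s v y"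
proof -
  let ?y = "replace (entry x (i + s)) (entry y i) x"
  have y: "?y = y" using arrow_sets(2)[OF assms] by simp
  have "(SOME g. \<exists>i s v. g = Arrow x i s v y \<and> is_arrow n x i s v y) = Arrow x i s v y"
    using assms arrow_unique by (intro some_equality) blast+
  then show ?thesis by (simp add: arr_def y)
qed

lemma step_arrow:
  assumes "step n x p q"
  obtains i s v where "is_arrow n x i s v (replace q p x)" "arr n x p q = Arrow x i s v (replace q p x)"
    "entry (replace q p x) i = p" "entry x (i + s) = q"
proof -
  obtain a c b where sh: "x = a @ c @ q # b" "replace q p x = a @ p # c @ b" "p < hd (c @ [q])"
    using step_shape[OF assms] .
  have xv: "x \<in> vertices n" using assms by (simp add: step_def)
  note ar = arrow_of_shape[OF sh(1,2) xv step_replace[OF assms] sh(3)]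
  have e: "entry (replace q p x) (length a + 1) = p" "entry x (length a + 1 + length c) = q"
    by (simp add: entry_def sh(2) nth_append, subst sh(1), simp add: entry_def nth_append)
  show ?thesis using that[OF ar _ e] arr_eqI[OF ar] by (simp only: e)
qed

lemma arrow_interior:
  assumes "is_arrow n x i s v y"
  shows "bij_betw (\<lambda>j. entry x (i + j)) {..<s} ({entry y i<..<entry x (i + s)} \<inter> set x)"
    "\<And>j. j < s \<Longrightarrow> entry y (i + j + 1) = entry x (i + j)"
    "sum_list v = card ({entry y i<..<entry x (i + s)} - set x)"
proof -
  have xv: "x \<in> vertices n" and yv: "y \<in> vertices n" using assms by (auto simp: is_arrow_def)
  obtain a c b p q where sh: "x = a @ c @ q # b" "y = a @ p # c @ b" "i = length a + 1" "s = length c"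
    "v = map2 (\<lambda>a b. a - b - 1) (c @ [q]) (p # c)" "sorted_wrt (<) (p # c @ [q])"
    "entry y i = p" "entry x (i + s) = q"
    using arrow_shape[OF assms] by metis
  have sx: "sorted_wrt (<) x" and sy: "sorted_wrt (<) y" using xv yv by (auto simp: vertices_iff)
  have int: "{p<..<q} \<inter> set x = set c"
    using sx sy sh(6) unfolding sh(1,2) by (auto simp: sorted_wrt_append)
  have dc: "distinct c" using vertices_distinct[OF xv] by (simp add: sh)
  have ent: "entry x (i + j) = c ! j" if "j < s" for j
    using that by (simp add: entry_def sh nth_append)
  have "bij_betw ((!) c) {..<s} (set c)"
    using dc sh(4) by (intro bij_betw_nth) auto
  then show "bij_betw (\<lambda>j. entry x (i + j)) {..<s} ({entry y i<..<entry x (i + s)} \<inter> set x)"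
    unfolding sh(7,8) int using ent by (subst bij_betw_cong[of _ _ "(!) c"]) auto
  show "entry y (i + j + 1) = entry x (i + j)" if "j < s" for j
    using that by (simp add: entry_def sh nth_append)
  have "sum_list v + s + 1 + p = q"
    using sum_gaps[OF sh(6)] by (simp add: sh)
  moreover have "card ({p<..<q} - set x) + card ({p<..<q} \<inter> set x) = card {p<..<q}"
    using card_Int_Diff[of "{p<..<q}" "set x"] by simp
  moreover have "card ({p<..<q} \<inter> set x) = s" using dc by (simp only: int sh(4) distinct_card)
  ultimately have "sum_list v = card ({p<..<q} - set x)" using sh(6) by simp
  then show "sum_list v = card ({entry y i<..<entry x (i + s)} - set x)" by (simp only: sh(7,8))
qed

lemma r_to_arrow:
  assumes "is_arrow n x i s v y"
  shows "r_to n x y = r_gen x i s v y"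
  unfolding r_to_def using assms arrow_unique by (intro the_equality) blast+

lemma r_to_arr:
  assumes "step n x p q" "y \<in> vertices n" "set y = insert p (set x - {q})"
  shows "r_to n x y = mono_word [arr n x p q]" "y = replace q p x"
proof -
  show y: "y = replace q p x"
    by (rule vertices_eqI[OF assms(2) step_replace[OF assms(1)]]) (simp add: assms set_replace)
  obtain i s v where a: "is_arrow n x i s v (replace q p x)" "arr n x p q = Arrow x i s v (replace q p x)"
    using step_arrow[OF assms(1)] by metis
  then show "r_to n x y = mono_word [arr n x p q]"
    unfolding y using r_to_arrow[OF a(1)] by (simp add: r_gen_def)
qed

lemma loop_entry: "is_loop n x i \<Longrightarrow> x \<in> vertices n \<and> entry x i \<in> set x"
  by (auto simp: is_loop_def entry_def)

lemma loop_exists: "x \<in> vertices n \<Longrightarrow> m \<in> set x \<Longrightarrow> \<exists>i. is_loop n x i \<and> entry x i = m"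
proof -
  assume "x \<in> vertices n" "m \<in> set x"
  then obtain k where "k < length x" "x ! k = m" by (auto simp: in_set_conv_nth)
  then have "is_loop n x (Suc k) \<and> entry x (Suc k) = m"
    using \<open>x \<in> vertices n\<close> by (simp add: is_loop_def entry_def)
  then show ?thesis by blast
qed

lemma loop_unique: "is_loop n x i \<Longrightarrow> is_loop n x i' \<Longrightarrow> entry x i = entry x i' \<Longrightarrow> i = i'"
  using nth_distinct_eq[of x "i - 1" "i' - 1"] vertices_distinct[of x n]
  unfolding is_loop_def entry_def by linarith

lemma arrow_index_outside:
  assumes "is_arrow n x i s v y" "is_loop n x i'" "i' \<notin> {i..i + s}"
  shows "is_loop n y i'" "entry y i' = entry x i'" "entry x i' \<noteq> entry x (i + s)"
    "entry x i' \<noteq> entry y i"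
proof -
  show l: "is_loop n y i'" using assms by (auto simp: is_loop_def is_arrow_def)
  show e: "entry y i' = entry x i'" using assms by (auto simp: is_loop_def is_arrow_def)
  have "is_loop n x (i + s)" using assms(1) by (auto simp: is_loop_def is_arrow_def)
  then show "entry x i' \<noteq> entry x (i + s)" using loop_unique[OF assms(2)] assms(3) by fastforce
  have "entry y i \<notin> set x" using arrow_sets(1)[OF assms(1)] by (simp add: step_def)
  then show "entry x i' \<noteq> entry y i" using loop_entry[OF assms(2)] by metis
qed

lemma arrow_index_crossing:
  assumes "is_arrow n x i s v y" "i \<le> i'" "i' < i + s"
  shows "is_loop n x i'" "is_loop n y (i' + 1)" "entry y (i' + 1) = entry x i'"
    "entry y i < entry x i'" "entry x i' < entry x (i + s)"
proof -
  show "is_loop n x i'" "is_loop n y (i' + 1)" "entry y (i' + 1) = entry x i'"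
    using assms by (auto simp: is_loop_def is_arrow_def)
  have "entry x (i + (i' - i)) \<in> {entry y i<..<entry x (i + s)} \<inter> set x"
    using bij_betwE[OF arrow_interior(1)[OF assms(1)], rule_format, of "i' - i"] assms by simp
  then show "entry y i < entry x i'" "entry x i' < entry x (i + s)" using assms by auto
qed

text \<open>The loop at \<open>x\<close> on the entry \<open>m\<close>. Naming loops by entries instead of indices absorbs the index
  shifts of the relations.\<close>

definition lp :: "nat \<Rightarrow> nat list \<Rightarrow> nat \<Rightarrow> gen" where
  "lp n x m = Loop x (THE i. is_loop n x i \<and> entry x i = m)"

lemma lp_eqI: "is_loop n x i \<Longrightarrow> lp n x (entry x i) = Loop x i"
  unfolding lp_def using loop_unique by (auto intro!: the_equality)

lemma lp_loop:
  assumes "x \<in> vertices n" "m \<in> set x"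
  obtains i where "is_loop n x i" "entry x i = m" "lp n x m = Loop x i"
  using loop_exists[OF assms] lp_eqI by blast

lemma gens_cases:
  assumes "g \<in> gens n"
  obtains (Vertex) x where "x \<in> vertices n" "g = Vertex x"
    | (Loop) x m where "x \<in> vertices n" "m \<in> set x" "g = lp n x m"
    | (Arrow) x p q where "step n x p q" "g = arr n x p q"
proof -
  consider x where "x \<in> vertices n" "g = Vertex x" | x i where "is_loop n x i" "g = Loop x i"
    | x i s v y where "is_arrow n x i s v y" "g = Arrow x i s v y"
    using assms by (auto simp: gens_def)
  then show ?thesis
  proof cases
    case (2 x i)
    then show ?thesis using that(2)[of x "entry x i"] loop_entry[of n x i] lp_eqI[of n x i] by simp
  next
    case (3 x i s v y)
    then show ?thesis
      using that(3)[of x "entry y i" "entry x (i + s)"] arrow_sets(1) arr_eqI by simp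
  qed (use that(1) in blast)
qed

lemma gens_intros:
  "x \<in> vertices n \<Longrightarrow> Vertex x \<in> gens n"
  "x \<in> vertices n \<Longrightarrow> m \<in> set x \<Longrightarrow> lp n x m \<in> gens n"
  "step n x p q \<Longrightarrow> arr n x p q \<in> gens n"
proof -
  show "x \<in> vertices n \<Longrightarrow> Vertex x \<in> gens n" by (simp add: gens_def)
  show "x \<in> vertices n \<Longrightarrow> m \<in> set x \<Longrightarrow> lp n x m \<in> gens n"
    by (elim lp_loop) (auto simp: gens_def)
  show "step n x p q \<Longrightarrow> arr n x p q \<in> gens n"
    by (elim step_arrow) (auto simp: gens_def)
qed

lemma deg_lp [simp]: "deg_h (lp n x m) = -1" "deg_t (lp n x m) = -1"
  by (simp_all add: lp_def)

lemma deg_arr: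
  assumes "step n x p q"
  shows "deg_h (arr n x p q) = 1 - int (card ({p<..<q} \<inter> set x))"
    "deg_t (arr n x p q) = 1 + int (card ({p<..<q} - set x))"
proof -
  obtain i s v where a: "is_arrow n x i s v (replace q p x)" "arr n x p q = Arrow x i s v (replace q p x)"
    "entry (replace q p x) i = p" "entry x (i + s) = q"
    using step_arrow[OF assms] .
  have "card ({p<..<q} \<inter> set x) = s"
    using bij_betw_same_card[OF arrow_interior(1)[OF a(1)]] a(3,4) by simp
  then show "deg_h (arr n x p q) = 1 - int (card ({p<..<q} \<inter> set x))" by (simp add: a(2))
  show "deg_t (arr n x p q) = 1 + int (card ({p<..<q} - set x))"
    using arrow_interior(3)[OF a(1)] a(3,4) by (simp add: a(2))
qed

lemma step_mark:
  assumes "step n x p q" "m \<in> {p<..<q} - set x"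
  shows "step n x m q" "step n (replace q m x) p m" "replace m p (replace q m x) = replace q p x"
proof -
  have x: "x \<in> vertices n" "q \<in> set x" "p \<notin> set x" "1 \<le> p" "p < q" "q \<le> n"
    using assms by (auto simp: step_def vertices_iff)
  show 1: "step n x m q" using assms x by (auto simp: step_def)
  show 2: "step n (replace q m x) p m"
    using assms x step_replace[OF 1] by (auto simp: step_def set_replace)
  show "replace m p (replace q m x) = replace q p x"
    using assms(2) by (intro vertices_eqI[OF step_replace[OF 2] step_replace[OF assms(1)]])
      (auto simp: set_replace)
qed

lemma step_cross:
  assumes "step n x p q" "m \<in> {p<..<q} \<inter> set x"
  shows "step n x p m" "step n (replace m p x) m q" "replace q m (replace m p x) = replace q p x"
proof -
  have x: "x \<in> vertices n" "q \<in> set x" "p \<notin> set x" "1 \<le> p" "p < q" "q \<le> n"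
    using assms by (auto simp: step_def vertices_iff)
  show 1: "step n x p m" using assms x by (auto simp: step_def)
  show 2: "step n (replace m p x) m q"
    using assms x step_replace[OF 1] by (auto simp: step_def set_replace)
  show "replace q m (replace m p x) = replace q p x"
    using assms x by (intro vertices_eqI[OF step_replace[OF 2] step_replace[OF assms(1)]])
      (auto simp: set_replace)
qed

lemma r_to_arr': "step n x p q \<Longrightarrow> y = replace q p x \<Longrightarrow> r_to n x y = mono_word [arr n x p q]"
  using r_to_arr(1)[of n x p q y] step_replace by (simp add: set_replace)

lemma diff_gen_lp [simp]: "diff_gen n (lp n x m) = 0"
  by (simp add: lp_def)

text \<open>The differential of an arrow, with crossings indexed by the entries crossed.\<close>

lemma diff_gen_arr:
  assumes "step n x p q"
  shows "diff_gen n (arr n x p q) =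
    (\<Sum>m\<in>{p<..<q} - set x. mono_word [arr n x m q] * mono_word [arr n (replace q m x) p m]) +
    (\<Sum>m\<in>{p<..<q} \<inter> set x.
       mono_word [lp n x m] * mono_word [arr n x p m] * mono_word [arr n (replace m p x) m q] +
       mono_word [arr n x p m] * mono_word [arr n (replace m p x) m q] * mono_word [lp n (replace q p x) m])"
proof -
  let ?y = "replace q p x"
  let ?f = "\<lambda>m. mono_word [lp n x m] * mono_word [arr n x p m] * mono_word [arr n (replace m p x) m q] +
       mono_word [arr n x p m] * mono_word [arr n (replace m p x) m q] * mono_word [lp n ?y m]"
  obtain i s v where a: "is_arrow n x i s v ?y" "arr n x p q = Arrow x i s v ?y"
    "entry ?y i = p" "entry x (i + s) = q"
    using step_arrow[OF assms] .
  have m1: "r_to n x (replace q m x) * r_to n (replace q m x) ?y =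
      mono_word [arr n x m q] * mono_word [arr n (replace q m x) p m]"
    if "m \<in> {p<..<q} - set x" for m
    using step_mark[OF assms that] by (simp add: r_to_arr')
  have m2: "rho x (i + j) * r_to n x (replace (entry x (i + j)) p x) * r_to n (replace (entry x (i + j)) p x) ?y +
         r_to n x (replace (entry x (i + j)) p x) * r_to n (replace (entry x (i + j)) p x) ?y * rho ?y (i + j + 1)
      = ?f (entry x (i + j))" if "j < s" for j
  proof -
    have mem: "entry x (i + j) \<in> {p<..<q} \<inter> set x"
      using bij_betwE[OF arrow_interior(1)[OF a(1)]] that a(3,4) by auto
    have "lp n x (entry x (i + j)) = Loop x (i + j)"
      using arrow_index_crossing(1)[OF a(1), of "i + j"] that by (simp add: lp_eqI)
    moreover have "lp n ?y (entry x (i + j)) = Loop ?y (i + j + 1)"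
      using arrow_index_crossing(2,3)[OF a(1), of "i + j"] lp_eqI[of n ?y "i + j + 1"] that by simp
    ultimately show ?thesis
      using step_cross[OF assms mem] by (simp add: r_to_arr' rho_def)
  qed
  have "(\<Sum>j<s. ?f (entry x (i + j))) = (\<Sum>m\<in>{p<..<q} \<inter> set x. ?f m)"
    using arrow_interior(1)[OF a(1)] unfolding a(3,4) by (rule sum.reindex_bij_betw)
  moreover have "diff_gen n (arr n x p q) =
     (\<Sum>m\<in>{p<..<q} - set x. r_to n x (replace q m x) * r_to n (replace q m x) ?y) +
     (\<Sum>j<s. rho x (i + j) * r_to n x (replace (entry x (i + j)) p x) * r_to n (replace (entry x (i + j)) p x) ?y +
         r_to n x (replace (entry x (i + j)) p x) * r_to n (replace (entry x (i + j)) p x) ?y * rho ?y (i + j + 1))"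
    unfolding a(2) by (simp add: a(3,4) Let_def)
  ultimately show ?thesis using m1 m2 by simp
qed

section \<open>The action of the free algebra on configurations\<close>

text \<open>The letters that an arrow from \<open>x\<close> replacing \<open>q\<close> by \<open>p\<close> prepends at each site, first at a single site
  \<open>m\<close>, then for a configuration that starts at the end of the arrow.\<close>

definition cell :: "nat list \<Rightarrow> nat \<Rightarrow> nat \<Rightarrow> nat \<Rightarrow> letter list \<Rightarrow> letter list" where
  "cell x p q m w =
     (if m = q then Leave # w else if m = p then Arrive # w
      else if p < m \<and> m < q then (if m \<in> set x then cross w else Mark # w) else w)"

definition cells :: "nat list \<Rightarrow> nat \<Rightarrow> nat \<Rightarrow> cfg \<Rightarrow> cfg" where
  "cells x p q b = (x, \<lambda>m. cell x p q m (snd b m))"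

text \<open>Left multiplication by a generator: a configuration is extended by a letter in front, and the
  result is zero unless the letter ends where the configuration starts.\<close>

fun act :: "gen \<Rightarrow> cfg \<Rightarrow> cfg \<Rightarrow>\<^sub>0 bit" where
  "act (Vertex x) b = (if fst b = x then bas b else 0)"
| "act (Loop x i) b = (if fst b = x then site (entry x i) dot b else 0)"
| "act (Arrow x i s v y) b = (if fst b = y then bas (cells x (entry y i) (entry x (i + s)) b) else 0)"

definition opw :: "gen list \<Rightarrow> (cfg \<Rightarrow>\<^sub>0 bit) \<Rightarrow> cfg \<Rightarrow>\<^sub>0 bit" where
  "opw gs z = foldr (\<lambda>g. lin (act g)) gs z"

definition op :: "free \<Rightarrow> (cfg \<Rightarrow>\<^sub>0 bit) \<Rightarrow> cfg \<Rightarrow>\<^sub>0 bit" where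
  "op f z = lin (\<lambda>w. opw (letters w) z) f"

lemma act_lp:
  assumes "x \<in> vertices n" "m \<in> set x"
  shows "act (lp n x m) b = (if fst b = x then site m dot b else 0)"
  using lp_loop[OF assms] by (metis act.simps(2))

lemma act_arr:
  assumes "step n x p q"
  shows "act (arr n x p q) b = (if fst b = replace q p x then bas (cells x p q b) else 0)"
  using step_arrow[OF assms] by (metis act.simps(3))

lemma opw_simps [simp]: "opw [] z = z" "opw (g # gs) z = lin (act g) (opw gs z)"
  by (simp_all add: opw_def)

lemma opw_append: "opw (gs @ hs) z = opw gs (opw hs z)"
  by (simp add: opw_def)

lemma opw_add [simp]: "opw gs (y + z) = opw gs y + opw gs z"
  by (induction gs) simp_all

lemma opw_zero [simp]: "opw gs 0 = 0"
  by (induction gs) simp_all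

lemma op_add_left [simp]: "op (f + g) z = op f z + op g z"
  by (simp add: op_def)

lemma op_zero_left [simp]: "op 0 z = 0"
  by (simp add: op_def)

lemma op_sum_left: "op (sum f S) z = (\<Sum>s\<in>S. op (f s) z)"
  by (simp add: op_def)

lemma op_add_right [simp]: "op f (y + z) = op f y + op f z"
  by (simp add: op_def lin_add_fun)

lemma op_zero_right [simp]: "op f 0 = 0"
  by (simp add: op_def)

lemma op_lin_right: "op f z = lin (\<lambda>b. op f (bas b)) z"
  by (rule additive_eq_lin) simp

lemma op_mono_word [simp]: "op (mono_word gs) z = opw gs z"
  by (simp add: op_def mono_word_def)

lemma mono_word_mult: "mono_word gs * mono_word hs = mono_word (gs @ hs)"
  by (simp add: mono_word_def mult_single plus_word_def)

lemma mono_word_Nil: "mono_word [] = 1"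
  by (simp add: mono_word_def single_one flip: zero_word_def)

lemma op_one [simp]: "op 1 z = z"
  using op_mono_word[of "[]"] by (simp add: mono_word_Nil)

lemma bas_mono_word: "bas w = mono_word (letters w)"
  by (simp add: mono_word_def)

lemma op_mult [simp]: "op (f * g) z = op f (op g z)"
proof (induction f rule: bas_induct)
  case (add k f)
  have "op (bas k * g) z = op (bas k) (op g z)"
    by (induction g rule: bas_induct)
      (simp_all add: distrib_left bas_mono_word mono_word_mult opw_append)
  then show ?case using add by (simp add: distrib_right)
qed simp

lemma keys_act:
  assumes "g \<in> gens n" "b' \<in> Poly_Mapping.keys (act g b)"
  shows "fst b' \<in> vertices n"
  using assms
  by (cases g) (auto simp: gens_def is_loop_def is_arrow_def cells_def dest!: keys_site split: if_splits)

lemma keys_opw: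
  assumes "set gs \<subseteq> gens n" "\<And>b. b \<in> Poly_Mapping.keys z \<Longrightarrow> fst b \<in> vertices n"
    "b' \<in> Poly_Mapping.keys (opw gs z)"
  shows "fst b' \<in> vertices n"
proof (cases gs)
  case Nil
  then show ?thesis using assms by simp
next
  case (Cons g hs)
  then obtain k where "b' \<in> Poly_Mapping.keys (act g k)" using assms(3) by (auto dest!: keys_lin)
  then show ?thesis using assms(1) Cons keys_act[of g n b' k] by simp
qed

lemma keys_op:
  assumes "f \<in> carrier (free_alg n)" "\<And>b. b \<in> Poly_Mapping.keys z \<Longrightarrow> fst b \<in> vertices n"
    "b' \<in> Poly_Mapping.keys (op f z)"
  shows "fst b' \<in> vertices n"
proof -
  obtain w where "w \<in> Poly_Mapping.keys f" "b' \<in> Poly_Mapping.keys (opw (letters w) z)"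
    using assms(3) unfolding op_def by (auto dest!: keys_lin)
  then show ?thesis
    using assms(1,2) keys_opw[of "letters w" n z b'] by (auto simp: free_alg_def)
qed

subsection \<open>The relations hold\<close>

lemma lin_cells_site:
  "lin (\<lambda>b. bas (cells x p q b)) (site m F b) =
     lin (\<lambda>u. bas (x, (snd (cells x p q b))(m := u))) (lin (\<lambda>u. bas (cell x p q m u)) (F (snd b m)))"
  by (simp add: site_def lin_lin cells_def fun_upd_def if_distrib cong: if_cong)

lemma lin_act_site:
  "lin (act (Loop x i)) (site m F b) = (if fst b = x then lin (site (entry x i) dot) (site m F b) else 0)"
  "lin (act (Vertex x)) (site m F b) = (if fst b = x then site m F b else 0)"
  "lin (act (Arrow x i s v y)) (site m F b) =
     (if fst b = y then lin (\<lambda>b. bas (cells x (entry y i) (entry x (i + s)) b)) (site m F b) else 0)"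
  by (simp_all add: site_def lin_lin)

lemma dot_cell:
  assumes "m \<in> set x" "m \<noteq> p" "m \<noteq> q"
  shows "dot (cell x p q m w) = lin (\<lambda>u. bas (cell x p q m u)) (dot w)"
proof (cases "p < m \<and> m < q")
  case True
  then show ?thesis using assms by (simp add: cell_def dot_cross)
next
  case False
  then have "cell x p q m = (\<lambda>u. u)" using assms by (auto simp: cell_def)
  then show ?thesis by simp
qed

lemma site_dot_cells:
  assumes "m \<in> set x" "m \<noteq> p" "m \<noteq> q"
  shows "site m dot (cells x p q b) = lin (\<lambda>b. bas (cells x p q b)) (site m dot b)"
  unfolding lin_cells_site dot_cell[OF assms, symmetric] by (simp add: site_def cells_def)

lemma cells_cells_commute:
  assumes "q < p'" "p < q" "p' < q'" "set y = insert p (set x - {q})" "set w = insert p' (set x - {q'})"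
  shows "cells x p q (cells y p' q' b) = cells x p' q' (cells w p q b)"
  using assms by (auto simp: cells_def cell_def fun_eq_iff)

text \<open>The only delicate relation is the commutation of two distant arrows, where the entries moved by the
  arrows have to be recognised from indices alone. Since \<open>x\<^bsub>i+s\<^esub> < z\<^bsub>i'\<^esub>\<close> forces \<open>i + s < i'\<close>, the two
  index ranges do not interact.\<close>

lemma relators_act_zero:
  assumes "f \<in> relators n" and b: "fst b \<in> vertices n"
  shows "op f (bas b) = 0"
  using assms(1)
proof cases
  case (unit)
  have "(\<Sum>x\<in>vertices n. op (e_gen x) (bas b)) = bas b"
    using b finite_vertices by (simp add: e_gen_def if_distrib sum.delta' cong: if_cong)
  then show ?thesis by (simp add: unit op_sum_left)
next
  case (loop_ends x i)
  then show ?thesis by (simp add: e_gen_def rho_def lin_act_site)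
next
  case (arrow_ends x i s v y)
  then show ?thesis by (simp add: e_gen_def r_gen_def cells_def)
next
  case (loop_square x i)
  then show ?thesis by (simp add: rho_def lin_act_site site_comp site_zero)
next
  case (loop_loop x i i')
  then have "entry x i \<noteq> entry x i'" using loop_unique by blast
  then show ?thesis
    using loop_loop by (simp add: rho_def lin_act_site site_commute[of "entry x i"])
next
  case (loop_arrow x i s v y i')
  have "site (entry x i') dot (cells x (entry y i) (entry x (i + s)) b) =
      lin (\<lambda>b. bas (cells x (entry y i) (entry x (i + s)) b)) (site (entry x i') dot b)"
    using arrow_index_outside[OF loop_arrow(2-4)] loop_entry[OF loop_arrow(3)]
    by (intro site_dot_cells) auto
  then show ?thesis
    using arrow_index_outside(2)[OF loop_arrow(2-4)]
    by (simp add: loop_arrow(1) rho_def r_gen_def lin_act_site)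
      (simp add: cells_def)
next
  case (loop_crossing x i s v y i')
  have "site (entry x i') dot (cells x (entry y i) (entry x (i + s)) b) =
      lin (\<lambda>b. bas (cells x (entry y i) (entry x (i + s)) b)) (site (entry x i') dot b)"
    using arrow_index_crossing[OF loop_crossing(2,4,5)] loop_entry[of n x i']
    by (intro site_dot_cells) auto
  then show ?thesis
    using arrow_index_crossing(3)[OF loop_crossing(2,4,5)]
    by (simp add: loop_crossing(1) rho_def r_gen_def lin_act_site)
      (simp add: cells_def)
next
  case (arrow_arrow x i s v y i' s' v' z w)
  let ?p = "entry y i" and ?q = "entry x (i + s)" and ?p' = "entry z i'" and ?q' = "entry y (i' + s')"
  note xy = arrow_arrow(2) and yz = arrow_arrow(3) and xw = arrow_arrow(4) and wz = arrow_arrow(5)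
  have idx: "i + s < i'"
  proof (rule ccontr)
    assume "\<not> i + s < i'"
    moreover have "sorted_wrt (<) x" "1 \<le> i" "i + s \<le> length x" "1 \<le> i'" "i' + s' \<le> length x"
      "length x = length y"
      using xy yz by (auto simp: is_arrow_def vertices_iff)
    ultimately have "entry x i' \<le> ?q"
      by (cases "i' = i + s") (auto simp: entry_def intro!: less_imp_le sorted_wrt_nth_less[of "(<)"])
    moreover have "entry y i' \<le> entry x i'"
    proof -
      consider "i' \<notin> {i..i + s}" | "i' = i" | j where "i' = j + 1" "i \<le> j" "j < i + s"
        by (cases i') (auto simp: not_less_eq_eq, linarith)
      then show ?thesis
      proof cases
        case 1
        then show ?thesis using xy yz by (auto simp: is_arrow_def)
      next
        case 2
        then show ?thesis using xy by (auto simp: is_arrow_def)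
      next
        case (3 j)
        then have "entry y i' = entry x j" using xy by (auto simp: is_arrow_def)
        moreover have "entry x j \<le> entry x i'"
          using 3 xy by (auto simp: is_arrow_def vertices_iff entry_def
              intro!: less_imp_le sorted_wrt_nth_less[of "(<)"])
        ultimately show ?thesis by simp
      qed
    qed
    moreover have "?p' < entry y i'" using yz by (simp add: is_arrow_def)
    ultimately show False using arrow_arrow(6) by simp
  qed
  have bounds: "1 \<le> i" "i' + s' \<le> length x" "length x = length y" "length y = length z"
    "length x = length w"
    using xy yz xw by (auto simp: is_arrow_def)
  have e1: "entry x (i' + s') = ?q'" using xy idx bounds by (auto simp: is_arrow_def)
  have e2: "entry w i' = ?p'" using wz idx bounds by (auto simp: is_arrow_def)
  have e3: "entry z i = ?p" using yz idx bounds by (auto simp: is_arrow_def)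
  have e4: "entry w (i + s) = ?q" using xw idx bounds by (auto simp: is_arrow_def)
  have "cells x ?p ?q (cells y ?p' ?q' b) = cells x ?p' ?q' (cells w ?p ?q b)"
    using arrow_arrow(6) arrow_sets(1,3)[OF xy] arrow_sets(1)[OF yz] arrow_sets(3)[OF xw]
    by (intro cells_cells_commute) (auto simp: step_def e1 e2)
  then show ?thesis
    by (simp add: arrow_arrow(1) r_gen_def e1 e2 e3 e4) (simp add: cells_def)
qed (auto simp: e_gen_def)

subsection \<open>Validity and degrees\<close>

lemma cell_counts:
  assumes "p < q"
  shows "right_count (cell x p q m w) = right_count w + (if p \<le> m \<and> m < q then 1 else 0)"
    "left_count (cell x p q m w) = left_count w + (if p < m \<and> m \<le> q then 1 else 0)"
    "word_h (cell x p q m w) = word_h w + (if m = q then 1 else 0) - (if m \<in> {p<..<q} \<inter> set x then 1 else 0)"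
    "word_t (cell x p q m w) = word_t w + (if m = q then 1 else 0) + (if m \<in> {p<..<q} - set x then 1 else 0)"
  using assms by (auto simp: cell_def)

lemma lvalid_cell:
  assumes "step n x p q"
  shows "lvalid (m \<in> set x) (cell x p q m w) = lvalid (m \<in> set (replace q p x)) w"
  using assms by (auto simp: cell_def step_def set_replace)

lemma valid_cells:
  assumes st: "step n x p q" and y: "fst b = replace q p x"
  shows "valid n (cells x p q b) = valid n b"
proof -
  have pq: "p < q" "1 \<le> p" "q \<le> n" "x \<in> vertices n"
    using st by (auto simp: step_def vertices_iff)
  have "cell x p q m w = w" if "m \<notin> {1..n}" for m w
    using that pq by (auto simp: cell_def)
  moreover have "right_count (cell x p q m v) = left_count (cell x p q (Suc m) w)
      \<longleftrightarrow> right_count v = left_count w" for m v w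
    using pq by (auto simp: cell_counts)
  ultimately show ?thesis
    using pq step_replace[OF st] y lvalid_cell[OF st]
    by (simp add: valid_def cells_def)
qed

lemma degree_cells:
  assumes st: "step n x p q"
  shows "cfg_h n (cells x p q b) = cfg_h n b + deg_h (arr n x p q)"
    "cfg_t n (cells x p q b) = cfg_t n b + deg_t (arr n x p q)"
proof -
  have pq: "p < q" "1 \<le> p" "q \<le> n" "x \<in> vertices n"
    using st by (auto simp: step_def vertices_iff)
  have ind: "(\<Sum>m\<in>{1..n}. if m \<in> S then 1 else 0 :: int) = int (card S)" if "S \<subseteq> {p<..<q}" for S
  proof -
    have "S \<subseteq> {1..n}" using that pq by auto
    then have "{1..n} \<inter> S = S" by blast
    then show ?thesis by (simp flip: sum.inter_restrict)
  qed
  have one: "(\<Sum>m\<in>{1..n}. if m = q then 1 else 0 :: int) = 1" using pq by simp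
  show "cfg_h n (cells x p q b) = cfg_h n b + deg_h (arr n x p q)"
    using ind[of "{p<..<q} \<inter> set x"] one
    by (simp add: cfg_h_def cells_def cell_counts[OF pq(1)] deg_arr[OF st] sum.distrib sum_subtractf
        del: sum.delta sum.delta')
  show "cfg_t n (cells x p q b) = cfg_t n b + deg_t (arr n x p q)"
    using ind[of "{p<..<q} - set x"] one
    by (simp add: cfg_t_def cells_def cell_counts[OF pq(1)] deg_arr[OF st] sum.distrib
        del: sum.delta sum.delta')
qed

lemma valid_upd_dot:
  assumes "m \<in> set x"
  shows "valid n (x, \<tau>(m := Dot # w)) \<longleftrightarrow> valid n (x, \<tau>(m := w)) \<and> \<not> starts_dot w"
proof (cases "x \<in> vertices n")
  case True
  then have "m \<in> {1..n}" using assms by (auto simp: vertices_iff)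
  then show ?thesis using assms by (auto simp: valid_def)
qed (simp add: valid_def)

lemma degree_upd_dot:
  assumes "m \<in> {1..n}"
  shows "cfg_h n (x, \<tau>(m := Dot # w)) = cfg_h n (x, \<tau>(m := w)) - 1"
    "cfg_t n (x, \<tau>(m := Dot # w)) = cfg_t n (x, \<tau>(m := w)) - 1"
  using assms by (simp_all add: cfg_h_def cfg_t_def sum.remove[of _ m])

lemma act_valid:
  assumes g: "g \<in> gens n" and b: "valid n b" and b': "b' \<in> Poly_Mapping.keys (act g b)"
  shows "valid n b' \<and> cfg_h n b' = cfg_h n b + deg_h g \<and> cfg_t n b' = cfg_t n b + deg_t g"
  using g
proof (cases rule: gens_cases)
  case (Vertex x)
  then show ?thesis using b b' by (auto split: if_splits)
next
  case (Loop x m)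
  then have x: "fst b = x" and "b' \<in> Poly_Mapping.keys (site m dot b)"
    using b' by (auto simp: act_lp split: if_splits)
  then have e: "b' = (x, (snd b)(m := Dot # snd b m))" "\<not> starts_dot (snd b m)"
    by (auto dest!: keys_site keys_dot)
  have m: "m \<in> {1..n}" using Loop by (auto simp: vertices_iff)
  have "b = (x, (snd b)(m := snd b m))" using x by (cases b) simp
  then show ?thesis
    using e valid_upd_dot[OF Loop(2), of n "snd b" "snd b m"] degree_upd_dot[OF m, of x "snd b" "snd b m"] b
    by (simp add: Loop)
next
  case (Arrow x p q)
  then have "fst b = replace q p x" "b' = cells x p q b"
    using b' by (auto simp: act_arr split: if_splits)
  then show ?thesis
    using valid_cells[OF Arrow(1)] degree_cells[OF Arrow(1)] b Arrow by simp
qed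

lemma opw_valid:
  assumes "set gs \<subseteq> gens n" "valid n b" "b' \<in> Poly_Mapping.keys (opw gs (bas b))"
  shows "valid n b' \<and> cfg_h n b' = cfg_h n b + sum_list (map deg_h gs) \<and>
    cfg_t n b' = cfg_t n b + sum_list (map deg_t gs)"
  using assms(1,3)
proof (induction gs arbitrary: b')
  case Nil
  then show ?case using assms(2) by simp
next
  case (Cons g gs)
  then obtain k where k: "k \<in> Poly_Mapping.keys (opw gs (bas b))" "b' \<in> Poly_Mapping.keys (act g k)"
    by (auto dest!: keys_lin)
  have "valid n k \<and> cfg_h n k = cfg_h n b + sum_list (map deg_h gs) \<and>
      cfg_t n k = cfg_t n b + sum_list (map deg_t gs)"
    using Cons k by simp
  with act_valid[of g n k b'] Cons.prems k(2) show ?case by simp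
qed

subsection \<open>Compatibility with the differentials\<close>

text \<open>The part of the differential of a configuration \<open>cells x p q b\<close> that comes from resolving the marking
  or crossing added at \<open>m\<close>.\<close>

definition extra :: "nat list \<Rightarrow> nat \<Rightarrow> nat \<Rightarrow> nat \<Rightarrow> letter list \<Rightarrow> letter list \<Rightarrow>\<^sub>0 bit" where
  "extra x p q m w =
     (if m \<in> {p<..<q} then
        if m \<in> set x then bas (Dot # Leave # Arrive # w) + lin (pre [Leave, Arrive]) (dot w)
        else bas (Arrive # Leave # w)
      else 0)"

lemma dloc_cell:
  assumes "lvalid s w" "p < q"
  shows "dloc (cell x p q m w) = lin (\<lambda>u. bas (cell x p q m u)) (dloc w) + extra x p q m w"
proof -
  consider "m = q" | "m = p" | "m \<in> {p<..<q}" "m \<in> set x" | "m \<in> {p<..<q}" "m \<notin> set x"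
    | "m \<noteq> p" "m \<noteq> q" "m \<notin> {p<..<q}" by blast
  then show ?thesis
  proof cases
    case 3
    then show ?thesis
      using dloc_cross[OF assms(1)] by (simp add: cell_def extra_def add.commute)
  next
    case 4
    then show ?thesis by (simp add: cell_def extra_def add.commute)
  next
    case 5
    then have "cell x p q m = (\<lambda>u. u)" by (auto simp: cell_def)
    moreover have "extra x p q m w = 0" using 5(3) by (simp only: extra_def if_False)
    ultimately show ?thesis by simp
  qed (use assms(2) in \<open>simp_all add: cell_def extra_def\<close>)
qed

lemma cfg_diff_cells:
  assumes st: "step n x p q" and b: "valid n b" "fst b = replace q p x"
  shows "cfg_diff n (cells x p q b) = lin (\<lambda>b. bas (cells x p q b)) (cfg_diff n b) +
    (\<Sum>m\<in>{p<..<q}. lin (\<lambda>u. bas (x, (snd (cells x p q b))(m := u))) (extra x p q m (snd b m)))"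
proof -
  have pq: "p < q" "1 \<le> p" "q \<le> n" using st by (auto simp: step_def vertices_iff)
  let ?E = "\<lambda>m. lin (\<lambda>u. bas (x, (snd (cells x p q b))(m := u))) (extra x p q m (snd b m))"
  have lv: "lvalid (m \<in> set (fst b)) (snd b m)" for m using b(1) by (simp add: valid_def)
  have "site m dloc (cells x p q b) = lin (\<lambda>b. bas (cells x p q b)) (site m dloc b) + ?E m" for m
    using dloc_cell[OF lv pq(1), of x m m]
    by (simp add: site_def[of m dloc "cells x p q b"] lin_cells_site) (simp add: cells_def)
  then have "cfg_diff n (cells x p q b) = lin (\<lambda>b. bas (cells x p q b)) (cfg_diff n b) + (\<Sum>m\<in>{1..n}. ?E m)"
    by (simp add: cfg_diff_def sum.distrib)
  also have "(\<Sum>m\<in>{1..n}. ?E m) = (\<Sum>m\<in>{p<..<q}. ?E m)"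
    using pq by (intro sum.mono_neutral_right) (auto simp: extra_def)
  finally show ?thesis .
qed

lemma lin_act_arr_site:
  assumes "step n x p q"
  shows "lin (act (arr n x p q)) (site m F b) =
    (if fst b = replace q p x then lin (\<lambda>b. bas (cells x p q b)) (site m F b) else 0)"
  by (simp add: site_def lin_lin act_arr[OF assms])

lemma cells_mark:
  assumes "step n x p q" "m \<in> {p<..<q} - set x"
  shows "cells x m q (cells (replace q m x) p m b) =
    (x, (snd (cells x p q b))(m := Arrive # Leave # snd b m))"
  using assms by (auto simp: cells_def cell_def set_replace fun_eq_iff)

lemma cells_cross:
  assumes "step n x p q" "m \<in> {p<..<q} \<inter> set x"
  shows "cells x p m (cells (replace m p x) m q b) =
    (x, (snd (cells x p q b))(m := Leave # Arrive # snd b m))"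
  using assms by (auto simp: cells_def cell_def set_replace fun_eq_iff)

lemma op_diff_gen_arr:
  assumes st: "step n x p q"
  shows "op (diff_gen n (arr n x p q)) (bas b) =
    (if fst b = replace q p x
     then \<Sum>m\<in>{p<..<q}. lin (\<lambda>u. bas (x, (snd (cells x p q b))(m := u))) (extra x p q m (snd b m))
     else 0)"
proof -
  let ?y = "replace q p x"
  let ?E = "\<lambda>m. lin (\<lambda>u. bas (x, (snd (cells x p q b))(m := u))) (extra x p q m (snd b m))"
  have x: "x \<in> vertices n" using st by (simp add: step_def)
  have mark: "op (mono_word [arr n x m q] * mono_word [arr n (replace q m x) p m]) (bas b) =
      (if fst b = ?y then ?E m else 0)" if m: "m \<in> {p<..<q} - set x" for m
  proof -
    note sm = step_mark[OF st m]
    have "op (mono_word [arr n x m q] * mono_word [arr n (replace q m x) p m]) (bas b) =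
       (if fst b = ?y then bas (cells x m q (cells (replace q m x) p m b)) else 0)"
      by (simp add: act_arr[OF sm(1)] act_arr[OF sm(2)] sm(3) cells_def)
    also have "\<dots> = (if fst b = ?y then ?E m else 0)"
      using m by (simp add: cells_mark[OF st m] extra_def)
    finally show ?thesis .
  qed
  have cross: "op (mono_word [lp n x m] * mono_word [arr n x p m] * mono_word [arr n (replace m p x) m q] +
       mono_word [arr n x p m] * mono_word [arr n (replace m p x) m q] * mono_word [lp n ?y m]) (bas b) =
      (if fst b = ?y then ?E m else 0)" if m: "m \<in> {p<..<q} \<inter> set x" for m
  proof -
    note sm = step_cross[OF st m]
    have my: "m \<in> set ?y" using m by (auto simp: set_replace)
    have mx: "m \<in> set x" using m by simp
    have 1: "op (mono_word [lp n x m] * mono_word [arr n x p m] * mono_word [arr n (replace m p x) m q]) (bas b) =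
       (if fst b = ?y then site m dot (cells x p m (cells (replace m p x) m q b)) else 0)"
      by (simp add: act_arr[OF sm(1)] act_arr[OF sm(2)] act_lp[OF x mx] sm(3) cells_def)
    have 2: "op (mono_word [arr n x p m] * mono_word [arr n (replace m p x) m q] * mono_word [lp n ?y m]) (bas b) =
       (if fst b = ?y then lin (\<lambda>u. bas (cells x p m (cells (replace m p x) m q (?y, (snd b)(m := u))))) (dot (snd b m)) else 0)"
      by (simp add: act_lp[OF step_replace[OF st] my] site_def lin_lin
          act_arr[OF sm(1)] act_arr[OF sm(2)] sm(3)) (simp add: cells_def)
    have 3: "site m dot (cells x p m (cells (replace m p x) m q b)) =
       bas (x, (snd (cells x p q b))(m := Dot # Leave # Arrive # snd b m))"
      by (simp add: cells_cross[OF st m] site_def)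
    have 4: "cells x p m (cells (replace m p x) m q (?y, (snd b)(m := u))) =
       (x, (snd (cells x p q b))(m := Leave # Arrive # u))" for u
      unfolding cells_cross[OF st m] by (auto simp: cells_def)
    show ?thesis
      unfolding op_add_left 1 2 3 4 using m by (simp add: extra_def lin_lin)
  qed
  have "op (diff_gen n (arr n x p q)) (bas b) =
      (\<Sum>m\<in>{p<..<q} - set x. if fst b = ?y then ?E m else 0) +
      (\<Sum>m\<in>{p<..<q} \<inter> set x. if fst b = ?y then ?E m else 0)"
    unfolding diff_gen_arr[OF st] op_add_left[of "sum _ _" "sum _ _"] op_sum_left
    using mark cross by simp
  also have "\<dots> = (\<Sum>m\<in>{p<..<q}. if fst b = ?y then ?E m else 0)"
    using sum.Int_Diff[of "{p<..<q}" "\<lambda>m. if fst b = ?y then ?E m else 0" "set x"]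
    by (simp add: add.commute)
  finally show ?thesis by simp
qed

lemma cfg_diff_act:
  assumes g: "g \<in> gens n" and b: "valid n b"
  shows "lin (cfg_diff n) (act g b) = op (diff_gen n g) (bas b) + lin (act g) (cfg_diff n b)"
  using g
proof (cases rule: gens_cases)
  case (Vertex x)
  then show ?thesis by (simp add: cfg_diff_def lin_act_site)
next
  case (Loop x m)
  obtain i where i: "is_loop n x i" "entry x i = m" "lp n x m = Loop x i"
    using lp_loop[OF Loop(1,2)] .
  have "lin (site k dloc) (site m dot b) = lin (site m dot) (site k dloc b)" for k
    using site_commute[of k m] by (cases "k = m") (simp_all add: site_comp dloc_dot)
  then have "lin (cfg_diff n) (site m dot b) = lin (site m dot) (cfg_diff n b)"
    by (simp add: cfg_diff_def[abs_def] lin_sum_fun)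
  then show ?thesis
    by (simp add: Loop(3) i(2,3) cfg_diff_def[of n b] lin_act_site)
next
  case (Arrow x p q)
  have "lin (act (arr n x p q)) (cfg_diff n b) =
      (if fst b = replace q p x then lin (\<lambda>b. bas (cells x p q b)) (cfg_diff n b) else 0)"
    by (simp add: cfg_diff_def lin_act_arr_site[OF Arrow(1)])
  then show ?thesis
    using cfg_diff_cells[OF Arrow(1) b]
    by (simp add: Arrow(2) act_arr[OF Arrow(1)] op_diff_gen_arr[OF Arrow(1)] add.commute)
qed

lemma diff_word_Nil [simp]: "diff_word n [] = 0"
  by (simp add: diff_word_def)

lemma diff_word_Cons:
  "diff_word n (g # gs) = diff_gen n g * mono_word gs + mono_word [g] * diff_word n gs"
proof -
  have "diff_word n (g # gs) = mono_word [] * diff_gen n g * mono_word gs +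
      (\<Sum>j<length gs. mono_word (g # take j gs) * diff_gen n (gs ! j) * mono_word (drop (Suc j) gs))"
    by (simp add: diff_word_def sum.lessThan_Suc_shift del: sum.lessThan_Suc)
  also have "(\<Sum>j<length gs. mono_word (g # take j gs) * diff_gen n (gs ! j) * mono_word (drop (Suc j) gs))
      = mono_word [g] * diff_word n gs"
    unfolding diff_word_def sum_distrib_left
    by (intro sum.cong refl) (simp add: mono_word_mult flip: mult.assoc)
  finally show ?thesis by (simp add: mono_word_Nil)
qed

lemma cfg_diff_opw:
  assumes "set gs \<subseteq> gens n" "\<And>b. b \<in> Poly_Mapping.keys z \<Longrightarrow> valid n b"
  shows "lin (cfg_diff n) (opw gs z) = op (diff_word n gs) z + opw gs (lin (cfg_diff n) z)"
  using assms(1)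
proof (induction gs)
  case (Cons g gs)
  have v: "valid n b" if b: "b \<in> Poly_Mapping.keys (opw gs z)" for b
  proof -
    have "opw gs z = lin (\<lambda>b. opw gs (bas b)) z" by (rule additive_eq_lin) simp
    then obtain k where "k \<in> Poly_Mapping.keys z" "b \<in> Poly_Mapping.keys (opw gs (bas k))"
      using b by (auto dest!: keys_lin)
    then show ?thesis using opw_valid[of gs n k b] assms(2) Cons.prems by auto
  qed
  have "lin (cfg_diff n) (opw (g # gs) z) =
      lin (\<lambda>b. op (diff_gen n g) (bas b) + lin (act g) (cfg_diff n b)) (opw gs z)"
    unfolding opw_simps lin_lin using v Cons.prems by (intro lin_cong cfg_diff_act) auto
  also have "\<dots> = op (diff_gen n g) (opw gs z) + lin (act g) (lin (cfg_diff n) (opw gs z))"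
    by (simp add: lin_add_fun lin_lin flip: op_lin_right)
  finally show ?case
    using Cons by (simp add: diff_word_Cons add.assoc)
qed simp

lemma diff_free_eq: "diff_free n f = lin (\<lambda>w. diff_word n (letters w)) f"
  by (simp add: diff_free_def lin_def)

text \<open>The sum of the empty configurations plays the role of the unit; acting on it represents an element of
  the free algebra by configurations.\<close>

definition unit_vec :: "nat \<Rightarrow> cfg \<Rightarrow>\<^sub>0 bit" where
  "unit_vec n = (\<Sum>x\<in>vertices n. bas (x, \<lambda>_. []))"

definition rep :: "nat \<Rightarrow> free \<Rightarrow> cfg \<Rightarrow>\<^sub>0 bit" where
  "rep n f = op f (unit_vec n)"

lemma keys_unit_vec: "b \<in> Poly_Mapping.keys (unit_vec n) \<Longrightarrow>
    valid n b \<and> cfg_h n b = 0 \<and> cfg_t n b = 0 \<and> snd b = (\<lambda>_. [])"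
  unfolding unit_vec_def
  using keys_sum_subset[of "\<lambda>x. bas (x, \<lambda>_. [])" "vertices n"]
  by (auto simp: valid_def cfg_h_def cfg_t_def split: if_splits)

lemma cfg_diff_unit_vec: "lin (cfg_diff n) (unit_vec n) = 0"
  by (simp add: unit_vec_def cfg_diff_def site_def)

lemma rep_add: "rep n (f + g) = rep n f + rep n g"
  by (simp add: rep_def)

lemma rep_diff:
  assumes "f \<in> carrier (free_alg n)"
  shows "rep n (diff_free n f) = lin (cfg_diff n) (rep n f)"
proof -
  have "lin (cfg_diff n) (opw (letters w) (unit_vec n)) = op (diff_word n (letters w)) (unit_vec n)"
    if "w \<in> Poly_Mapping.keys f" for w
    using cfg_diff_opw[of "letters w" n "unit_vec n"] that assms keys_unit_vec
    by (auto simp: free_alg_def cfg_diff_unit_vec)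
  then have "lin (cfg_diff n) (rep n f) = lin (\<lambda>w. op (diff_word n (letters w)) (unit_vec n)) f"
    unfolding rep_def op_def[of f] lin_lin by (intro lin_cong) auto
  also have "\<dots> = op (lin (\<lambda>w. diff_word n (letters w)) f) (unit_vec n)"
    by (simp add: op_def lin_lin)
  finally show ?thesis by (simp add: rep_def diff_free_eq)
qed

lemma keys_rep:
  assumes "f \<in> carrier (free_alg n)" "b \<in> Poly_Mapping.keys (rep n f)"
  shows "valid n b \<and> (\<exists>w\<in>Poly_Mapping.keys f.
    cfg_h n b = sum_list (map deg_h (letters w)) \<and> cfg_t n b = sum_list (map deg_t (letters w)))"
proof -
  obtain w where w: "w \<in> Poly_Mapping.keys f" "b \<in> Poly_Mapping.keys (opw (letters w) (unit_vec n))"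
    using assms(2) unfolding rep_def op_def by (auto dest!: keys_lin)
  have "opw (letters w) (unit_vec n) = lin (\<lambda>b. opw (letters w) (bas b)) (unit_vec n)"
    by (rule additive_eq_lin) simp
  then obtain k where k: "k \<in> Poly_Mapping.keys (unit_vec n)" "b \<in> Poly_Mapping.keys (opw (letters w) (bas k))"
    using w(2) by (auto dest!: keys_lin)
  have "set (letters w) \<subseteq> gens n" using assms(1) w(1) by (auto simp: free_alg_def)
  from opw_valid[OF this _ k(2)] keys_unit_vec[OF k(1)] w(1) show ?thesis by auto
qed

section \<open>Normal forms\<close>

lemma free_alg_simps [simp]:
  "mult (free_alg n) = (*)" "one (free_alg n) = 1" "zero (free_alg n) = 0" "add (free_alg n) = (+)"
  by (simp_all add: free_alg_def)

lemma carrier_free_alg: "f \<in> carrier (free_alg n) \<longleftrightarrow>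
    (\<forall>w\<in>Poly_Mapping.keys f. set (letters w) \<subseteq> gens n)"
  by (simp add: free_alg_def)

lemma carrier_mono_word [simp]: "mono_word gs \<in> carrier (free_alg n) \<longleftrightarrow> set gs \<subseteq> gens n"
  by (simp add: carrier_free_alg mono_word_def)

lemma carrier_zero [simp]: "0 \<in> carrier (free_alg n)"
  by (simp add: carrier_free_alg)

lemma carrier_one [simp]: "1 \<in> carrier (free_alg n)"
  using carrier_mono_word[of "[]" n] by (simp add: mono_word_Nil)

lemma carrier_add: "f \<in> carrier (free_alg n) \<Longrightarrow> g \<in> carrier (free_alg n) \<Longrightarrow> f + g \<in> carrier (free_alg n)"
  unfolding carrier_free_alg by (meson keys_plus)

lemma carrier_mult: "f \<in> carrier (free_alg n) \<Longrightarrow> g \<in> carrier (free_alg n) \<Longrightarrow> f * g \<in> carrier (free_alg n)"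
  unfolding carrier_free_alg by (auto simp: plus_word_def subset_eq dest!: subsetD[OF keys_mult])

lemma carrier_sum: "(\<And>s. s \<in> S \<Longrightarrow> f s \<in> carrier (free_alg n)) \<Longrightarrow> sum f S \<in> carrier (free_alg n)"
  by (induction S rule: infinite_finite_induct) (auto intro: carrier_add)

lemma ring_free_alg: "ring (free_alg n)"
proof (rule ringI)
  show "abelian_group (free_alg n)"
  proof (rule abelian_groupI)
    fix f assume "f \<in> carrier (free_alg n)"
    then show "\<exists>g\<in>carrier (free_alg n). g \<oplus>\<^bsub>free_alg n\<^esub> f = \<zero>\<^bsub>free_alg n\<^esub>"
      by (intro bexI[of _ f]) simp_all
  qed (auto simp: carrier_add add.assoc add.commute)
  show "Group.monoid (free_alg n)"
    by (rule Group.monoidI) (auto simp: carrier_mult mult.assoc)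
qed (auto simp: distrib_left distrib_right)

lemma mem_gens [simp]:
  "Vertex x \<in> gens n \<longleftrightarrow> x \<in> vertices n" "Loop x i \<in> gens n \<longleftrightarrow> is_loop n x i"
  "Arrow x i s v y \<in> gens n \<longleftrightarrow> is_arrow n x i s v y"
  by (simp_all add: gens_def)

lemma relators_carrier: "relators n \<subseteq> carrier (free_alg n)"
proof
  have ends: "is_loop n x i \<Longrightarrow> x \<in> vertices n" "is_arrow n x i s v y \<Longrightarrow> x \<in> vertices n"
    "is_arrow n x i s v y \<Longrightarrow> y \<in> vertices n" for x i s v y
    by (simp_all add: is_loop_def is_arrow_def)
  note simps = e_gen_def rho_def r_gen_def mono_word_mult ends carrier_add
  fix f assume "f \<in> relators n"
  then show "f \<in> carrier (free_alg n)"
  proof cases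
    case unit
    then show ?thesis by (auto simp: simps intro!: carrier_add carrier_sum)
  next
    case (loop_arrow x i s v y i')
    then show ?thesis using arrow_index_outside(1)[OF loop_arrow(2-4)] by (simp add: simps)
  next
    case (loop_crossing x i s v y i')
    then show ?thesis
      using arrow_index_crossing(1,2)[OF loop_crossing(2,4,5)] by (simp add: simps)
  qed (simp_all add: simps)
qed

lemma rel_ideal_ideal: "ideal (rel_ideal n) (free_alg n)"
  unfolding rel_ideal_def by (rule ring.genideal_ideal[OF ring_free_alg relators_carrier])

lemma relators_rel_ideal: "f \<in> relators n \<Longrightarrow> f \<in> rel_ideal n"
  unfolding rel_ideal_def using ring.genideal_self[OF ring_free_alg relators_carrier] by blast

lemma rel_ideal_closed: "f \<in> rel_ideal n \<Longrightarrow> f \<in> carrier (free_alg n)"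
  using ideal.Icarr[OF rel_ideal_ideal] .

lemma rel_ideal_zero [simp]: "0 \<in> rel_ideal n"
  using additive_subgroup.zero_closed[OF ideal.axioms(1)[OF rel_ideal_ideal]] by simp

lemma rel_ideal_add: "f \<in> rel_ideal n \<Longrightarrow> g \<in> rel_ideal n \<Longrightarrow> f + g \<in> rel_ideal n"
  using additive_subgroup.a_closed[OF ideal.axioms(1)[OF rel_ideal_ideal]] by simp

lemma rel_ideal_lmult: "f \<in> rel_ideal n \<Longrightarrow> g \<in> carrier (free_alg n) \<Longrightarrow> g * f \<in> rel_ideal n"
  using ideal.I_l_closed[OF rel_ideal_ideal] by simp

lemma rel_ideal_rmult: "f \<in> rel_ideal n \<Longrightarrow> g \<in> carrier (free_alg n) \<Longrightarrow> f * g \<in> rel_ideal n"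
  using ideal.I_r_closed[OF rel_ideal_ideal] by simp

lemma op_rel_ideal:
  assumes "f \<in> rel_ideal n" "\<And>b. b \<in> Poly_Mapping.keys z \<Longrightarrow> fst b \<in> vertices n"
  shows "op f z = 0"
proof -
  let ?K = "{f \<in> carrier (free_alg n). \<forall>z. (\<forall>b\<in>Poly_Mapping.keys z. fst b \<in> vertices n) \<longrightarrow> op f z = 0}"
  interpret F: ring "free_alg n" by (rule ring_free_alg)
  have "ideal ?K (free_alg n)"
  proof (rule idealI[OF ring_free_alg])
    show "subgroup ?K (add_monoid (free_alg n))"
    proof (rule F.add.subgroupI)
      show "?K \<noteq> {}" by (auto intro!: exI[of _ 0])
      fix f assume f: "f \<in> ?K"
      then have "\<ominus>\<^bsub>free_alg n\<^esub> f = f" by (intro F.minus_equality) auto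
      then show "\<ominus>\<^bsub>free_alg n\<^esub> f \<in> ?K" using f by simp
    qed (auto simp: carrier_add)
  next
    fix f g assume f: "f \<in> ?K" and g: "g \<in> carrier (free_alg n)"
    show "g \<otimes>\<^bsub>free_alg n\<^esub> f \<in> ?K" using f g by (simp add: carrier_mult)
    have "op f (op g z) = 0" if "\<forall>b\<in>Poly_Mapping.keys z. fst b \<in> vertices n" for z
      using f keys_op[OF g, of z] that by blast
    then show "f \<otimes>\<^bsub>free_alg n\<^esub> g \<in> ?K" using f g by (simp add: carrier_mult)
  qed
  moreover have "relators n \<subseteq> ?K"
  proof
    fix f assume f: "f \<in> relators n"
    have "op f z = lin (\<lambda>b. op f (bas b)) z" for z by (rule op_lin_right)
    also have "\<dots> z = lin (\<lambda>_. 0) z" if "\<forall>b\<in>Poly_Mapping.keys z. fst b \<in> vertices n" for z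
      using relators_act_zero[OF f] that by (intro lin_cong) auto
    finally show "f \<in> ?K" using f relators_carrier by auto
  qed
  ultimately have "rel_ideal n \<subseteq> ?K"
    unfolding rel_ideal_def by (rule F.genideal_minimal)
  then have "f \<in> ?K" using assms(1) by blast
  then show ?thesis using assms(2) by blast
qed

text \<open>Congruence modulo the relations.\<close>

definition eqv :: "nat \<Rightarrow> free \<Rightarrow> free \<Rightarrow> bool" where
  "eqv n f g \<longleftrightarrow> f + g \<in> rel_ideal n"

lemma eqv_refl [simp]: "eqv n f f"
  by (simp add: eqv_def)

lemma eqv_sym: "eqv n f g \<Longrightarrow> eqv n g f"
  by (simp add: eqv_def add.commute)

lemma eqv_trans [trans]: "eqv n f g \<Longrightarrow> eqv n g h \<Longrightarrow> eqv n f h"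
  unfolding eqv_def using rel_ideal_add[of "f + g" n "g + h"] by (simp add: add.assoc)

lemma eqv_Cons: "eqv n (mono_word gs) (mono_word hs) \<Longrightarrow> g \<in> gens n \<Longrightarrow>
    eqv n (mono_word (g # gs)) (mono_word (g # hs))"
  unfolding eqv_def using rel_ideal_lmult[of "mono_word gs + mono_word hs" n "mono_word [g]"]
  by (simp add: distrib_left mono_word_mult)

lemma eqv_swap:
  assumes "mono_word [g, h] + mono_word [h', g'] \<in> rel_ideal n" "set gs \<subseteq> gens n"
  shows "eqv n (mono_word (g # h # gs)) (mono_word (h' # g' # gs))"
  unfolding eqv_def using rel_ideal_rmult[OF assms(1), of "mono_word gs"] assms(2)
  by (simp add: distrib_right mono_word_mult)

subsection \<open>Commutation of loops and arrows\<close>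

lemma arrow_of_shape':
  assumes x: "x = a @ c @ q # b" and y: "y = a @ p # c @ b"
    and xv: "x \<in> vertices n" and yv: "y \<in> vertices n" and p: "p < hd (c @ [q])"
  shows "is_arrow n x (length a + 1) (length c) (map2 (\<lambda>a b. a - b - 1) (c @ [q]) (p # c)) y"
    "arr n x p q = Arrow x (length a + 1) (length c) (map2 (\<lambda>a b. a - b - 1) (c @ [q]) (p # c)) y"
proof -
  have "map (\<lambda>j. entry x j - entry y j - 1) [length a + 1..<length a + 1 + length c + 1] =
      map2 (\<lambda>a b. a - b - 1) (c @ [q]) (p # c)"
  proof (rule nth_equalityI)
    fix k assume "k < length (map (\<lambda>j. entry x j - entry y j - 1) [length a + 1..<length a + 1 + length c + 1])"
    then have k: "k < Suc (length c)" by (simp del: upt_Suc)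
    have "entry x (length a + 1 + k) = (c @ [q]) ! k"
      using k by (simp add: entry_def x nth_append)
    moreover have "entry y (length a + 1 + k) = (p # c) ! k"
      using k by (cases k) (simp_all add: entry_def y nth_append)
    ultimately show "map (\<lambda>j. entry x j - entry y j - 1) [length a + 1..<length a + 1 + length c + 1] ! k =
        map2 (\<lambda>a b. a - b - 1) (c @ [q]) (p # c) ! k"
      using k by (simp del: upt_Suc)
  qed (simp del: upt_Suc)
  then show 1: "is_arrow n x (length a + 1) (length c) (map2 (\<lambda>a b. a - b - 1) (c @ [q]) (p # c)) y"
    using arrow_of_shape[OF x y xv yv p] by simp
  have "entry y (length a + 1) = p" "entry x (length a + 1 + length c) = q"
    by (simp_all add: entry_def x y nth_append)
  then show "arr n x p q = Arrow x (length a + 1) (length c) (map2 (\<lambda>a b. a - b - 1) (c @ [q]) (p # c)) y"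
    using arr_eqI[OF 1] by simp
qed

lemma rel_lp_lp:
  assumes "x \<in> vertices n" "m \<in> set x" "m' \<in> set x" "m \<noteq> m'"
  shows "mono_word [lp n x m, lp n x m'] + mono_word [lp n x m', lp n x m] \<in> rel_ideal n"
proof -
  obtain i where i: "is_loop n x i" "entry x i = m" "lp n x m = Loop x i" using lp_loop[OF assms(1,2)] .
  obtain i' where i': "is_loop n x i'" "entry x i' = m'" "lp n x m' = Loop x i'" using lp_loop[OF assms(1,3)] .
  have "i' \<noteq> i" using i i' assms(4) by auto
  from relators.loop_loop[OF i'(1) i(1) this] show ?thesis
    by (intro relators_rel_ideal) (simp add: i i' rho_def mono_word_mult)
qed

lemma rel_lp_arr:
  assumes st: "step n x p q" and m: "m \<in> set x" "m \<noteq> q"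
  shows "mono_word [lp n x m, arr n x p q] + mono_word [arr n x p q, lp n (replace q p x) m] \<in> rel_ideal n"
proof -
  let ?y = "replace q p x"
  have x: "x \<in> vertices n" using st by (simp add: step_def)
  obtain i' where i': "is_loop n x i'" "entry x i' = m" "lp n x m = Loop x i'" using lp_loop[OF x m(1)] .
  obtain i s v where a: "is_arrow n x i s v ?y" "arr n x p q = Arrow x i s v ?y"
    "entry ?y i = p" "entry x (i + s) = q" using step_arrow[OF st] .
  consider "i' \<notin> {i..i + s}" | "i \<le> i'" "i' < i + s"
    using i'(2) a(4) m(2) by force
  then show ?thesis
  proof cases
    case 1
    have "lp n ?y m = Loop ?y i'"
      using arrow_index_outside(1,2)[OF a(1) i'(1) 1] lp_eqI[of n ?y i'] i'(2) by simp
    with relators.loop_arrow[OF a(1) i'(1) 1] show ?thesis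
      by (intro relators_rel_ideal) (simp add: a(2) i'(3) rho_def r_gen_def mono_word_mult)
  next
    case 2
    have "lp n ?y m = Loop ?y (i' + 1)"
      using arrow_index_crossing(2,3)[OF a(1) 2] lp_eqI[of n ?y "i' + 1"] i'(2) by simp
    moreover have "s > 0" using 2 by simp
    ultimately show ?thesis
      using relators.loop_crossing[OF a(1) _ 2]
      by (intro relators_rel_ideal) (simp add: a(2) i'(3) rho_def r_gen_def mono_word_mult)
  qed
qed

lemma sorted_appendI:
  "sorted_wrt (<) u \<Longrightarrow> sorted_wrt (<) v \<Longrightarrow> (\<And>a b. a \<in> set u \<Longrightarrow> b \<in> set v \<Longrightarrow> a < b) \<Longrightarrow>
     sorted_wrt (<) (u @ v)"
  by (simp add: sorted_wrt_append)

text \<open>The relation only applies if the indices and the list \<open>v\<close> of each arrow are the same at both of its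
  occurrences. This is read off from a common decomposition of the four vertices: with \<open>x\<close> equal to
  \<open>a @ c @ q # e @ c' @ q' # f\<close>, the other vertices arise by replacing \<open>c @ [q]\<close> by \<open>p # c\<close>, or
  \<open>c' @ [q']\<close> by \<open>p' # c'\<close>, or both.\<close>

lemma rel_arr_arr:
  assumes 1: "step n x p q" and 2: "step n x p' q'" and far: "q < p'"
  shows "step n (replace q p x) p' q'" "step n (replace q' p' x) p q"
    "replace q' p' (replace q p x) = replace q p (replace q' p' x)"
    "mono_word [arr n x p q, arr n (replace q p x) p' q'] +
     mono_word [arr n x p' q', arr n (replace q' p' x) p q] \<in> rel_ideal n"
proof -
  let ?y = "replace q p x" and ?w = "replace q' p' x"
  let ?z = "replace q' p' ?y"
  have d: "x \<in> vertices n" "q \<in> set x" "q' \<in> set x" "p \<notin> set x" "p' \<notin> set x" "p < q" "p' < q'"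
    "1 \<le> p" "1 \<le> p'"
    using 1 2 by (auto simp: step_def)
  show y: "step n ?y p' q'" using d far step_replace[OF 1] by (auto simp: step_def set_replace)
  show w: "step n ?w p q" using d far step_replace[OF 2] by (auto simp: step_def set_replace)
  show zz: "?z = replace q p ?w"
    using d far by (intro vertices_eqI[OF step_replace[OF y] step_replace[OF w]]) (auto simp: set_replace)
  obtain a c b where sh: "x = a @ c @ q # b" "?y = a @ p # c @ b" "p < hd (c @ [q])"
    using step_shape[OF 1] .
  have sx: "sorted_wrt (<) (a @ c @ q # b)" "set x \<subseteq> {1..n}" using d(1) sh(1) by (auto simp: vertices_iff)
  have sy: "sorted_wrt (<) (a @ p # c @ b)" using sorted_replace[of q p x] sh(2) by simp
  have small: "u \<le> q" if "u \<in> set (a @ c @ [q])" for u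
    using that sx by (auto simp: sorted_wrt_append intro: less_imp_le)
  have "q' \<in> set b" using d far small[of q'] sh(1) by fastforce
  have b: "step n b p' q'"
    using d sx \<open>q' \<in> set b\<close> by (auto simp: step_def vertices_iff sorted_wrt_append sh(1))
  obtain e c' f where sh': "b = e @ c' @ q' # f" "replace q' p' b = e @ p' # c' @ f" "p' < hd (c' @ [q'])"
    using step_shape[OF b] .
  have big: "q < u" if "u \<in> set (replace q' p' b)" for u
    using that sx far by (auto simp: set_replace sorted_wrt_append)
  have sorted_rep: "sorted_wrt (<) (e @ p' # c' @ f)" using sorted_replace[of q' p' b] sh'(2) by simp
  have big': "\<forall>u\<in>set (e @ p' # c' @ f). q < u" using big sh'(2) by simp
  have w_eq: "?w = a @ c @ q # e @ p' # c' @ f"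
  proof -
    have "sorted_wrt (<) (a @ c @ [q])" using sx by (simp add: sorted_wrt_append)
    then have "sorted_wrt (<) ((a @ c @ [q]) @ (e @ p' # c' @ f))"
      using sorted_rep le_less_trans[OF small big'[rule_format]] by (rule sorted_appendI)
    then have "sorted_wrt (<) (a @ c @ q # e @ p' # c' @ f)" by simp
    moreover have "q' \<notin> set (a @ c @ [q])" using small[of q'] d far by auto
    then have "set ?w = set ((a @ c @ [q]) @ replace q' p' b)"
      by (auto simp: set_replace sh(1))
    then have "set ?w = set (a @ c @ q # e @ p' # c' @ f)" by (simp add: sh'(2))
    ultimately show ?thesis using sorted_replace[of q' p' x] strict_sorted_equal by metis
  qed
  have z_eq: "?z = a @ p # c @ e @ p' # c' @ f"
  proof -
    have ss: "u \<le> q" if "u \<in> set (a @ p # c)" for u using that small[of u] d by auto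
    have "sorted_wrt (<) (a @ p # c)" using sy by (simp add: sorted_wrt_append)
    then have "sorted_wrt (<) ((a @ p # c) @ (e @ p' # c' @ f))"
      using sorted_rep le_less_trans[OF ss big'[rule_format]] by (rule sorted_appendI)
    then have "sorted_wrt (<) (a @ p # c @ e @ p' # c' @ f)" by simp
    moreover have "q' \<notin> set (a @ p # c)" using ss[of q'] d far by auto
    then have "set ?z = set ((a @ p # c) @ replace q' p' b)"
      unfolding set_replace[of q' p' ?y] sh(2) by (auto simp: set_replace)
    then have "set ?z = set (a @ p # c @ e @ p' # c' @ f)" by (simp add: sh'(2))
    ultimately show ?thesis using sorted_replace[of q' p' ?y] strict_sorted_equal by metis
  qed
  have x2: "x = (a @ c @ q # e) @ c' @ q' # f" and w2: "?w = (a @ c @ q # e) @ p' # c' @ f"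
    and y2: "?y = (a @ p # c @ e) @ c' @ q' # f" and z2: "?z = (a @ p # c @ e) @ p' # c' @ f"
    using sh(1) sh(2) sh'(1) w_eq z_eq by simp_all
  have w3: "?w = a @ c @ q # (e @ p' # c' @ f)" and z3: "?z = a @ p # c @ (e @ p' # c' @ f)"
    using w_eq z_eq by simp_all
  note xv = d(1) and yv = step_replace[OF 1] and wv = step_replace[OF 2] and zv = step_replace[OF y]
  note A1 = arrow_of_shape'[OF sh(1,2) xv yv sh(3)]
  note A2 = arrow_of_shape'[OF y2 z2 yv zv sh'(3)]
  note A3 = arrow_of_shape'[OF x2 w2 xv wv sh'(3)]
  note A4 = arrow_of_shape'[OF w3 z3 wv zv sh(3)]
  have len: "length (a @ p # c @ e) = length (a @ c @ q # e)" by simp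
  have ent: "entry x (length a + 1 + length c) < entry ?z (length (a @ c @ q # e) + 1)"
  proof -
    have "entry x (length a + 1 + length c) = q" unfolding sh(1) by (simp add: entry_def nth_append)
    moreover have "entry ?z (length (a @ c @ q # e) + 1) = p'"
      unfolding z2 len[symmetric] by (simp add: entry_def nth_append)
    ultimately show ?thesis using far by simp
  qed
  note rel = relators.arrow_arrow[OF A1(1) A2(1)[unfolded len] A3(1) A4(1) ent]
  show "mono_word [arr n x p q, arr n ?y p' q'] + mono_word [arr n x p' q', arr n ?w p q] \<in> rel_ideal n"
    using relators_rel_ideal[OF rel] unfolding A1(2) A2(2)[unfolded len] A3(2) A4(2)
    by (simp add: r_gen_def mono_word_mult)
qed

subsection \<open>Every valid configuration is reached by an essentially unique word\<close>

text \<open>\<open>reach n b gs\<close>: the word \<open>gs\<close> of loops and arrows, closed by one vertex, represents the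
  configuration \<open>b\<close>.\<close>

inductive reach :: "nat \<Rightarrow> cfg \<Rightarrow> gen list \<Rightarrow> bool" for n where
  base: "x \<in> vertices n \<Longrightarrow> reach n (x, \<lambda>_. []) [Vertex x]"
| loop: "reach n (x, \<tau>(m := w)) gs \<Longrightarrow> m \<in> set x \<Longrightarrow> \<not> starts_dot w \<Longrightarrow>
    reach n (x, \<tau>(m := Dot # w)) (lp n x m # gs)"
| arrow: "reach n b gs \<Longrightarrow> step n x p q \<Longrightarrow> fst b = replace q p x \<Longrightarrow>
    reach n (cells x p q b) (arr n x p q # gs)"

definition size_cfg :: "nat \<Rightarrow> cfg \<Rightarrow> nat" where
  "size_cfg n b = (\<Sum>m\<in>{1..n}. length (snd b m))"

lemma size_upd_dot: "m \<in> {1..n} \<Longrightarrow> size_cfg n (x, \<tau>(m := w)) < size_cfg n (x, \<tau>(m := a # w))"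
  by (simp add: size_cfg_def sum.remove[of _ m])

lemma length_cell: "length w \<le> length (cell x p q m w)"
  by (cases w rule: cross.cases) (auto simp: cell_def)

lemma size_cells:
  assumes "step n x p q"
  shows "size_cfg n b < size_cfg n (cells x p q b)"
proof -
  have "q \<in> {1..n}" using assms by (auto simp: step_def vertices_iff)
  moreover have "length (snd b q) < length (cell x p q q (snd b q))" by (simp add: cell_def)
  ultimately show ?thesis
    unfolding size_cfg_def cells_def snd_conv
    by (intro sum_strict_mono_ex1 ballI length_cell) blast+
qed

lemma reach_valid: "reach n b gs \<Longrightarrow> valid n b"
proof (induction rule: reach.induct)
  case (base x)
  then show ?case by (simp add: valid_def)
next
  case (loop x \<tau> m w gs)
  then show ?case by (simp add: valid_upd_dot)
next
  case (arrow b gs x p q)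
  then show ?case by (simp add: valid_cells)
qed

lemma reach_vertices: "reach n b gs \<Longrightarrow> fst b \<in> vertices n"
  using reach_valid by (auto simp: valid_def)

lemma reach_gens: "reach n b gs \<Longrightarrow> set gs \<subseteq> gens n"
proof (induction rule: reach.induct)
  case (loop x \<tau> m w gs)
  then show ?case using reach_vertices[OF loop(1)] by (simp add: gens_intros)
qed (auto simp: gens_intros)

lemma reach_opw: "reach n b gs \<Longrightarrow> opw gs (unit_vec n) = bas b"
proof (induction rule: reach.induct)
  case (base x)
  have "(\<Sum>y\<in>vertices n. act (Vertex x) (y, \<lambda>_. [])) = (\<Sum>y\<in>vertices n. if y = x then bas (x, \<lambda>_. []) else 0)"
    by (intro sum.cong) auto
  then show ?case using base finite_vertices by (simp add: unit_vec_def)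
next
  case (loop x \<tau> m w gs)
  then show ?case
    using reach_vertices[OF loop(1)] by (simp add: act_lp site_def not_starts_dot)
next
  case (arrow b gs x p q)
  then show ?case by (simp add: act_arr)
qed

lemma cross_inj: "cross u = cross v \<Longrightarrow> u = v"
  by (cases u rule: cross.cases; cases v rule: cross.cases) auto

lemma cell_inj: "cell x p q m u = cell x p q m v \<Longrightarrow> u = v"
  by (auto simp: cell_def dest: cross_inj split: if_splits)

lemma cells_inj: "cells x p q b = cells x p q b' \<Longrightarrow> snd b = snd b'"
  unfolding cells_def by (auto simp: fun_eq_iff intro: cell_inj)

lemma cell_dot:
  assumes "cell x p q m u = Dot # w" "m \<in> set x"
  obtains v where "u = Dot # v" "m \<noteq> q" "m \<noteq> p"
    "\<not> starts_dot v \<Longrightarrow> w = cell x p q m v"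
proof -
  have "u \<noteq> []" and ne: "m \<noteq> q" "m \<noteq> p" using assms by (auto simp: cell_def split: if_splits)
  then obtain a v where u: "u = a # v" by (cases u) auto
  have "a = Dot" using assms u by (cases a) (auto simp: cell_def split: if_splits)
  then show ?thesis using that[of v] assms u ne by (auto simp: cell_def not_starts_dot split: if_splits)
qed

text \<open>Every site in the interval \<open>[p, q]\<close> of the first arrow shows by its first letter that is not a \<open>Dot\<close>
  whether it is the left end, the right end or in between. So two intervals that can both come first and
  share a site are equal.\<close>

lemma cells_disjoint_or_equal:
  assumes "cells x p q b = cells x p' q' b'" "p < q" "p' < q'"
  shows "(p = p' \<and> q = q') \<or> q < p' \<or> q' < p"
proof (rule ccontr)
  assume neg: "\<not> ?thesis"
  have eq: "cell x p q m (snd b m) = cell x p' q' m (snd b' m)" for m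
    using assms(1) by (auto simp: cells_def fun_eq_iff)
  have leave: "cell x p q q u = Leave # u" "cell x p' q' q' u = Leave # u" for u
    by (simp_all add: cell_def)
  have arrive: "cell x p q p u = Arrive # u" "cell x p' q' p' u = Arrive # u" for u
    using assms by (simp_all add: cell_def)
  have inner: "cell x a c m u \<noteq> Leave # w \<and> cell x a c m u \<noteq> Arrive # w"
    if "a < m" "m < c" for a c m u w
    using that by (cases u rule: cross.cases) (auto simp: cell_def)
  have "q = q'"
  proof (rule ccontr)
    assume "q \<noteq> q'"
    then consider "q < q'" "p' \<le> q" | "q' < q" "p \<le> q'" using neg by linarith
    then show False
    proof cases
      case 1
      then show False
        using eq[of q] leave(1) arrive(2) inner[of p' q q']
        by (cases "q = p'") (simp, metis le_neq_implies_less)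
    next
      case 2
      then show False
        using eq[of q'] leave(2) arrive(1) inner[of p q' q]
        by (cases "q' = p") (simp, metis le_neq_implies_less)
    qed
  qed
  moreover have "p = p'"
  proof (rule ccontr)
    assume "p \<noteq> p'"
    then consider "p < p'" | "p' < p" by linarith
    then show False
    proof cases
      case 1
      then show False
        using eq[of p'] arrive(2) inner[of p p' q] assms(2,3) \<open>q = q'\<close> by metis
    next
      case 2
      then show False
        using eq[of p] arrive(1) inner[of p' p q'] assms(2,3) \<open>q = q'\<close> by metis
    qed
  qed
  ultimately show False using neg by simp
qed

text \<open>If two distant arrows can both come first, then removing both gives the fourth corner of a
  square.\<close>

lemma cells_square:
  assumes 1: "step n x p q" and 2: "step n x p' q'" and far: "q < p'"
    and eq: "cells x p q b = cells x p' q' b'"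
    and b: "fst b = replace q p x" and b': "fst b' = replace q' p' x"
  obtains b'' where "b = cells (replace q p x) p' q' b''" "b' = cells (replace q' p' x) p q b''"
    "fst b'' = replace q' p' (replace q p x)"
proof -
  let ?y = "replace q p x" and ?w = "replace q' p' x"
  let ?b = "(replace q' p' ?y, \<lambda>m. if p' \<le> m \<and> m \<le> q' then snd b' m else snd b m)"
  have d: "p < q" "p' < q'" using 1 2 by (auto simp: step_def)
  have eq': "cell x p q m (snd b m) = cell x p' q' m (snd b' m)" for m
    using eq by (auto simp: cells_def fun_eq_iff)
  have id: "cell x' a c m u = u" if "m < a \<or> c < m" "a < c" for x' a c m u
    using that by (auto simp: cell_def)
  have memy: "(m \<in> set ?y) = (m \<in> set x)" if "q < m" for m
    using that d by (auto simp: set_replace)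
  have memw: "(m \<in> set ?w) = (m \<in> set x)" if "m < p'" for m
    using that d by (auto simp: set_replace)
  have y: "snd b m = cell ?y p' q' m (snd ?b m)" for m
  proof (cases "p' \<le> m \<and> m \<le> q'")
    case True
    then have "snd b m = cell x p' q' m (snd b' m)"
      using eq'[of m] id[of m p q] far d by auto
    also have "\<dots> = cell ?y p' q' m (snd b' m)"
      using memy[of m] True far by (simp add: cell_def)
    finally show ?thesis using True by simp
  next
    case False
    then have "cell ?y p' q' m (snd b m) = snd b m" using d by (intro id) auto
    with False show ?thesis by auto
  qed
  have w: "snd b' m = cell ?w p q m (snd ?b m)" for m
  proof (cases "p \<le> m \<and> m \<le> q")
    case True
    then have "snd b' m = cell x p q m (snd b m)"
      using eq'[of m] id[of m p' q'] far d by auto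
    also have "\<dots> = cell ?w p q m (snd b m)"
      using memw[of m] True far by (simp add: cell_def)
    finally show ?thesis using True far by simp
  next
    case False
    then have c: "cell ?w p q m (snd ?b m) = snd ?b m" "cell x p q m (snd b m) = snd b m"
      using id[of m p q] d by (auto simp: not_le)
    show ?thesis
    proof (cases "p' \<le> m \<and> m \<le> q'")
      case True
      then show ?thesis using c by simp
    next
      case F: False
      then have "cell x p' q' m (snd b' m) = snd b' m" using id[of m p' q'] d by (auto simp: not_le)
      then show ?thesis using c eq'[of m] F by simp
    qed
  qed
  have "b = cells ?y p' q' ?b" unfolding cells_def using b y by (intro prod_eqI) auto
  moreover have "b' = cells ?w p q ?b" unfolding cells_def using b' w by (intro prod_eqI) auto
  ultimately show ?thesis using that[of ?b] by simp
qed

lemma dot_arrow_square: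
  assumes st: "step n x p q" and eq: "cells x p q b = (x, \<tau>(m := Dot # w))" and m: "m \<in> set x"
    and b: "fst b = replace q p x" and v: "valid n b" and w: "\<not> starts_dot w"
  obtains u where "b = (replace q p x, (snd b)(m := Dot # u))" "\<not> starts_dot u" "m \<noteq> q"
    "m \<in> set (replace q p x)"
    "(x, \<tau>(m := w)) = cells x p q (replace q p x, (snd b)(m := u))"
proof -
  have cell: "cell x p q k (snd b k) = (\<tau>(m := Dot # w)) k" for k
    using eq by (simp add: cells_def fun_eq_iff)
  obtain u where u: "snd b m = Dot # u" "m \<noteq> q" "m \<noteq> p" "\<not> starts_dot u \<Longrightarrow> w = cell x p q m u"
    using cell_dot[of x p q m "snd b m" w] cell[of m] m by auto
  have my: "m \<in> set (replace q p x)" using m u(2) by (simp add: set_replace)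
  have bb: "b = (replace q p x, (snd b)(m := Dot # u))"
    using b u(1) by (intro prod_eqI) (auto simp: fun_eq_iff)
  have nd: "\<not> starts_dot u" using v valid_upd_dot[OF my] bb by metis
  have "(x, \<tau>(m := w)) = cells x p q (replace q p x, (snd b)(m := u))"
  proof (intro prod_eqI ext)
    fix k
    show "snd (x, \<tau>(m := w)) k = snd (cells x p q (replace q p x, (snd b)(m := u))) k"
      using cell[of k] u(4)[OF nd] by (auto simp: cells_def)
  qed (simp add: cells_def)
  with that[OF bb nd u(2) my] show ?thesis by blast
qed

lemma cells_not_empty: "cells x p q b \<noteq> (x', \<lambda>_. [])"
proof
  assume "cells x p q b = (x', \<lambda>_. [])"
  then have "cell x p q q (snd b q) = []" by (auto simp: cells_def fun_eq_iff)
  then show False by (simp add: cell_def)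
qed

text \<open>The interval ends at the leftmost site \<open>q\<close> whose history begins with \<open>Leave\<close>. Going left from \<open>q\<close>,
  each edge is jumped over, so the next history is nonempty and begins with \<open>Cross\<close>, \<open>Mark\<close> or \<open>Arrive\<close>; the
  first \<open>Arrive\<close> is the left end.\<close>

lemma first_interval:
  assumes b: "valid n b" and nodot: "\<And>m. \<not> starts_dot (snd b m)" and ne: "snd b \<noteq> (\<lambda>_. [])"
  obtains p q where "p < q" "\<exists>u. snd b q = Leave # u" "\<exists>u. snd b p = Arrive # u"
    "\<And>m. p < m \<Longrightarrow> m < q \<Longrightarrow> \<exists>u. snd b m = Cross # u \<or> snd b m = Mark # u"
proof -
  let ?\<tau> = "snd b"
  have lr: "right_count (?\<tau> m) = left_count (?\<tau> (Suc m))" for m using b by (simp add: valid_def)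
  have out: "?\<tau> m = []" if "m \<notin> {1..n}" for m using b that by (simp add: valid_def)
  obtain m0 where "?\<tau> m0 \<noteq> []" using ne by auto
  then have fin: "finite {m. ?\<tau> m \<noteq> []}" "{m. ?\<tau> m \<noteq> []} \<noteq> {}"
    using finite_subset[of "{m. ?\<tau> m \<noteq> []}" "{1..n}"] out by blast+
  define r where "r = Max {m. ?\<tau> m \<noteq> []}"
  have r: "?\<tau> r \<noteq> []" using Max_in[OF fin] by (simp add: r_def)
  have "?\<tau> (Suc r) = []" using Max_ge[OF fin(1), of "Suc r"] by (auto simp: r_def[symmetric])
  then have "right_count (?\<tau> r) = 0" using lr[of r] by simp
  then have "\<exists>u. ?\<tau> r = Leave # u"
    using r nodot[of r] by (cases "?\<tau> r"; cases "hd (?\<tau> r)") auto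
  then have ex: "\<exists>q u. ?\<tau> q = Leave # u" by blast
  define q where "q = (LEAST q. \<exists>u. ?\<tau> q = Leave # u)"
  have q: "\<exists>u. ?\<tau> q = Leave # u" using LeastI_ex[OF ex] by (simp add: q_def)
  have least: "\<nexists>u. ?\<tau> m = Leave # u" if "m < q" for m
    using not_less_Least[of m "\<lambda>q. \<exists>u. ?\<tau> q = Leave # u"] that by (simp add: q_def)
  let ?CM = "\<lambda>m. \<exists>u. ?\<tau> m = Cross # u \<or> ?\<tau> m = Mark # u"
  let ?G = "\<exists>p<q. (\<exists>u. ?\<tau> p = Arrive # u) \<and> (\<forall>m. p < m \<and> m < q \<longrightarrow> ?CM m)"
  have alternative: "?G \<or> (\<forall>m. k \<le> m \<and> m < q \<longrightarrow> ?CM m)" if "k \<le> q" for k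
    using that
  proof (induction k rule: inc_induct)
    case base
    show ?case by (meson not_le)
  next
    case (step k)
    show ?case
    proof (cases ?G)
      case False
      then have cm: "?CM m" if "Suc k \<le> m" "m < q" for m using step that by blast
      have "left_count (?\<tau> (Suc k)) > 0"
        using cm[of "Suc k"] q step(2) by (cases "Suc k = q") auto
      then have "right_count (?\<tau> k) > 0" using lr[of k] by simp
      then have "(\<exists>u. ?\<tau> k = Arrive # u) \<or> ?CM k"
        using nodot[of k] least[OF step(2)] by (cases "?\<tau> k"; cases "hd (?\<tau> k)") auto
      then show ?thesis
      proof
        assume "\<exists>u. ?\<tau> k = Arrive # u"
        then have ?G using cm step(2) by (auto simp: Suc_le_eq intro!: exI[of _ k])
        then show ?thesis ..
      next
        assume "?CM k"
        then show ?thesis using cm by (metis Suc_leI le_neq_implies_less)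
      qed
    qed simp
  qed
  from alternative[of 0] have "?G \<or> (\<forall>m<q. ?CM m)" by simp
  moreover have "\<not> (\<forall>m<q. ?CM m)"
  proof -
    have "q > 0" using q out[of 0] by (cases q) auto
    then show ?thesis using out[of 0] by auto
  qed
  ultimately have ?G by blast
  then show ?thesis using that q by blast
qed

lemma reach_exists: "valid n b \<Longrightarrow> \<exists>gs. reach n b gs"
proof (induction "size_cfg n b" arbitrary: b rule: less_induct)
  case less
  note b = \<open>valid n b\<close>
  obtain x \<tau> where bx: "b = (x, \<tau>)" by (cases b)
  have x: "x \<in> vertices n" using b by (simp add: valid_def bx)
  have lv: "lvalid (m \<in> set x) (\<tau> m)" for m using b by (simp add: valid_def bx)
  consider "\<tau> = (\<lambda>_. [])" | m where "starts_dot (\<tau> m)"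
    | "\<tau> \<noteq> (\<lambda>_. [])" "\<And>m. \<not> starts_dot (\<tau> m)" by blast
  then show ?case
  proof cases
    case 1
    then show ?thesis using reach.base[OF x] bx by blast
  next
    case (2 m)
    then obtain w where w: "\<tau> m = Dot # w" by (cases "\<tau> m" rule: starts_dot_cases) auto
    then have m: "m \<in> set x" using lv[of m] by simp
    have bm: "b = (x, \<tau>(m := Dot # w))" using bx w by (simp add: fun_upd_idem)
    have v: "valid n (x, \<tau>(m := w))" "\<not> starts_dot w"
      using b valid_upd_dot[OF m, of n \<tau> w] bm by auto
    have "m \<in> {1..n}" using x m by (auto simp: vertices_iff)
    then have "size_cfg n (x, \<tau>(m := w)) < size_cfg n b"
      unfolding bm by (rule size_upd_dot)
    then obtain gs where "reach n (x, \<tau>(m := w)) gs" using less(1) v by blast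
    then show ?thesis using reach.loop[OF _ m v(2)] bm by blast
  next
    case 3
    obtain p q where pq: "p < q" "\<exists>u. \<tau> q = Leave # u" "\<exists>u. \<tau> p = Arrive # u"
      "\<And>m. p < m \<Longrightarrow> m < q \<Longrightarrow> \<exists>u. \<tau> m = Cross # u \<or> \<tau> m = Mark # u"
      using first_interval[OF b] 3 bx by auto
    have "q \<in> set x" "p \<notin> set x" using lv[of q] lv[of p] pq(2,3) by auto
    moreover have "1 \<le> p" using pq(3) b by (cases p) (auto simp: valid_def bx)
    ultimately have st: "step n x p q" using x pq(1) by (simp add: step_def)
    let ?b = "(replace q p x, \<lambda>m. if p \<le> m \<and> m \<le> q then tl (\<tau> m) else \<tau> m)"
    have "\<tau> m = cell x p q m (snd ?b m)" for m
    proof (cases "p < m \<and> m < q")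
      case True
      then obtain u where u: "\<tau> m = Cross # u \<or> \<tau> m = Mark # u" using pq(4) by blast
      then show ?thesis
      proof
        assume c: "\<tau> m = Cross # u"
        then have "m \<in> set x" "\<not> starts_dot u" using lv[of m] by auto
        then show ?thesis using c True by (simp add: cell_def not_starts_dot)
      next
        assume c: "\<tau> m = Mark # u"
        then have "m \<notin> set x" using lv[of m] by auto
        then show ?thesis using c True by (simp add: cell_def)
      qed
    next
      case False
      then consider "m = q" | "m = p" | "m < p \<or> q < m" by linarith
      then show ?thesis
        using pq(1-3) by cases (auto simp: cell_def)
    qed
    then have bc: "b = cells x p q ?b" unfolding bx cells_def by auto
    have v: "valid n ?b" using b valid_cells[OF st, of ?b] bc by simp
    have "size_cfg n ?b < size_cfg n b" using size_cells[OF st, of ?b] bc by simp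
    then obtain gs where "reach n ?b gs" using less(1) v by blast
    then have "reach n (cells x p q ?b) (arr n x p q # gs)" by (rule reach.arrow[OF _ st]) simp
    then show ?thesis using bc by metis
  qed
qed

lemma reach_unique:
  "reach n b gs \<Longrightarrow> reach n b hs \<Longrightarrow> eqv n (mono_word gs) (mono_word hs)"
proof (induction "size_cfg n b" arbitrary: b gs hs rule: less_induct)
  case less
  note IH = less(1)
  let ?E = "\<lambda>gs hs. eqv n (mono_word gs) (mono_word hs)"
  \<comment> \<open>Two different first letters commute, and the induction hypothesis applies to what follows each.\<close>
  have diamond: "?E (g # gs) (h # hs)"
    if gs: "reach n b1 gs" and hs: "reach n b2 hs" and g: "g \<in> gens n" and h: "h \<in> gens n"
      and s: "size_cfg n b1 < size_cfg n b" "size_cfg n b2 < size_cfg n b"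
      and ks: "reach n b1 (h' # ks)" "reach n b2 (g' # ks)"
      and rel: "mono_word [g, h'] + mono_word [h, g'] \<in> rel_ideal n"
    for g h g' h' gs hs ks b1 b2
  proof -
    have "?E (g # gs) (g # h' # ks)" using IH[OF s(1) gs ks(1)] g by (rule eqv_Cons)
    also have "?E (g # h' # ks) (h # g' # ks)"
      using rel reach_gens[OF ks(1)] by (intro eqv_swap) auto
    also have "?E (h # g' # ks) (h # hs)" using IH[OF s(2) ks(2) hs] h by (rule eqv_Cons)
    finally show ?thesis .
  qed
  have loop_arrow: "?E (lp n x m # gs) (arr n x p q # hs)"
    if b: "b = (x, \<tau>(m := Dot # w))" "b = cells x p q b2"
      and gs: "reach n (x, \<tau>(m := w)) gs" and hs: "reach n b2 hs"
      and m: "m \<in> set x" "\<not> starts_dot w" and st: "step n x p q" "fst b2 = replace q p x"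
    for x \<tau> m w p q b2 gs hs
  proof -
    have x: "x \<in> vertices n" using st by (simp add: step_def)
    obtain u where u: "b2 = (replace q p x, (snd b2)(m := Dot # u))" "\<not> starts_dot u" "m \<noteq> q"
      "m \<in> set (replace q p x)"
      "(x, \<tau>(m := w)) = cells x p q (replace q p x, (snd b2)(m := u))"
      using dot_arrow_square[OF st(1) _ m(1) st(2) reach_valid[OF hs] m(2)] b by metis
    let ?b = "(replace q p x, (snd b2)(m := u))"
    have "valid n ?b" using reach_valid[OF hs] valid_upd_dot[OF u(4)] u(1) by metis
    then obtain ks where ks: "reach n ?b ks" using reach_exists by blast
    have "m \<in> {1..n}" using x m by (auto simp: vertices_iff)
    then have s1: "size_cfg n (x, \<tau>(m := w)) < size_cfg n b" unfolding b(1) by (rule size_upd_dot)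
    have s2: "size_cfg n b2 < size_cfg n b" unfolding b(2) using st(1) by (rule size_cells)
    have k1: "reach n (x, \<tau>(m := w)) (arr n x p q # ks)"
      unfolding u(5) using ks st(1) by (rule reach.arrow) simp
    have k2: "reach n b2 (lp n (replace q p x) m # ks)"
      by (subst u(1)) (rule reach.loop[OF ks u(4,2)])
    show ?thesis
      using diamond[OF gs hs _ _ s1 s2 k1 k2 rel_lp_arr[OF st(1) m(1) u(3)]] x m st
      by (simp add: gens_intros)
  qed
  have arrow_arrow: "?E (arr n x p q # gs) (arr n x p' q' # hs)"
    if b: "b = cells x p q b1" "b = cells x p' q' b2"
      and gs: "reach n b1 gs" and hs: "reach n b2 hs"
      and st: "step n x p q" "fst b1 = replace q p x" "step n x p' q'" "fst b2 = replace q' p' x"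
      and far: "q < p'"
    for x p q p' q' b1 b2 gs hs
  proof -
    have eq: "cells x p q b1 = cells x p' q' b2" using b by simp
    obtain b' where b': "b1 = cells (replace q p x) p' q' b'" "b2 = cells (replace q' p' x) p q b'"
      "fst b' = replace q' p' (replace q p x)"
      using cells_square[OF st(1,3) far eq st(2,4)] .
    note rel = rel_arr_arr[OF st(1,3) far]
    have "valid n b'" using reach_valid[OF gs] valid_cells[OF rel(1) b'(3)] b'(1) by simp
    then obtain ks where ks: "reach n b' ks" using reach_exists by blast
    have s1: "size_cfg n b1 < size_cfg n b" unfolding b(1) using st(1) by (rule size_cells)
    have s2: "size_cfg n b2 < size_cfg n b" unfolding b(2) using st(3) by (rule size_cells)
    have k1: "reach n b1 (arr n (replace q p x) p' q' # ks)"
      unfolding b'(1) using ks rel(1) b'(3) by (rule reach.arrow)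
    have k2: "reach n b2 (arr n (replace q' p' x) p q # ks)"
      unfolding b'(2) using ks rel(2) b'(3)[unfolded rel(3)] by (rule reach.arrow)
    show ?thesis
      using diamond[OF gs hs _ _ s1 s2 k1 k2 rel(4)] st by (simp add: gens_intros)
  qed
  from \<open>reach n b gs\<close> show ?case
  proof cases
    case (base x)
    from \<open>reach n b hs\<close> show ?thesis
    proof cases
      case base2: (base y)
      then show ?thesis using base by simp
    next
      case (loop y \<tau> m w hs')
      then have "(\<lambda>_. []) = \<tau>(m := Dot # w)" using base by simp
      then show ?thesis by (metis fun_upd_same list.distinct(1))
    next
      case (arrow b2 hs' y p q)
      then show ?thesis using base cells_not_empty by metis
    qed
  next
    case 1: (loop x \<tau> m w gs')
    from \<open>reach n b hs\<close> show ?thesis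
    proof cases
      case (base y)
      then have "(\<lambda>_. []) = \<tau>(m := Dot # w)" using 1 by simp
      then show ?thesis by (metis fun_upd_same list.distinct(1))
    next
      case 2: (loop y \<sigma> m' w' hs')
      have eq: "\<tau>(m := Dot # w) = \<sigma>(m' := Dot # w')" and y: "y = x" using 1 2 by auto
      have x: "x \<in> vertices n" using reach_vertices[OF 1(3)] by simp
      have mn: "m \<in> {1..n}" "m' \<in> {1..n}" using x 1(4) 2(4) y by (auto simp: vertices_iff)
      have s1: "size_cfg n (x, \<tau>(m := w)) < size_cfg n b" unfolding 1(1) using mn(1) by (rule size_upd_dot)
      have s2: "size_cfg n (y, \<sigma>(m' := w')) < size_cfg n b" unfolding 2(1) using mn(2) by (rule size_upd_dot)
      show ?thesis
      proof (cases "m = m'")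
        case True
        have "w = w'" using fun_cong[OF eq, of m] True by simp
        moreover have "\<tau>(m := w) = \<sigma>(m' := w')"
          using eq True \<open>w = w'\<close> by (metis fun_upd_upd)
        ultimately have "?E gs' hs'" using IH[OF s1 1(3)] 2(3) y by simp
        then show ?thesis
          unfolding 1(2) 2(2) y using True x 1(4) by (auto intro!: eqv_Cons gens_intros)
      next
        case False
        let ?\<tau> = "\<tau>(m := w, m' := w')"
        have t1: "\<tau>(m := w) = ?\<tau>(m' := Dot # w')"
        proof
          fix k show "(\<tau>(m := w)) k = (?\<tau>(m' := Dot # w')) k"
            using fun_cong[OF eq, of k] False by (auto split: if_splits)
        qed
        have t2: "\<sigma>(m' := w') = ?\<tau>(m := Dot # w)"
        proof
          fix k show "(\<sigma>(m' := w')) k = (?\<tau>(m := Dot # w)) k"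
            using fun_cong[OF eq, of k] False by (auto split: if_splits)
        qed
        have m': "m' \<in> set x" using 2(4) y by simp
        have tm': "?\<tau>(m' := w') = ?\<tau>" by simp
        have tm: "?\<tau>(m := w) = ?\<tau>" using False by (simp add: fun_upd_idem)
        have "valid n (x, ?\<tau>(m' := w'))"
          using reach_valid[OF 1(3)] valid_upd_dot[OF m', of n ?\<tau> w'] t1 by simp
        then obtain ks where ks: "reach n (x, ?\<tau>) ks" using reach_exists tm' by metis
        have k1: "reach n (x, \<tau>(m := w)) (lp n x m' # ks)"
        proof (subst t1, rule reach.loop[OF _ m' 2(5)])
          show "reach n (x, ?\<tau>(m' := w')) ks" using ks by (simp only: tm')
        qed
        have k2: "reach n (y, \<sigma>(m' := w')) (lp n x m # ks)"
        proof (subst t2, subst y, rule reach.loop[OF _ 1(4,5)])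
          show "reach n (x, ?\<tau>(m := w)) ks" using ks by (simp only: tm)
        qed
        show ?thesis
          unfolding 1(2) 2(2) y
          by (rule diamond[OF 1(3) 2(3) _ _ s1 s2 k1 k2 rel_lp_lp[OF x 1(4) m' False]])
            (use x 1(4) m' in \<open>auto intro: gens_intros\<close>)
      qed
    next
      case 2: (arrow b2 hs' y p q)
      have "y = x" using 1 2 by (auto simp: cells_def)
      then show ?thesis unfolding 1(2) 2(2)
        using loop_arrow[OF 1(1) 2(1)[unfolded \<open>y = x\<close>] 1(3) 2(3) 1(4,5)] 2(4,5) by simp
    qed
  next
    case 1: (arrow b1 gs' x p q)
    from \<open>reach n b hs\<close> show ?thesis
    proof cases
      case (base y)
      then show ?thesis using 1 cells_not_empty by metis
    next
      case 2: (loop y \<tau> m w hs')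
      have "x = y" using 1 2 by (auto simp: cells_def)
      then show ?thesis unfolding 1(2) 2(2)
        using loop_arrow[OF 2(1) 1(1)[unfolded \<open>x = y\<close>] 2(3) 1(3) 2(4,5)] 1(4,5) by (simp add: eqv_sym)
    next
      case 2: (arrow b2 hs' y p' q')
      have y: "y = x" using 1(1) 2(1) by (auto simp: cells_def)
      note 2 = 2[unfolded y]
      have pq: "p < q" "p' < q'" using 1(4) 2(4) by (auto simp: step_def)
      have eq: "cells x p q b1 = cells x p' q' b2" using 1(1) 2(1) by simp
      consider "p = p'" "q = q'" | "q < p'" | "q' < p"
        using cells_disjoint_or_equal[OF eq pq] by blast
      then show ?thesis
      proof cases
        case e: 1
        have "b1 = b2" using cells_inj[of x p q b1 b2] eq e 1(5) 2(5) by (intro prod_eqI) auto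
        moreover have "size_cfg n b1 < size_cfg n b" unfolding 1(1) using 1(4) by (rule size_cells)
        ultimately have "?E gs' hs'" using IH 1(3) 2(3) by blast
        then show ?thesis unfolding 1(2) 2(2) e using 2(4) by (intro eqv_Cons gens_intros)
      next
        case e: 2
        show ?thesis unfolding 1(2) 2(2)
          by (rule arrow_arrow[OF 1(1) 2(1) 1(3) 2(3) 1(4,5) 2(4,5) e])
      next
        case e: 3
        show ?thesis unfolding 1(2) 2(2)
          by (rule eqv_sym, rule arrow_arrow[OF 2(1) 1(1) 2(3) 1(3) 2(4,5) 1(4,5) e])
      qed
    qed
  qed
qed

subsection \<open>The algebra has the valid configurations as a basis\<close>

text \<open>A chosen word for a valid configuration; \<open>sec\<close> is a linear section of \<open>rep\<close>.\<close>

definition nf :: "nat \<Rightarrow> cfg \<Rightarrow> gen list" where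
  "nf n b = (SOME gs. reach n b gs)"

definition sec :: "nat \<Rightarrow> (cfg \<Rightarrow>\<^sub>0 bit) \<Rightarrow> free" where
  "sec n z = lin (\<lambda>b. mono_word (nf n b)) z"

lemma reach_nf: "valid n b \<Longrightarrow> reach n b (nf n b)"
  unfolding nf_def using reach_exists by (blast intro: someI)

lemma eqv_add: "eqv n f f' \<Longrightarrow> eqv n g g' \<Longrightarrow> eqv n (f + g) (f' + g')"
  unfolding eqv_def using rel_ideal_add[of "f + f'" n "g + g'"] by (simp add: ac_simps)

lemma eqv_lmult: "eqv n f g \<Longrightarrow> h \<in> carrier (free_alg n) \<Longrightarrow> eqv n (h * f) (h * g)"
  unfolding eqv_def using rel_ideal_lmult[of "f + g" n h] by (simp add: distrib_left)

lemma eqv_rmult: "eqv n f g \<Longrightarrow> h \<in> carrier (free_alg n) \<Longrightarrow> eqv n (f * h) (g * h)"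
  unfolding eqv_def using rel_ideal_rmult[of "f + g" n h] by (simp add: distrib_right)

lemma eqv_zero: "eqv n f 0 \<longleftrightarrow> f \<in> rel_ideal n"
  by (simp add: eqv_def)

lemma eqv_sum: "(\<And>s. s \<in> S \<Longrightarrow> eqv n (f s) (g s)) \<Longrightarrow> eqv n (sum f S) (sum g S)"
  by (induction S rule: infinite_finite_induct) (auto intro: eqv_add)

fun source :: "gen \<Rightarrow> nat list" where
  "source (Vertex x) = x" | "source (Loop x i) = x" | "source (Arrow x i s v y) = x"

fun target :: "gen \<Rightarrow> nat list" where
  "target (Vertex x) = x" | "target (Loop x i) = x" | "target (Arrow x i s v y) = y"

lemma source_target_vertices: "g \<in> gens n \<Longrightarrow> source g \<in> vertices n \<and> target g \<in> vertices n"
  by (cases g) (auto simp: is_loop_def is_arrow_def)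

lemma e_gen_carrier: "x \<in> vertices n \<Longrightarrow> e_gen x \<in> carrier (free_alg n)"
  by (simp add: e_gen_def)

lemma e_gen_idem: "x \<in> vertices n \<Longrightarrow> eqv n (e_gen x * e_gen x) (e_gen x)"
  unfolding eqv_def using relators_rel_ideal[OF relators.idem] by simp

lemma e_gen_orth: "x \<in> vertices n \<Longrightarrow> y \<in> vertices n \<Longrightarrow> x \<noteq> y \<Longrightarrow> eqv n (e_gen x * e_gen y) 0"
  unfolding eqv_zero using relators_rel_ideal[OF relators.orth] by simp

lemma gen_ends:
  assumes "g \<in> gens n"
  shows "eqv n (mono_word [g]) (e_gen (source g) * mono_word [g] * e_gen (target g))"
proof (cases g)
  case (Vertex x)
  then have x: "x \<in> vertices n" using assms by simp
  have "eqv n (e_gen x * (e_gen x * e_gen x)) (e_gen x * e_gen x)"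
    by (rule eqv_lmult[OF e_gen_idem[OF x] e_gen_carrier[OF x]])
  also have "eqv n (e_gen x * e_gen x) (e_gen x)" by (rule e_gen_idem[OF x])
  finally show ?thesis using Vertex by (simp add: eqv_sym e_gen_def[of x, symmetric] mult.assoc)
next
  case (Loop x i)
  then show ?thesis
    using assms relators_rel_ideal[OF relators.loop_ends, of n x i] by (simp add: eqv_def rho_def)
next
  case (Arrow x i s v y)
  then show ?thesis
    using assms relators_rel_ideal[OF relators.arrow_ends, of n x i s v y] by (simp add: eqv_def r_gen_def)
qed

lemma e_gen_left:
  assumes "g \<in> gens n"
  shows "eqv n (e_gen (source g) * mono_word [g]) (mono_word [g])"
proof -
  let ?x = "e_gen (source g)" and ?y = "e_gen (target g)" and ?g = "mono_word [g]"
  note v = source_target_vertices[OF assms]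
  have c: "?x \<in> carrier (free_alg n)" "?y \<in> carrier (free_alg n)" "?g \<in> carrier (free_alg n)"
    using v assms by (simp_all add: e_gen_carrier)
  have "eqv n (?x * ?g) (?x * (?x * ?g * ?y))" by (rule eqv_lmult[OF gen_ends[OF assms] c(1)])
  also have "\<dots> = ?x * ?x * (?g * ?y)" by (simp add: mult.assoc)
  also have "eqv n (?x * ?x * (?g * ?y)) (?x * (?g * ?y))"
    using v c by (intro eqv_rmult e_gen_idem carrier_mult) auto
  also have "?x * (?g * ?y) = ?x * ?g * ?y" by (simp add: mult.assoc)
  also have "eqv n (?x * ?g * ?y) ?g" by (rule eqv_sym[OF gen_ends[OF assms]])
  finally show ?thesis .
qed

lemma e_gen_right:
  assumes "g \<in> gens n" "y \<in> vertices n" "y \<noteq> target g"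
  shows "eqv n (mono_word [g] * e_gen y) 0"
proof -
  let ?x = "e_gen (source g)" and ?t = "e_gen (target g)" and ?g = "mono_word [g]"
  note v = source_target_vertices[OF assms(1)]
  have c: "?x \<in> carrier (free_alg n)" "?t \<in> carrier (free_alg n)" "?g \<in> carrier (free_alg n)"
    using v assms by (simp_all add: e_gen_carrier)
  have "eqv n (?g * e_gen y) (?x * ?g * ?t * e_gen y)"
    by (rule eqv_rmult[OF gen_ends[OF assms(1)] e_gen_carrier[OF assms(2)]])
  also have "\<dots> = ?x * ?g * (?t * e_gen y)" by (simp add: mult.assoc)
  also have "eqv n \<dots> (?x * ?g * 0)"
    using v c assms by (intro eqv_lmult e_gen_orth carrier_mult) auto
  finally show ?thesis by simp
qed

lemma reach_source: "reach n b gs \<Longrightarrow> \<exists>g hs. gs = g # hs \<and> source g = fst b"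
proof (induction rule: reach.induct)
  case (loop x \<tau> m w gs)
  then show ?case by (simp add: lp_def)
next
  case (arrow b gs x p q)
  obtain i s v where "arr n x p q = Arrow x i s v (replace q p x)"
    using step_arrow[OF arrow(2)] by metis
  then show ?case by (simp add: cells_def)
qed simp

lemma e_gen_reach:
  assumes "reach n b gs"
  shows "eqv n (e_gen (fst b) * mono_word gs) (mono_word gs)"
proof -
  obtain g hs where g: "gs = g # hs" "source g = fst b" using reach_source[OF assms] by blast
  have "g \<in> gens n" "set hs \<subseteq> gens n" using reach_gens[OF assms] g by auto
  then have "eqv n (e_gen (fst b) * mono_word [g] * mono_word hs) (mono_word [g] * mono_word hs)"
    using e_gen_left[of g n] g by (intro eqv_rmult) auto
  then show ?thesis by (simp add: g mult.assoc mono_word_mult)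
qed

lemma gen_reach_zero:
  assumes g: "g \<in> gens n" and gs: "reach n b gs" and ne: "fst b \<noteq> target g"
  shows "eqv n (mono_word (g # gs)) 0"
proof -
  have b: "fst b \<in> vertices n" by (rule reach_vertices[OF gs])
  have gc: "mono_word [g] \<in> carrier (free_alg n)" "mono_word gs \<in> carrier (free_alg n)"
    using g reach_gens[OF gs] by simp_all
  have "mono_word (g # gs) = mono_word [g] * mono_word gs" by (simp add: mono_word_mult)
  also have "eqv n \<dots> (mono_word [g] * (e_gen (fst b) * mono_word gs))"
    by (intro eqv_lmult gc eqv_sym[OF e_gen_reach[OF gs]])
  also have "\<dots> = mono_word [g] * e_gen (fst b) * mono_word gs" by (simp add: mult.assoc)
  also have "eqv n \<dots> (0 * mono_word gs)" by (intro eqv_rmult e_gen_right g b ne gc)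
  finally show ?thesis by simp
qed

lemma sec_bas [simp]: "sec n (bas b) = mono_word (nf n b)"
  by (simp add: sec_def)

lemma sec_zero [simp]: "sec n 0 = 0"
  by (simp add: sec_def)

lemma gen_sec:
  assumes g: "g \<in> gens n" and b: "valid n b"
  shows "eqv n (mono_word (g # nf n b)) (sec n (act g b))"
proof -
  have r: "reach n b (nf n b)" using b by (rule reach_nf)
  have uniq: "eqv n (mono_word gs) (mono_word (nf n b'))" if "reach n b' gs" for b' gs
    using reach_unique[OF that reach_nf[OF reach_valid[OF that]]] .
  show ?thesis
  proof (cases "fst b = target g")
    case False
    then have "act g b = 0" by (cases g) auto
    then show ?thesis using gen_reach_zero[OF g r False] by simp
  next
    case True
    from g show ?thesis
    proof (cases rule: gens_cases)
      case (Vertex x)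
      then show ?thesis
        using True e_gen_reach[OF r] by (simp add: e_gen_def mono_word_mult)
    next
      case (Loop x m)
      have x: "fst b = x" using True Loop by (simp add: lp_def)
      have act: "act g b = site m dot b" using Loop x by (simp add: act_lp)
      show ?thesis
      proof (cases "snd b m" rule: starts_dot_cases)
        case (dot w)
        have bm: "b = (x, (snd b)(m := Dot # w))" using x dot by (intro prod_eqI) auto
        then have v: "valid n (x, (snd b)(m := w))" "\<not> starts_dot w"
          using b valid_upd_dot[OF Loop(2), of n "snd b" w] by auto
        define gs where "gs = nf n (x, (snd b)(m := w))"
        have gs: "reach n (x, (snd b)(m := w)) gs" unfolding gs_def using v(1) by (rule reach_nf)
        have gc: "mono_word gs \<in> carrier (free_alg n)" using reach_gens[OF gs] by simp
        have "reach n (x, (snd b)(m := Dot # w)) (g # gs)"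
          unfolding Loop(3) by (rule reach.loop[OF gs Loop(2) v(2)])
        then have "reach n b (g # gs)" using bm by simp
        then have "eqv n (mono_word (nf n b)) (mono_word (g # gs))" using uniq eqv_sym by blast
        then have "eqv n (mono_word (g # nf n b)) (mono_word (g # g # gs))" using g by (rule eqv_Cons)
        also have "mono_word (g # g # gs) = mono_word [g] * mono_word [g] * mono_word gs"
          by (simp add: mono_word_mult)
        also have "eqv n \<dots> (0 * mono_word gs)"
        proof (intro eqv_rmult gc)
          obtain i where "is_loop n x i" "g = Loop x i" using lp_loop[OF Loop(1,2)] Loop(3) by metis
          then show "eqv n (mono_word [g] * mono_word [g]) 0"
            unfolding eqv_zero using relators_rel_ideal[OF relators.loop_square, of n x i]
            by (simp add: rho_def)
        qed
        finally show ?thesis by (simp add: act site_zero dot)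
      next
        case other
        have "b = (x, (snd b)(m := snd b m))" using x by (intro prod_eqI) auto
        then have "reach n (x, (snd b)(m := snd b m)) (nf n b)" using r by simp
        then have "reach n (x, (snd b)(m := Dot # snd b m)) (g # nf n b)"
          unfolding Loop(3) using Loop(2) other by (rule reach.loop)
        moreover have "act g b = bas (x, (snd b)(m := Dot # snd b m))"
          using other x by (simp add: act site_def not_starts_dot)
        ultimately show ?thesis using uniq by simp
      qed
    next
      case (Arrow x p q)
      obtain i s v where "arr n x p q = Arrow x i s v (replace q p x)"
        using step_arrow[OF Arrow(1)] by metis
      then have y: "fst b = replace q p x" using True Arrow(2) by simp
      have "reach n (cells x p q b) (g # nf n b)"
        unfolding Arrow(2) by (rule reach.arrow[OF r Arrow(1) y])
      then show ?thesis using uniq y by (simp add: Arrow(2) act_arr[OF Arrow(1)])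
    qed
  qed
qed

lemma sec_carrier:
  assumes "\<And>b. b \<in> Poly_Mapping.keys z \<Longrightarrow> valid n b"
  shows "sec n z \<in> carrier (free_alg n)"
  unfolding sec_def lin_def using reach_gens[OF reach_nf[OF assms]] by (intro carrier_sum) simp

lemma opw_valid_lin:
  assumes "set gs \<subseteq> gens n" "\<And>b. b \<in> Poly_Mapping.keys z \<Longrightarrow> valid n b"
    "b' \<in> Poly_Mapping.keys (opw gs z)"
  shows "valid n b'"
proof -
  have "opw gs z = lin (\<lambda>b. opw gs (bas b)) z" by (rule additive_eq_lin) simp
  then obtain k where "k \<in> Poly_Mapping.keys z" "b' \<in> Poly_Mapping.keys (opw gs (bas k))"
    using assms(3) by (auto dest!: keys_lin)
  then show ?thesis using opw_valid[OF assms(1), of k b'] assms(2) by auto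
qed

lemma mono_word_sec:
  assumes "set gs \<subseteq> gens n" "\<And>b. b \<in> Poly_Mapping.keys z \<Longrightarrow> valid n b"
  shows "eqv n (mono_word gs * sec n z) (sec n (opw gs z))"
  using assms(1)
proof (induction gs)
  case Nil
  then show ?case by (simp add: mono_word_Nil)
next
  case (Cons g gs)
  let ?z = "opw gs z"
  have g: "g \<in> gens n" using Cons.prems by simp
  have v: "valid n b" if "b \<in> Poly_Mapping.keys ?z" for b
    using opw_valid_lin[OF _ assms(2) that] Cons.prems by simp
  have "mono_word (g # gs) * sec n z = mono_word [g] * (mono_word gs * sec n z)"
    by (simp add: mono_word_mult flip: mult.assoc)
  also have "eqv n \<dots> (mono_word [g] * sec n ?z)"
    using Cons g by (intro eqv_lmult) auto
  also have "mono_word [g] * sec n ?z = (\<Sum>b\<in>Poly_Mapping.keys ?z. mono_word (g # nf n b))"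
    by (simp add: sec_def lin_def sum_distrib_left mono_word_mult)
  also have "eqv n \<dots> (\<Sum>b\<in>Poly_Mapping.keys ?z. sec n (act g b))"
    using g v by (intro eqv_sum gen_sec) auto
  also have "\<dots> = sec n (opw (g # gs) z)"
    unfolding sec_def lin_lin opw_simps by (simp add: lin_def[of _ ?z])
  finally show ?case .
qed

text \<open>The section commutes with left multiplication by generators up to congruence (\<open>gen_sec\<close>), and it
  sends the unit to an element congruent to \<open>1\<close>. So every element is congruent to the one rebuilt from its
  configurations.\<close>

lemma sec_rep:
  assumes "f \<in> carrier (free_alg n)"
  shows "eqv n f (sec n (rep n f))"
proof -
  have vu: "valid n b" if "b \<in> Poly_Mapping.keys (unit_vec n)" for b
    using keys_unit_vec[OF that] by simp
  have "sec n (unit_vec n) = (\<Sum>x\<in>vertices n. mono_word (nf n (x, \<lambda>_. [])))"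
    by (simp add: sec_def unit_vec_def)
  also have "eqv n \<dots> (\<Sum>x\<in>vertices n. e_gen x)"
  proof (rule eqv_sum)
    fix x assume "x \<in> vertices n"
    from reach.base[OF this] have r: "reach n (x, \<lambda>_. []) [Vertex x]" .
    show "eqv n (mono_word (nf n (x, \<lambda>_. []))) (e_gen x)"
      unfolding e_gen_def using reach_unique[OF reach_nf[OF reach_valid[OF r]] r] .
  qed
  also have "eqv n (\<Sum>x\<in>vertices n. e_gen x) 1"
    unfolding eqv_def using relators_rel_ideal[OF relators.unit] by simp
  finally have one: "eqv n 1 (sec n (unit_vec n))" by (rule eqv_sym)
  have "eqv n (f * 1) (f * sec n (unit_vec n))" using one assms by (rule eqv_lmult)
  also have "f * sec n (unit_vec n) = (\<Sum>w\<in>Poly_Mapping.keys f. mono_word (letters w) * sec n (unit_vec n))"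
    using sum_bas_keys[of f] by (simp add: bas_mono_word flip: sum_distrib_right)
  also have "eqv n \<dots> (\<Sum>w\<in>Poly_Mapping.keys f. sec n (opw (letters w) (unit_vec n)))"
    using assms vu by (intro eqv_sum mono_word_sec) (auto simp: carrier_free_alg)
  also have "\<dots> = sec n (rep n f)"
    unfolding rep_def op_def sec_def lin_lin by (simp add: lin_def[of _ f])
  finally show ?thesis by simp
qed

theorem rel_ideal_iff:
  assumes "f \<in> carrier (free_alg n)"
  shows "f \<in> rel_ideal n \<longleftrightarrow> rep n f = 0"
proof
  assume "f \<in> rel_ideal n"
  then show "rep n f = 0"
    unfolding rep_def using keys_unit_vec by (intro op_rel_ideal) (auto simp: valid_def)
next
  assume "rep n f = 0"
  then show "f \<in> rel_ideal n" using sec_rep[OF assms] by (simp add: eqv_zero)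
qed

lemma rep_sec:
  assumes "\<And>b. b \<in> Poly_Mapping.keys z \<Longrightarrow> valid n b"
  shows "rep n (sec n z) = z"
proof -
  have "rep n (sec n z) = lin (\<lambda>b. opw (nf n b) (unit_vec n)) z"
    unfolding rep_def sec_def lin_def[of _ z] by (simp add: op_sum_left)
  also have "\<dots> = lin bas z"
    using reach_opw[OF reach_nf[OF assms]] by (intro lin_cong) auto
  finally show ?thesis by simp
qed

section \<open>The differential graded algebra\<close>

lemma diff_free_add: "diff_free n (f + g) = diff_free n f + diff_free n g"
  by (simp add: diff_free_eq)

lemma diff_free_mono_word [simp]: "diff_free n (mono_word gs) = diff_word n gs"
  by (simp add: diff_free_eq mono_word_def)

lemma diff_word_append:
  "diff_word n (gs @ hs) = diff_word n gs * mono_word hs + mono_word gs * diff_word n hs"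
proof (induction gs)
  case Nil
  then show ?case by (simp add: mono_word_Nil)
next
  case (Cons g gs)
  have "mono_word (g # gs) = mono_word [g] * mono_word gs" by (simp add: mono_word_mult)
  then show ?case
    by (simp add: diff_word_Cons Cons distrib_left distrib_right mono_word_mult[symmetric] add.assoc mult.assoc)
qed

lemma diff_free_mult: "diff_free n (f * g) = diff_free n f * g + f * diff_free n g"
proof (induction f rule: bas_induct)
  case (add k f)
  have "diff_free n (bas k * g) = diff_free n (bas k) * g + bas k * diff_free n g"
  proof (induction g rule: bas_induct)
    case (add l g)
    have "diff_free n (bas k * bas l) = diff_free n (bas k) * bas l + bas k * diff_free n (bas l)"
      by (simp add: bas_mono_word mono_word_mult diff_word_append)
    then show ?case using add by (simp add: distrib_left diff_free_add ac_simps)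
  qed (simp add: diff_free_eq)
  then show ?case using add by (simp add: distrib_right diff_free_add ac_simps)
qed (simp add: diff_free_eq)

lemma diff_gen_carrier:
  assumes "g \<in> gens n"
  shows "diff_gen n g \<in> carrier (free_alg n)"
  using assms
proof (cases rule: gens_cases)
  case (Arrow x p q)
  have x: "x \<in> vertices n" "replace q p x \<in> vertices n"
    using Arrow(1) step_replace by (auto simp: step_def)
  have mark: "mono_word [arr n x m q] * mono_word [arr n (replace q m x) p m] \<in> carrier (free_alg n)"
    if "m \<in> {p<..<q} - set x" for m
    using step_mark[OF Arrow(1) that] by (simp add: carrier_mult gens_intros)
  have cross: "mono_word [lp n x m] * mono_word [arr n x p m] * mono_word [arr n (replace m p x) m q] +
      mono_word [arr n x p m] * mono_word [arr n (replace m p x) m q] * mono_word [lp n (replace q p x) m]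
      \<in> carrier (free_alg n)" if m: "m \<in> {p<..<q} \<inter> set x" for m
  proof -
    have "m \<in> set x" "m \<in> set (replace q p x)" using m by (auto simp: set_replace)
    then show ?thesis
      using step_cross[OF Arrow(1) m] x by (simp add: carrier_mult carrier_add gens_intros)
  qed
  show ?thesis
    unfolding Arrow(2) diff_gen_arr[OF Arrow(1)]
    by (rule carrier_add[OF carrier_sum carrier_sum]) (erule mark, erule cross)
qed simp_all

lemma diff_free_carrier:
  assumes "f \<in> carrier (free_alg n)"
  shows "diff_free n f \<in> carrier (free_alg n)"
proof -
  have "diff_word n gs \<in> carrier (free_alg n)" if "set gs \<subseteq> gens n" for gs
    using that
    by (induction gs) (auto simp: diff_word_Cons intro!: carrier_add carrier_mult diff_gen_carrier)
  then show ?thesis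
    unfolding diff_free_def using assms by (intro carrier_sum) (auto simp: carrier_free_alg)
qed

lemma rep_diff_diff:
  assumes "f \<in> carrier (free_alg n)"
  shows "rep n (diff_free n (diff_free n f)) = 0"
  using keys_rep[OF assms]
  by (simp add: rep_diff diff_free_carrier assms cfg_diff_square_lin)

text \<open>The bidegrees of words and of configurations, and the part of an element supported where a predicate
  holds.\<close>

definition bideg :: "word \<Rightarrow> int \<times> int" where
  "bideg w = (sum_list (map deg_h (letters w)), sum_list (map deg_t (letters w)))"

definition cfg_bideg :: "nat \<Rightarrow> cfg \<Rightarrow> int \<times> int" where
  "cfg_bideg n b = (cfg_h n b, cfg_t n b)"

definition part :: "('a \<Rightarrow> bool) \<Rightarrow> ('a \<Rightarrow>\<^sub>0 bit) \<Rightarrow> 'a \<Rightarrow>\<^sub>0 bit" where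
  "part P = lin (\<lambda>k. if P k then bas k else 0)"

lemma part_add [simp]: "part P (f + g) = part P f + part P g"
  by (simp add: part_def)

lemma keys_part: "Poly_Mapping.keys (part P f) = {k \<in> Poly_Mapping.keys f. P k}"
proof -
  have "Poly_Mapping.lookup (part P f) k = (if P k then Poly_Mapping.lookup f k else 0)" for k
    by (induction f rule: bas_induct)
      (auto simp: part_def lookup_add lookup_single when_def)
  then show ?thesis by (auto simp: in_keys_iff split: if_splits)
qed

lemma part_id:
  assumes "\<And>k. k \<in> Poly_Mapping.keys f \<Longrightarrow> P k"
  shows "part P f = f"
proof -
  have "part P f = lin bas f" unfolding part_def using assms by (intro lin_cong) auto
  then show ?thesis by simp
qed

lemma part_zero:
  assumes "\<And>k. k \<in> Poly_Mapping.keys f \<Longrightarrow> \<not> P k"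
  shows "part P f = 0"
proof -
  have "part P f = lin (\<lambda>_. 0) f" unfolding part_def using assms by (intro lin_cong) auto
  then show ?thesis by simp
qed

lemma free_homog_iff: "f \<in> free_homog n h t \<longleftrightarrow> f \<in> carrier (free_alg n) \<and>
    (\<forall>w\<in>Poly_Mapping.keys f. bideg w = (h, t))"
  by (auto simp: free_homog_def bideg_def)

lemma finsum_free_alg:
  assumes "finite S" "\<And>s. s \<in> S \<Longrightarrow> f s \<in> carrier (free_alg n)"
  shows "(\<Oplus>\<^bsub>free_alg n\<^esub>s\<in>S. f s) = (\<Sum>s\<in>S. f s)"
proof -
  interpret F: ring "free_alg n" by (rule ring_free_alg)
  show ?thesis using assms
  proof (induction S rule: finite_induct)
    case (insert a S)
    then have "finsum (free_alg n) f (insert a S) = f a + finsum (free_alg n) f S"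
      by (subst F.finsum_insert) auto
    then show ?case using insert by simp
  qed simp
qed

lemma graded_free_alg:
  "graded_group (free_alg n) (\<lambda>(h, t). free_homog n h t) (\<lambda>p. part (\<lambda>w. bideg w = p))"
proof -
  interpret F: ring "free_alg n" by (rule ring_free_alg)
  let ?pr = "\<lambda>p. part (\<lambda>w. bideg w = p)"
  show ?thesis
  proof (intro graded_group.intro graded_group_axioms.intro F.abelian_group_axioms)
    fix p :: "int \<times> int"
    obtain h t where p: "p = (h, t)" by (cases p)
    have "subgroup (free_homog n h t) (add_monoid (free_alg n))"
    proof (rule F.add.subgroupI)
      have "0 \<in> free_homog n h t" by (simp add: free_homog_iff)
      then show "free_homog n h t \<noteq> {}" by blast
      show "free_homog n h t \<subseteq> carrier (free_alg n)" by (auto simp: free_homog_iff)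
      fix f assume f: "f \<in> free_homog n h t"
      then have "\<ominus>\<^bsub>free_alg n\<^esub> f = f" by (intro F.minus_equality) (auto simp: free_homog_iff)
      then show "\<ominus>\<^bsub>free_alg n\<^esub> f \<in> free_homog n h t" using f by simp
      fix g assume "g \<in> free_homog n h t"
      then show "f \<oplus>\<^bsub>free_alg n\<^esub> g \<in> free_homog n h t"
        using f by (auto simp: free_homog_iff carrier_add dest!: keys_plus)
    qed
    then show "additive_subgroup (case p of (h, t) \<Rightarrow> free_homog n h t) (free_alg n)"
      by (simp add: p additive_subgroup_def)
  next
    fix f and p :: "int \<times> int" assume "f \<in> carrier (free_alg n)"
    then show "?pr p f \<in> (case p of (h, t) \<Rightarrow> free_homog n h t)"
      by (cases p) (auto simp: free_homog_iff carrier_free_alg keys_part)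
  next
    fix f g and p :: "int \<times> int"
    show "?pr p (f \<oplus>\<^bsub>free_alg n\<^esub> g) = ?pr p f \<oplus>\<^bsub>free_alg n\<^esub> ?pr p g" by simp
  next
    fix f and p :: "int \<times> int" assume "f \<in> (case p of (h, t) \<Rightarrow> free_homog n h t)"
    then show "?pr p f = f" by (cases p) (auto simp: free_homog_iff intro: part_id)
  next
    fix f and p q :: "int \<times> int" assume "f \<in> (case p of (h, t) \<Rightarrow> free_homog n h t)" "q \<noteq> p"
    then show "?pr q f = \<zero>\<^bsub>free_alg n\<^esub>"
      by (cases p) (auto simp: free_homog_iff intro!: part_zero)
  next
    fix f assume f: "f \<in> carrier (free_alg n)"
    have sub: "{p. ?pr p f \<noteq> 0} \<subseteq> bideg ` Poly_Mapping.keys f"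
    proof
      fix p assume p: "p \<in> {p. ?pr p f \<noteq> 0}"
      show "p \<in> bideg ` Poly_Mapping.keys f"
        using part_zero[of f "\<lambda>w. bideg w = p"] p by blast
    qed
    then show fin: "finite {p. ?pr p f \<noteq> \<zero>\<^bsub>free_alg n\<^esub>}"
      by (simp add: finite_subset)
    have "(\<Sum>p\<in>{p. ?pr p f \<noteq> 0}. ?pr p f) = (\<Sum>p\<in>bideg ` Poly_Mapping.keys f. ?pr p f)"
      using sub by (intro sum.mono_neutral_left) auto
    also have "\<dots> = (\<Sum>w\<in>Poly_Mapping.keys f. \<Sum>p\<in>bideg ` Poly_Mapping.keys f. if bideg w = p then bas w else 0)"
      unfolding part_def lin_def by (rule sum.swap)
    also have "\<dots> = (\<Sum>w\<in>Poly_Mapping.keys f. bas w)"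
      by (intro sum.cong refl) (simp add: sum.delta')
    finally have "(\<Sum>p\<in>{p. ?pr p f \<noteq> 0}. ?pr p f) = f" by (simp add: sum_bas_keys)
    moreover have "?pr p f \<in> carrier (free_alg n)" for p
      using f by (auto simp: carrier_free_alg keys_part)
    ultimately show "f = (\<Oplus>\<^bsub>free_alg n\<^esub>p\<in>{p. ?pr p f \<noteq> \<zero>\<^bsub>free_alg n\<^esub>}. ?pr p f)"
      using fin by (simp add: finsum_free_alg)
  qed
qed

text \<open>In particular the ideal of relations is homogeneous.\<close>

lemma rep_part:
  assumes "f \<in> carrier (free_alg n)"
  shows "rep n (part (\<lambda>w. bideg w = p) f) = part (\<lambda>b. cfg_bideg n b = p) (rep n f)"
  using assms
proof (induction f rule: bas_induct)
  case zero
  show ?case by (simp add: part_def rep_def)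
next
  case (add w f)
  have keys: "Poly_Mapping.keys (bas w + f) = insert w (Poly_Mapping.keys f)"
    using add(1) by (auto simp: in_keys_iff lookup_add lookup_single when_def split: if_splits)
  have w: "bas w \<in> carrier (free_alg n)" and f: "f \<in> carrier (free_alg n)"
    using add(3) by (auto simp: carrier_free_alg keys)
  have bd: "cfg_bideg n b = bideg w" if "b \<in> Poly_Mapping.keys (rep n (bas w))" for b
    using keys_rep[OF w that] by (simp add: cfg_bideg_def bideg_def)
  have "rep n (part (\<lambda>w. bideg w = p) (bas w)) = part (\<lambda>b. cfg_bideg n b = p) (rep n (bas w))"
  proof (cases "bideg w = p")
    case True
    then show ?thesis using bd part_id[of "rep n (bas w)"] by (simp add: part_def[of _ ] )
  next
    case False
    then have "part (\<lambda>b. cfg_bideg n b = p) (rep n (bas w)) = 0"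
      using bd by (intro part_zero) auto
    then show ?thesis using False by (simp add: part_def[of "\<lambda>w. bideg w = p"] rep_def)
  qed
  then show ?case using add(2)[OF f] by (simp add: rep_add)
qed

lemma free_homog_mult:
  "f \<in> free_homog n h t \<Longrightarrow> g \<in> free_homog n h' t' \<Longrightarrow> f * g \<in> free_homog n (h + h') (t + t')"
  unfolding free_homog_iff
  by (auto simp: carrier_mult bideg_def plus_word_def dest!: subsetD[OF keys_mult])

lemma sec_homog:
  assumes "\<And>b. b \<in> Poly_Mapping.keys z \<Longrightarrow> valid n b \<and> cfg_bideg n b = (h, t)"
  shows "sec n z \<in> free_homog n h t"
proof -
  have v: "valid n b" if "b \<in> Poly_Mapping.keys z" for b using assms that by blast
  have "bideg w = (h, t)" if w: "w \<in> Poly_Mapping.keys (sec n z)" for w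
  proof -
    obtain b where b: "b \<in> Poly_Mapping.keys z" "w = Word (nf n b)"
      using w by (auto simp: sec_def mono_word_def dest!: keys_lin split: if_splits)
    have r: "reach n b (nf n b)" using v[OF b(1)] by (rule reach_nf)
    have "mono_word (nf n b) \<in> carrier (free_alg n)" using reach_gens[OF r] by simp
    moreover have "b \<in> Poly_Mapping.keys (rep n (mono_word (nf n b)))"
      using reach_opw[OF r] by (simp add: rep_def)
    ultimately have "cfg_bideg n b = bideg w"
      using keys_rep[of "mono_word (nf n b)" n b] b(2) by (simp add: mono_word_def bideg_def cfg_bideg_def)
    then show ?thesis using assms[OF b(1)] by simp
  qed
  then show ?thesis using sec_carrier[OF v] by (simp add: free_homog_iff)
qed

lemma keys_rep_homog:
  assumes "f \<in> free_homog n h t" "b \<in> Poly_Mapping.keys (rep n f)"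
  shows "valid n b \<and> cfg_bideg n b = (h, t)"
  using assms keys_rep[of f n b] by (auto simp: free_homog_iff bideg_def cfg_bideg_def)

lemma coset_eq_iff_rep:
  assumes "f \<in> carrier (free_alg n)" "g \<in> carrier (free_alg n)"
  shows "rel_ideal n +>\<^bsub>free_alg n\<^esub> f = rel_ideal n +>\<^bsub>free_alg n\<^esub> g \<longleftrightarrow> rep n f = rep n g"
proof -
  interpret F: ring "free_alg n" by (rule ring_free_alg)
  interpret I: ideal "rel_ideal n" "free_alg n" by (rule rel_ideal_ideal)
  have "rel_ideal n +>\<^bsub>free_alg n\<^esub> f = rel_ideal n +>\<^bsub>free_alg n\<^esub> g \<longleftrightarrow> f + g \<in> rel_ideal n"
    using F.coset_eq_iff_char_two[OF I.additive_subgroup_axioms _ assms] by simp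
  then show ?thesis
    using assms by (simp add: rel_ideal_iff carrier_add rep_add pm_eq_iff_sum_zero[of "rep n f"])
qed

lemma R_alg_simps:
  shows carrier_R_alg: "carrier (R_alg n) = (+>\<^bsub>free_alg n\<^esub>) (rel_ideal n) ` carrier (free_alg n)"
    and zero_R_alg: "\<zero>\<^bsub>R_alg n\<^esub> = rel_ideal n"
    and homog_R_alg: "homog (R_alg n) h t = (+>\<^bsub>free_alg n\<^esub>) (rel_ideal n) ` free_homog n h t"
  by (auto simp: R_alg_def FactRing_def A_RCOSETS_def')

lemma diff_coset:
  assumes "f \<in> carrier (free_alg n)"
  shows "(\<Union>g\<in>rel_ideal n +>\<^bsub>free_alg n\<^esub> f. rel_ideal n +>\<^bsub>free_alg n\<^esub> diff_free n g) =
    rel_ideal n +>\<^bsub>free_alg n\<^esub> diff_free n f"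
proof -
  have "rel_ideal n +>\<^bsub>free_alg n\<^esub> diff_free n g = rel_ideal n +>\<^bsub>free_alg n\<^esub> diff_free n f"
    if g: "g \<in> rel_ideal n +>\<^bsub>free_alg n\<^esub> f" for g
  proof -
    obtain i where i: "i \<in> rel_ideal n" "g = i + f" using g by (auto simp: a_r_coset_def')
    then have ic: "i \<in> carrier (free_alg n)" by (intro rel_ideal_closed)
    have "rep n g = rep n f"
      using i ic by (simp add: rep_add rel_ideal_iff)
    then show ?thesis
      using assms ic i by (subst coset_eq_iff_rep) (simp_all add: rep_diff diff_free_carrier carrier_add)
  qed
  moreover have "f \<in> rel_ideal n +>\<^bsub>free_alg n\<^esub> f"
    using rel_ideal_zero[of n] by (force simp: a_r_coset_def')
  ultimately show ?thesis by blast
qed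

lemma diff_R_alg:
  "f \<in> carrier (free_alg n) \<Longrightarrow> diff (R_alg n) (rel_ideal n +>\<^bsub>free_alg n\<^esub> f) =
     rel_ideal n +>\<^bsub>free_alg n\<^esub> diff_free n f"
  using diff_coset by (simp add: R_alg_def)

text \<open>The bidegree of the differential is read off from configurations: a differential is congruent to
  the section of its configurations, which is homogeneous.\<close>

theorem tdg_algebra_R_alg: "tdg_algebra (R_alg n)"
  unfolding R_alg_def
proof (rule quotient_tdg_algebra[OF rel_ideal_ideal graded_free_alg, where d = "diff_free n"])
  fix p and f assume "f \<in> rel_ideal n"
  then have f: "f \<in> carrier (free_alg n)" "rep n f = 0"
    using rel_ideal_closed rel_ideal_iff by blast+
  have "part (\<lambda>w. bideg w = p) f \<in> carrier (free_alg n)"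
    using f(1) by (auto simp: carrier_free_alg keys_part)
  then show "part (\<lambda>w. bideg w = p) f \<in> rel_ideal n"
    using f by (simp add: rel_ideal_iff rep_part) (simp add: part_def)
next
  fix f h t assume f: "f \<in> free_homog n h t"
  have fc: "f \<in> carrier (free_alg n)" using f by (simp add: free_homog_iff)
  let ?z = "rep n (diff_free n f)"
  have z: "valid n b \<and> cfg_bideg n b = (h + 1, t)" if b: "b \<in> Poly_Mapping.keys ?z" for b
  proof -
    obtain k where k: "k \<in> Poly_Mapping.keys (rep n f)" "b \<in> Poly_Mapping.keys (cfg_diff n k)"
      using b fc by (auto simp: rep_diff dest!: keys_lin)
    show ?thesis
      using keys_rep_homog[OF f k(1)] valid_cfg_diff[OF _ k(2)] by (simp add: cfg_bideg_def)
  qed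
  have "rel_ideal n +>\<^bsub>free_alg n\<^esub> diff_free n f = rel_ideal n +>\<^bsub>free_alg n\<^esub> sec n ?z"
    using z fc by (subst coset_eq_iff_rep) (auto simp: diff_free_carrier sec_carrier rep_sec)
  then show "rel_ideal n +>\<^bsub>free_alg n\<^esub> diff_free n f \<in>
      (+>\<^bsub>free_alg n\<^esub>) (rel_ideal n) ` free_homog n (h + 1) t"
    using sec_homog[OF z] by simp
next
  fix f assume f: "f \<in> carrier (free_alg n)"
  show "diff_free n (diff_free n f) \<in> rel_ideal n"
    using f by (simp add: rel_ideal_iff rep_diff_diff diff_free_carrier)
next
  show "\<one>\<^bsub>free_alg n\<^esub> \<in> free_homog n 0 0"
    by (simp add: free_homog_iff) (simp add: bideg_def zero_word_def flip: single_one)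
qed (simp_all add: free_homog_mult diff_free_carrier diff_free_add diff_free_mult diff_coset)

theorem quasi_iso_R_alg: "\<exists>f. quasi_iso (R_alg n) (cohomology (R_alg n)) f"
proof -
  interpret R: tdg_algebra "R_alg n" by (rule tdg_algebra_R_alg)
  have "quasi_iso (R_alg n) (cohomology (R_alg n))
      (\<lambda>X. coboundaries (R_alg n) +>\<^bsub>R_alg n\<^esub> R.diagonal X)"
  proof (rule R.formality_criterion)
    fix h t :: int and X assume ht: "t < h" and X: "X \<in> homog (R_alg n) h t"
    obtain f where f: "f \<in> free_homog n h t" "X = rel_ideal n +>\<^bsub>free_alg n\<^esub> f"
      using X by (auto simp: homog_R_alg)
    have fc: "f \<in> carrier (free_alg n)" using f by (simp add: free_homog_iff)
    have "b \<notin> Poly_Mapping.keys (rep n f)" for b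
      using keys_rep_homog[OF f(1), of b] cfg_h_le_t[of n b] ht by (auto simp: cfg_bideg_def)
    then have "rep n f = 0" by (metis ex_in_conv keys_eq_empty)
    then have "X = rel_ideal n +>\<^bsub>free_alg n\<^esub> 0"
      unfolding f(2) using fc by (subst coset_eq_iff_rep) (simp_all add: rep_def)
    moreover have "rel_ideal n +>\<^bsub>free_alg n\<^esub> 0 = rel_ideal n"
      by (auto simp: a_r_coset_def')
    ultimately show "X = \<zero>\<^bsub>R_alg n\<^esub>" by (simp add: zero_R_alg)
  next
    fix h t :: int and X
    assume ht: "h < t" and X: "X \<in> homog (R_alg n) h t" and dX: "diff (R_alg n) X = \<zero>\<^bsub>R_alg n\<^esub>"
    obtain f where f: "f \<in> free_homog n h t" "X = rel_ideal n +>\<^bsub>free_alg n\<^esub> f"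
      using X by (auto simp: homog_R_alg)
    have fc: "f \<in> carrier (free_alg n)" using f by (simp add: free_homog_iff)
    have "rel_ideal n +>\<^bsub>free_alg n\<^esub> diff_free n f = rel_ideal n"
      using dX fc by (simp add: f(2) diff_R_alg zero_R_alg)
    also have "rel_ideal n = rel_ideal n +>\<^bsub>free_alg n\<^esub> 0" by (auto simp: a_r_coset_def')
    finally have "rep n (diff_free n f) = 0"
      using fc by (subst (asm) coset_eq_iff_rep) (simp_all add: diff_free_carrier rep_def)
    then have "lin (cfg_diff n) (rep n f) = 0" using fc by (simp add: rep_diff)
    moreover have "valid n b \<and> cfg_h n b < cfg_t n b" if "b \<in> Poly_Mapping.keys (rep n f)" for b
      using keys_rep_homog[OF f(1) that] ht by (simp add: cfg_bideg_def)
    ultimately obtain y where y: "\<forall>b\<in>Poly_Mapping.keys y. valid n b" "lin (cfg_diff n) y = rep n f"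
      using exact_below_diagonal by blast
    have sc: "sec n y \<in> carrier (free_alg n)" using y(1) by (intro sec_carrier) auto
    have "rep n (sec n y) = y" using y(1) by (intro rep_sec) auto
    then have "rep n (diff_free n (sec n y)) = rep n f" using sc y(2) by (simp add: rep_diff)
    then have "X = diff (R_alg n) (rel_ideal n +>\<^bsub>free_alg n\<^esub> sec n y)"
      unfolding f(2) diff_R_alg[OF sc] using sc fc
      by (subst coset_eq_iff_rep) (simp_all add: diff_free_carrier)
    then show "X \<in> coboundaries (R_alg n)"
      using sc by (auto simp: coboundaries_def carrier_R_alg)
  qed
  then show ?thesis by blast
qed

theorem lemma5p14:
  fixes n :: nat
  assumes "n > 0"
  shows "quasi_isomorphic (R_alg n) (cohomology (R_alg n))"
  unfolding quasi_isomorphic_def quasi_iso_link_def using quasi_iso_R_alg by blast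

end
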